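(* There exist absolute constants $K>0$ and $x_0>0$ such that for all $x\ge x_0$ and all $q\in[0,1]$, \[ \mathbb{E}\bigg\{\bigg(\frac{1}{\log x}\int_0^1\big|F_x(1/2+ih)\big|^2\,\mathrm{d}h\bigg)^q\bigg\}\le K\,\big(\sqrt{\log\log x}\,(1-q)+1\big)^{-q}. \]
   Context: Let $(Z_p)_p$ be i.i.d. random variables indexed by the primes, each uniformly distributed on the complex unit circle, and let $f$ be the Steinhaus random multiplicative function, i.e. the completely multiplicative function $f:\mathbb{N}\to\mathbb{C}$ with $f(p)=Z_p$ for $p$ prime. For $x>0$ and complex $s$, $F_x(s):=\prod_{p\le x}(1-f(p)p^{-s})^{-1}$ is the associated random Euler product truncated at $x$ (product over primes). *)

theory Defs
  imports "HOL-Probability.Probability" "HOL-Computational_Algebra.Primes"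
begin

definition uniform_circle :: "complex measure" where
  "uniform_circle = distr (uniform_measure lborel {0..2 * pi}) borel cis"

text \<open>The value at \<^term>\<open>0::nat\<close> is left unconstrained: arithmetic functions live on the
  positive integers.\<close>

definition completely_multiplicative :: "(nat \<Rightarrow> complex) \<Rightarrow> bool" where
  "completely_multiplicative g \<longleftrightarrow>
     g 1 = 1 \<and> (\<forall>m n. m > 0 \<longrightarrow> n > 0 \<longrightarrow> g (m * n) = g m * g n)"

text \<open>Only the members of the family \<^term>\<open>Z :: nat \<Rightarrow> 'a \<Rightarrow> complex\<close> with prime index
  carry any meaning.\<close>

locale steinhaus = prob_space M
  for M :: "'a measure" and Z :: "nat \<Rightarrow> 'a \<Rightarrow> complex" and f :: "nat \<Rightarrow> 'a \<Rightarrow> complex" +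
  assumes indep: "indep_vars (\<lambda>_. borel) Z {p. prime p}"
    and uniform: "\<And>p. prime p \<Longrightarrow> distr M borel (Z p) = uniform_circle"
    and multiplicative: "\<And>\<omega>. \<omega> \<in> space M \<Longrightarrow> completely_multiplicative (\<lambda>n. f n \<omega>)"
    and at_prime: "\<And>p \<omega>. prime p \<Longrightarrow> \<omega> \<in> space M \<Longrightarrow> f p \<omega> = Z p \<omega>"

definition euler_product :: "(nat \<Rightarrow> complex) \<Rightarrow> real \<Rightarrow> complex \<Rightarrow> complex" where
  "euler_product g x s =
     (\<Prod>p | prime p \<and> real p \<le> x. inverse (1 - g p * of_nat p powr (- s)))"

end

(*
  Normalise M = (1/W) int_0^1 |F(1/2+ih)|^2 dh with W = E|F|^2, which is of order log x.  For one h, under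
  the measure with density |F|^2/W, log|F| is a sum of independent increments whose mean over p <= k is
  log W_k, and its variance is of order log W_k <= log log x + O(1).  Optional stopping for the martingale
  |F_k|^(2+l), normalised, with l = 1/sqrt(u) and u = 1 + log W bounds the mass of the paths staying
  below the barrier exp(A) W_k (1 + log W_k) by O((A+1)/sqrt u).

  The barrier is violated somewhere with probability O(exp(-2A)): by Sobolev, |F_k|^2 is at most
  int_0^1 |F_k^2| + |(F_k^2)'| dh, a submartingale in k because F_k^2 and (F_k^2)' are martingales; its mean
  is O(W_k^2), and a maximal inequality with the growing thresholds (exp(A) W_k (1 + log W_k))^2 applies.

  With A of order 1/(1-q), Hoelder on the exceptional event gives, for y(q) = (E M^q)^(1/q),
  y(q) <= K/((1-q) sqrt u) + y((1+q)/2)/4.  Since 1 - (1+q)/2 = (1-q)/2, multiplying by (1-q) sqrt u turns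
  this into a contraction, so y(q) = O(1/((1-q) sqrt u)) for 1/2 <= q < 1.
*)
theory Submission
  imports Defs "HOL-Complex_Analysis.Complex_Analysis"
begin

section \<open>Sums and products over primes\<close>

text \<open>Jensen's inequality alone gives only E M^q <= 1, because rare paths carry the mass E M =
  1; the barrier isolates them. Under the tilted measure the barrier runs along the mean of the
  path, so staying below it is a ballot event for a centred walk. The increments are not Gaussian:
  in place of a central limit theorem stands a lower bound for the moment of order 2 + l of one
  Euler factor, with a gain 1 + l^2 r^2 / 8 over the matching power of its second moment. The factor
  1 + log W_k in the barrier is a compromise: without it the maximal inequality would sum to order
  log W; with it the barrier is raised only logarithmically, and the ballot estimate absorbs that by
  a bootstrap. F^2 and its h-derivative are analytic in each variable, and the mean of an analytic
  function is its value at 0, so they are martingales without normalisation. Independence is used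
  only as factorisation of E(Y phi(X_{n+1})) for Y measurable in the past; no conditional
  expectation is formed.\<close>

lemma prod_prime_factors_le:
  fixes m :: nat
  assumes "m > 0"
  shows "\<Prod>(prime_factors m) \<le> m"
proof -
  have "(\<Prod>p\<in>prime_factors m. p) \<le> (\<Prod>p\<in>prime_factors m. p ^ multiplicity p m)"
    by (intro prod_mono) (auto simp: prime_factors_multiplicity prime_gt_0_nat intro!: self_le_power Suc_leI)
  also have "\<dots> = m"
    using assms by (metis prime_factorization_nat)
  finally show ?thesis .
qed

text \<open>Double counting of the pairs \<open>p dvd m\<close> with \<open>m \<le> n\<close>,
  weighted by \<open>ln p\<close>: each \<open>m\<close> contributes the logarithm of its radical,
  at most \<open>ln n\<close>, and each prime has \<open>n div p\<close> multiples. As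
  \<open>p \<le> n\<close>, rounding down loses at most a factor 2, the factor in the bound.\<close>

lemma sum_ln_prime_div_prime_le:
  assumes "n \<ge> 1"
  shows "(\<Sum>p | prime p \<and> p \<le> n. ln (real p) / real p) \<le> 2 * ln (real n)"
proof -
  let ?P = "{p. prime p \<and> p \<le> n}"
  have fin: "finite ?P" by simp
  have "(\<Sum>p\<in>?P. ln (real p) / real p) * (real n / 2) = (\<Sum>p\<in>?P. ln (real p) * (real n / (2 * real p)))"
    by (simp add: sum_distrib_right)
  also have "\<dots> \<le> (\<Sum>p\<in>?P. ln (real p) * real (card {m\<in>{1..n}. p dvd m}))"
  proof (intro sum_mono mult_left_mono)
    fix p assume p: "p \<in> ?P"
    then have p0: "p > 0" by (auto simp: prime_gt_0_nat)
    have inj: "inj_on (\<lambda>j. p * j) {1..n div p}"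
      using p0 by (auto simp: inj_on_def)
    have "n div p = card ((\<lambda>j. p * j) ` {1..n div p})"
      using card_image[OF inj] by simp
    also have "\<dots> \<le> card {m\<in>{1..n}. p dvd m}"
    proof (rule card_mono)
      show "(\<lambda>j. p * j) ` {1..n div p} \<subseteq> {m\<in>{1..n}. p dvd m}"
      proof safe
        fix j assume j: "j \<in> {1..n div p}"
        then have "p * j \<le> p * (n div p)" by simp
        also have "\<dots> \<le> n" by simp
        finally show "p * j \<in> {1..n}" using p0 j by auto
      qed simp
    qed simp
    finally have c: "n div p \<le> card {m\<in>{1..n}. p dvd m}" .
    have "n < p * (n div p) + p"
      using p0 by (metis add.commute dividend_less_times_div mult.commute mult_Suc_right)
    moreover have "n div p \<ge> 1" using p p0 by (simp add: Suc_leI div_greater_zero_iff)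
    then have "p \<le> p * (n div p)" by simp
    ultimately have "n \<le> 2 * p * (n div p)" by linarith
    then have "real n \<le> 2 * real p * real (n div p)"
      by (metis of_nat_le_iff of_nat_mult of_nat_numeral)
    also have "\<dots> \<le> 2 * real p * real (card {m\<in>{1..n}. p dvd m})"
      using c p0 by (intro mult_left_mono) auto
    finally show "real n / (2 * real p) \<le> real (card {m\<in>{1..n}. p dvd m})"
      using p0 by (simp add: field_simps)
  next
    fix p assume p: "p \<in> ?P"
    then show "0 \<le> ln (real p)" using prime_ge_1_nat[of p] by auto
  qed
  also have "\<dots> = (\<Sum>p\<in>?P. \<Sum>m\<in>{m\<in>{1..n}. p dvd m}. ln (real p))"
    by (simp add: mult.commute)
  also have "\<dots> = (\<Sum>m\<in>{1..n}. \<Sum>p\<in>{p\<in>?P. p dvd m}. ln (real p))"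
    by (rule sum.swap_restrict) auto
  also have "\<dots> \<le> (\<Sum>m\<in>{1..n}. ln (real n))"
  proof (rule sum_mono)
    fix m assume m: "m \<in> {1..n}"
    have pf: "{p\<in>?P. p dvd m} = prime_factors m"
      using m by (auto simp: prime_factors_dvd dest: dvd_imp_le)
    have "(\<Sum>p\<in>{p\<in>?P. p dvd m}. ln (real p)) = ln (\<Prod>p\<in>prime_factors m. real p)"
      unfolding pf by (subst ln_prod) (auto intro: prime_gt_0_nat in_prime_factors_imp_prime)
    also have "(\<Prod>p\<in>prime_factors m. real p) = real (\<Prod>(prime_factors m))" by simp
    also have "ln \<dots> \<le> ln (real n)"
    proof -
      have "\<Prod>(prime_factors m) \<le> n" using prod_prime_factors_le[of m] m by auto
      moreover have "\<Prod>(prime_factors m) > 0"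
        by (intro prod_pos) (auto intro: prime_gt_0_nat in_prime_factors_imp_prime)
      ultimately show ?thesis
        using m by (subst ln_le_cancel_iff) (auto simp del: of_nat_prod)
    qed
    finally show "(\<Sum>p\<in>{p\<in>?P. p dvd m}. ln (real p)) \<le> ln (real n)" .
  qed
  also have "\<dots> = real n * ln (real n)" by simp
  finally show ?thesis using assms by (simp add: field_simps)
qed

text \<open>Unique factorisation \<open>n = p ^ j * m\<close> with \<open>p\<close> not dividing
  \<open>m\<close> turns the sum for \<open>insert p P\<close> into a geometric series times the sum
  for \<open>P\<close>. Any \<open>s > 0\<close> is admissible since only finitely many primes
  occur.\<close>

lemma has_sum_prime_support:
  fixes s :: real
  assumes "finite P" "\<And>p. p \<in> P \<Longrightarrow> prime p" "s > 0"
  shows "((\<lambda>n. real n powr -s) has_sum (\<Prod>p\<in>P. 1 / (1 - real p powr -s)))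
           {n. n > 0 \<and> prime_factors n \<subseteq> P}"
  using assms
proof (induction P rule: finite_induct)
  case empty
  have "{n::nat. n > 0 \<and> prime_factors n \<subseteq> {}} = {1}"
    by (auto simp: prime_factorization_empty_iff)
  then show ?case using has_sum_finite[of "{1::nat}" "\<lambda>n. real n powr -s"] by simp
next
  case (insert p P)
  define S where "S Q = {n::nat. n > 0 \<and> prime_factors n \<subseteq> Q}" for Q
  have pr: "prime p" using insert by auto
  have p1: "real p > 1" using prime_gt_1_nat[OF pr] by simp
  define y where "y = real p powr -s"
  have y: "0 < y" "y < 1" using p1 insert.prems by (auto simp: y_def powr_less_one)
  have IH: "((\<lambda>n. real n powr -s) has_sum (\<Prod>p\<in>P. 1 / (1 - real p powr -s))) (S P)"
    using insert unfolding S_def by auto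
  define c where "c = (\<Prod>p\<in>P. 1 / (1 - real p powr -s))"
  have geo: "((\<lambda>j. y ^ j) has_sum (1 / (1 - y))) UNIV"
    using y by (intro sums_nonneg_imp_has_sum geometric_sums) auto
  have inner: "((\<lambda>m. y ^ j * real m powr -s) has_sum (y ^ j * c)) (S P)" for j
    using has_sum_cmult_right[OF IH] by (simp add: c_def)
  have outer: "((\<lambda>j. y ^ j * c) has_sum (1 / (1 - y) * c)) UNIV"
    by (rule has_sum_cmult_left[OF geo])
  have "((\<lambda>(j, m). y ^ j * real m powr -s) has_sum (1 / (1 - y) * c)) (UNIV \<times> S P)"
  proof (rule has_sum_SigmaI)
    show "((\<lambda>m. case (j, m) of (j, m) \<Rightarrow> y ^ j * real m powr -s) has_sum (y ^ j * c)) (S P)" for j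
      using inner by simp
    show "((\<lambda>j. y ^ j * c) has_sum (1 / (1 - y) * c)) UNIV" by (rule outer)
    show "(\<lambda>(j, m). y ^ j * real m powr -s) summable_on (UNIV \<times> S P)"
    proof (rule summable_on_SigmaI)
      show "((\<lambda>m. case (j, m) of (j, m) \<Rightarrow> y ^ j * real m powr -s) has_sum (y ^ j * c)) (S P)" for j
        using inner by simp
      show "(\<lambda>j. y ^ j * c) summable_on UNIV" using outer by (auto simp: summable_on_def)
    qed (use y in auto)
  qed
  also have "((\<lambda>(j, m). y ^ j * real m powr -s) has_sum (1 / (1 - y) * c)) (UNIV \<times> S P) \<longleftrightarrow>
    ((\<lambda>n. real n powr -s) has_sum (1 / (1 - y) * c)) (S (insert p P))"
  proof (rule has_sum_reindex_bij_witness[where i = "\<lambda>n. (multiplicity p n, n div p ^ multiplicity p n)"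
        and j = "\<lambda>(j, m). p ^ j * m"])
    have ndvd: "\<not> p dvd m" if "m \<in> S P" for m
      using that insert.hyps pr by (auto simp: S_def prime_factors_dvd)
    fix a :: "nat \<times> nat" assume a: "a \<in> UNIV \<times> S P"
    obtain j m where jm: "a = (j, m)" by force
    have m: "m \<in> S P" using a jm by auto
    have "multiplicity p (p ^ j * m) = j"
      using ndvd[OF m] pr m by (intro multiplicity_eqI) auto
    then show "(multiplicity p (case a of (j, m) \<Rightarrow> p ^ j * m),
        (case a of (j, m) \<Rightarrow> p ^ j * m) div p ^ multiplicity p (case a of (j, m) \<Rightarrow> p ^ j * m)) = a"
      using pr by (simp add: jm prime_gt_0_nat)
    show "(case a of (j, m) \<Rightarrow> p ^ j * m) \<in> S (insert p P)"
    proof -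
      have "x = p \<or> x dvd m" if "prime x" "x dvd p ^ j * m" for x
        using that pr by (metis prime_dvd_mult_iff prime_dvd_power primes_dvd_imp_eq)
      then show ?thesis
        using m pr unfolding jm S_def by (auto simp: prime_factors_dvd prime_gt_0_nat) blast
    qed
    show "real (case a of (j, m) \<Rightarrow> p ^ j * m) powr -s = (case a of (j, m) \<Rightarrow> y ^ j * real m powr -s)"
      using p1 by (simp add: jm powr_mult y_def powr_realpow flip: powr_powr)
        (simp add: powr_powr mult.commute flip: powr_realpow)
  next
    fix b assume b: "b \<in> S (insert p P)"
    have b0: "b > 0" using b by (simp add: S_def)
    show "(case (multiplicity p b, b div p ^ multiplicity p b) of (j, m) \<Rightarrow> p ^ j * m) = b"
      by (simp add: multiplicity_dvd)
    have "b div p ^ multiplicity p b \<in> S P"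
    proof -
      have d: "\<not> p dvd b div p ^ multiplicity p b"
        using b0 pr by (intro multiplicity_decompose) auto
      have e: "b div p ^ multiplicity p b dvd b"
        by (metis dvd_mult_div_cancel dvd_triv_right multiplicity_dvd)
      have "b div p ^ multiplicity p b > 0" using e b0 by (auto intro: Nat.gr0I)
      then show ?thesis using b d e b0
        unfolding S_def by (auto simp: prime_factors_dvd intro: dvd_trans)
    qed
    then show "(multiplicity p b, b div p ^ multiplicity p b) \<in> UNIV \<times> S P" by simp
  qed simp
  finally show ?case using insert by (simp add: c_def y_def S_def)
qed

section \<open>Two-sided bounds for the Mertens product\<close>

definition mertens_product :: "nat \<Rightarrow> real" where
  "mertens_product n = (\<Prod>p | prime p \<and> p \<le> n. 1 / (1 - 1 / real p))"

text \<open>Every positive \<open>m \<le> n\<close> has only prime factors up to \<open>n\<close>,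
  so the harmonic sum is part of the series to which the Euler product at \<open>s = 1\<close>
  expands.\<close>

lemma ln_le_mertens_product: "ln (real n + 1) \<le> mertens_product n"
proof -
  let ?P = "{p. prime p \<and> p \<le> n}"
  have hs: "((\<lambda>m. real m powr -1) has_sum (\<Prod>p\<in>?P. 1 / (1 - real p powr -1))) {m. m > 0 \<and> prime_factors m \<subseteq> ?P}"
    by (rule has_sum_prime_support) auto
  have "ln (real n + 1) \<le> harm n" by (rule harm_ge_ln)
  also have "harm n = (\<Sum>m\<in>{1..n}. real m powr -1)"
    by (simp add: harm_def powr_minus)
  also have "\<dots> \<le> (\<Prod>p\<in>?P. 1 / (1 - real p powr -1))"
    by (rule has_sum_mono_neutral[OF has_sum_finite hs])
      (auto simp: prime_factors_dvd dest!: dvd_imp_le)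
  also have "\<dots> = mertens_product n"
    unfolding mertens_product_def by (intro prod.cong) (auto simp: powr_minus prime_gt_0_nat divide_simps)
  finally show ?thesis .
qed

lemma zeta_partial_sum_le:
  fixes s :: real
  assumes "s > 1"
  shows "(\<Sum>n\<in>{1..N::nat}. real n powr -s) \<le> s / (s - 1)"
proof -
  have "(\<Sum>n\<in>{1..N}. real n powr -s) \<le> 1 + (1 - real N powr (1 - s)) / (s - 1)" if "N \<ge> 1"
    using that
  proof (induction N rule: dec_induct)
    case (step n)
    define g where "g x = x powr (1 - s)" for x :: real
    have "\<exists>z. real n < z \<and> z < real (Suc n) \<and>
      g (real (Suc n)) - g (real n) = (real (Suc n) - real n) * ((1 - s) * z powr (-s))"
    proof (rule MVT2)
      fix x assume "real n \<le> x"
      then have "x > 0" using step by linarith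
      then show "(g has_real_derivative (1 - s) * x powr (-s)) (at x)"
        unfolding g_def by (auto intro!: derivative_eq_intros)
    qed simp
    then obtain z where z: "real n < z" "z < real (Suc n)"
      "g (real (Suc n)) - g (real n) = (1 - s) * z powr (-s)" by auto
    have "real (Suc n) powr -s \<le> z powr -s"
      using z assms by (intro powr_mono2') auto
    then have "(s - 1) * real (Suc n) powr -s \<le> (s - 1) * z powr -s"
      using assms by (intro mult_left_mono) auto
    also have "\<dots> = g (real n) - g (real (Suc n))" using z(3) by (simp add: algebra_simps)
    finally have "real (Suc n) powr -s \<le> (g (real n) - g (real (Suc n))) / (s - 1)"
      using assms by (simp add: field_simps)
    then have "(\<Sum>n\<in>{1..Suc n}. real n powr -s) \<le> 1 + (1 - g (real n)) / (s - 1) + (g (real n) - g (real (Suc n))) / (s - 1)"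
      using step by (simp add: g_def)
    also have "\<dots> = 1 + (1 - g (real (Suc n))) / (s - 1)"
      by (simp add: diff_divide_distrib)
    finally show ?case by (simp add: g_def)
  qed simp
  then have "(\<Sum>n\<in>{1..N}. real n powr -s) \<le> 1 + 1 / (s - 1)"
  proof (cases "N \<ge> 1")
    case True
    have "(1 - real N powr (1 - s)) / (s - 1) \<le> 1 / (s - 1)"
      using assms by (intro divide_right_mono) auto
    then show ?thesis using True \<open>N \<ge> 1 \<Longrightarrow> _\<close> by linarith
  qed (use assms in auto)
  also have "\<dots> = s / (s - 1)" using assms by (simp add: field_simps)
  finally show ?thesis .
qed

text \<open>Compare with the Euler product of the zeta function at \<open>1 + 1 / ln n\<close>; the quotient of
  corresponding factors is controlled by \<open>\<Sum> ln p / p\<close>.\<close>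

lemma mertens_product_le:
  assumes "n \<ge> 3"
  shows "mertens_product n \<le> 2 * exp 4 * ln (real n)"
proof -
  let ?P = "{p. prime p \<and> p \<le> n}"
  define L where "L = ln (real n)"
  have L: "L \<ge> 1"
  proof -
    have "exp 1 \<le> real n" using exp_le assms by linarith
    then show ?thesis unfolding L_def by (subst ln_ge_iff) (use assms in auto)
  qed
  \<comment> \<open>Balances two losses: the zeta sum is at most \<open>s / (s - 1) = L + 1\<close>,
    while moving the exponent from \<open>1\<close> to \<open>s\<close> costs in total
    \<open>exp (2 * (\<Sum> ln p / p) / L)\<close>, which is bounded.\<close>
  define s where "s = 1 + 1 / L"
  have s: "s > 1" using L by (simp add: s_def)
  have hs: "((\<lambda>m. real m powr -s) has_sum (\<Prod>p\<in>?P. 1 / (1 - real p powr -s))) {m. m > 0 \<and> prime_factors m \<subseteq> ?P}"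
    using s by (intro has_sum_prime_support) auto
  have zeta: "(\<Prod>p\<in>?P. 1 / (1 - real p powr -s)) \<le> s / (s - 1)"
  proof (rule has_sum_le_finite_sums[OF hs])
    fix F :: "nat set" assume F: "finite F" "F \<subseteq> {m. m > 0 \<and> prime_factors m \<subseteq> ?P}"
    then obtain N where "\<forall>m\<in>F. m \<le> N"
      by (auto simp: finite_nat_set_iff_bounded_le)
    then have N: "F \<subseteq> {1..N}" using F(2) by auto
    have "(\<Sum>m\<in>F. real m powr -s) \<le> (\<Sum>m\<in>{1..N}. real m powr -s)"
      using N by (intro sum_mono2) auto
    also have "\<dots> \<le> s / (s - 1)" by (rule zeta_partial_sum_le[OF s])
    finally show "(\<Sum>m\<in>F. real m powr -s) \<le> s / (s - 1)" .
  qed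
  \<comment> \<open>With \<open>a = 1 / p \<le> 1/2\<close>, the additive error \<open>a * t\<close>
    is at most \<open>(1 - a) * (2 * (a * t))\<close>; this turns it into the multiplicative error
    \<open>exp (2 * (a * t))\<close>.\<close>
  have fac: "1 / (1 - 1 / real p) \<le> exp (2 * (ln (real p) / real p) / L) * (1 / (1 - real p powr -s))" if p: "p \<in> ?P" for p
  proof -
    have p2: "real p \<ge> 2" using p prime_ge_2_nat[of p] by auto
    define a where "a = 1 / real p"
    define b where "b = real p powr -s"
    define t where "t = ln (real p) / L"
    have t0: "t \<ge> 0" using p2 L by (simp add: t_def)
    have b_eq: "b = a * exp (-t)"
      using p2 by (simp add: b_def a_def powr_def s_def t_def exp_diff exp_minus exp_add field_simps)
    have a: "0 < a" "a \<le> 1/2" using p2 by (auto simp: a_def field_simps)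
    have "b \<ge> a * (1 - t)" using a unfolding b_eq by (intro mult_left_mono) (use exp_ge_add_one_self[of "-t"] in auto)
    have "b \<le> a" using a t0 unfolding b_eq by (simp add: mult_left_le)
    have "(1 - b) \<le> (1 - a) * (1 + 2 * (a * t))"
    proof -
      have "1 - b \<le> 1 - a + a * t" using \<open>b \<ge> a * (1 - t)\<close> by (simp add: algebra_simps)
      also have "\<dots> \<le> 1 - a + (1 - a) * (2 * (a * t))"
      proof -
        have "1 * (a * t) \<le> (2 * (1 - a)) * (a * t)" using a t0 by (intro mult_right_mono) auto
        then show ?thesis by (simp add: mult_ac)
      qed
      finally show ?thesis by (simp add: algebra_simps)
    qed
    also have "\<dots> \<le> (1 - a) * exp (2 * (a * t))"
      using a by (intro mult_left_mono exp_ge_add_one_self) auto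
    finally have "1 / (1 - a) \<le> exp (2 * (a * t)) * (1 / (1 - b))"
      using a \<open>b \<le> a\<close> by (simp add: field_simps)
    moreover have "a * t = (ln (real p) / real p) / L" by (simp add: a_def t_def)
    ultimately show ?thesis unfolding a_def b_def by (simp only: mult.assoc times_divide_eq_right)
  qed
  have "mertens_product n \<le> (\<Prod>p\<in>?P. exp (2 * (ln (real p) / real p) / L) * (1 / (1 - real p powr -s)))"
    unfolding mertens_product_def
  proof (intro prod_mono conjI)
    fix p assume p: "p \<in> ?P"
    then have "real p > 1" using prime_gt_1_nat[of p] by auto
    then show "0 \<le> 1 / (1 - 1 / real p)" by simp
    show "1 / (1 - 1 / real p) \<le> exp (2 * (ln (real p) / real p) / L) * (1 / (1 - real p powr -s))"
      by (rule fac[OF p])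
  qed
  also have "\<dots> = exp (2 * (\<Sum>p\<in>?P. ln (real p) / real p) / L) * (\<Prod>p\<in>?P. 1 / (1 - real p powr -s))"
    by (simp add: prod.distrib exp_sum sum_distrib_left sum_divide_distrib del: times_divide_eq_right)
  also have "\<dots> \<le> exp 4 * (s / (s - 1))"
  proof (intro mult_mono zeta)
    have "(\<Sum>p\<in>?P. ln (real p) / real p) \<le> 2 * L"
      using sum_ln_prime_div_prime_le[of n] assms by (simp add: L_def)
    then have "2 * (\<Sum>p\<in>?P. ln (real p) / real p) / L \<le> 4" using L by (simp add: field_simps)
    then show "exp (2 * (\<Sum>p\<in>?P. ln (real p) / real p) / L) \<le> exp 4" by simp
    show "0 \<le> (\<Prod>p\<in>?P. 1 / (1 - real p powr -s))"
    proof (intro prod_nonneg ballI divide_nonneg_nonneg)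
      fix p assume "p \<in> ?P"
      then have "real p > 1" using prime_gt_1_nat[of p] by auto
      then show "0 \<le> 1 - real p powr -s" using s by (simp add: less_imp_le powr_less_one)
    qed simp
  qed auto
  also have "\<dots> = exp 4 * (L + 1)" using L by (simp add: s_def field_simps)
  also have "\<dots> \<le> exp 4 * (2 * L)" using L by simp
  finally show ?thesis by (simp add: L_def mult_ac)
qed

section \<open>Real sequences\<close>

text \<open>The exponent \<open>1/4\<close> lies strictly below the decay \<open>1/2\<close> of the
  ballot estimate, so trading the logarithm for this power still leaves decay.\<close>

lemma ln_le_four_root: "ln u \<le> 4 * u powr (1/4)" if "u > 0" for u :: real
proof -
  have "ln u = 4 * ln (u powr (1/4))" using that by (simp add: ln_powr)
  also have "\<dots> \<le> 4 * u powr (1/4)" using that ln_le_minus_one[of "u powr (1/4)"] by simp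
  finally show ?thesis .
qed

lemma sum_by_parts_decreasing:
  fixes g p :: "nat \<Rightarrow> real"
  shows "(\<Sum>k<n. g (Suc k) * (p k - p (Suc k))) + g n * p n = g 0 * p 0 + (\<Sum>k<n. (g (Suc k) - g k) * p k)"
  by (induction n) (simp_all add: algebra_simps)

text \<open>A ballot-type estimate: \<open>p n\<close> is the probability that a centred walk with variance
  \<open>u n\<close> stays below \<open>a + ln (u k)\<close> up to time \<open>n\<close>, and the hypothesis \<open>key\<close>
  is optional stopping for its exponential martingale with parameter \<open>l\<close>.\<close>

lemma barrier_decay:
  fixes p u :: "nat \<Rightarrow> real"
  assumes p0: "p 0 = 1" and pn: "\<And>n. 0 \<le> p n" and pd: "\<And>n. p (Suc n) \<le> p n"
    and u0: "u 0 = 1" and um: "\<And>n. u n \<le> u (Suc n)" and u2: "\<And>n. u (Suc n) \<le> 2 * u n"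
    and a: "a \<ge> 1"
    and key: "\<And>n l. 0 < l \<Longrightarrow> l \<le> 1 \<Longrightarrow>
      1 \<le> (\<Sum>k<n. exp (l * (a + ln (u (Suc k)))) * (p k - p (Suc k)))
          + exp (l * (a + ln (u n))) / (1 + l^2 * (u n - 1) / 16) * p n"
  shows "p n \<le> 200000 * (a + 1) / sqrt (u n)"
proof -
  have umono: "u m \<le> u n" if "m \<le> n" for m n using that um lift_Suc_mono_le[of u] by blast
  have u1: "u n \<ge> 1" for n using umono[of 0 n] u0 by simp
  have upos: "u n > 0" for n using u1[of n] by linarith
  have p1: "p n \<le> 1" for n using pd lift_Suc_antimono_le[of p 0 n] p0 by simp
  have lnu: "ln (u m) \<le> ln (u n)" if "m \<le> n" for m n using umono[OF that] upos by simp
  have main: "p n \<le> 66 / sqrt (u n) * (a + (\<Sum>k<n. (ln (u (Suc k)) - ln (u k)) * p k))"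
    if un: "u n \<ge> 2" and cond: "a + ln (u n) \<le> sqrt (u n)" for n
  proof -
    \<comment> \<open>With this size \<open>l^2 * (u n - 1)\<close> is bounded below, so survivors
      get a fixed discount, while \<open>cond\<close> gives
      \<open>l * (a + ln (u n)) \<le> 1\<close>, so the exponentials are essentially linear.\<close>
    define l where "l = 1 / sqrt (u n)"
    have l: "0 < l" "l \<le> 1" using upos[of n] u1[of n] by (auto simp: l_def)
    have l2: "l^2 = 1 / u n" using upos[of n] by (simp add: l_def power_divide)
    define b where "b k = exp (l * (a + ln (u k))) - 1" for k
    have b: "0 \<le> b k" "b k \<le> 2 * l * (a + ln (u k))" if "k \<le> n" for k
    proof -
      have "l * (a + ln (u k)) \<le> l * (a + ln (u n))" using lnu[OF that] l by simp
      also have "\<dots> \<le> l * sqrt (u n)" using l cond by simp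
      also have "\<dots> = 1" using upos[of n] by (simp add: l_def)
      finally have x1: "l * (a + ln (u k)) \<le> 1" .
      have x0: "0 \<le> l * (a + ln (u k))" using l a u1[of k] by simp
      show "0 \<le> b k" using x0 by (simp add: b_def)
      have "exp (l * (a + ln (u k))) \<le> 1 + l * (a + ln (u k)) + (l * (a + ln (u k)))^2"
        by (rule exp_bound[OF x0 x1])
      also have "(l * (a + ln (u k)))^2 \<le> l * (a + ln (u k))" using x0 x1 by (simp add: power2_eq_square mult_left_le)
      finally show "b k \<le> 2 * l * (a + ln (u k))" by (simp add: b_def algebra_simps)
    qed
    define \<Psi> where "\<Psi> = 1 + l^2 * (u n - 1) / 16"
    have \<Psi>: "\<Psi> \<ge> 1 + 1/32" using un by (simp add: \<Psi>_def l2 field_simps)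
    have tele: "(\<Sum>k<n. p k - p (Suc k)) + p n = 1"
      using p0 by (simp add: sum_lessThan_telescope')
    have "(1::real) \<le> (\<Sum>k<n. (1 + b (Suc k)) * (p k - p (Suc k))) + (1 + b n) / \<Psi> * p n"
      using key[OF l, of n] by (simp add: b_def \<Psi>_def)
    also have "\<dots> = (\<Sum>k<n. p k - p (Suc k)) + (\<Sum>k<n. b (Suc k) * (p k - p (Suc k))) + p n / \<Psi> + b n * p n / \<Psi>"
      by (simp add: algebra_simps sum.distrib sum_subtractf add_divide_distrib)
    also have "b n * p n / \<Psi> \<le> b n * p n / 1"
      using b(1)[of n] pn[of n] \<Psi> by (intro divide_left_mono) auto
    also have "p n / \<Psi> \<le> p n / (33/32)" using \<Psi> pn[of n] by (intro divide_left_mono) auto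
    \<comment> \<open>Subtracting the total mass \<open>tele\<close> cancels the leading
      \<open>1\<close>; the discount leaves \<open>1 - 32/33 = 1/33\<close>, and the factor
      \<open>2\<close> from linearising makes it \<open>66\<close>.\<close>
    finally have "p n * (1/33) \<le> (\<Sum>k<n. b (Suc k) * (p k - p (Suc k))) + b n * p n"
      using tele by simp
    also have "\<dots> \<le> (\<Sum>k<n. (2 * l * (a + ln (u (Suc k)))) * (p k - p (Suc k))) + (2 * l * (a + ln (u n))) * p n"
      using b pd pn by (intro add_mono sum_mono mult_right_mono) auto
    also have "\<dots> = 2 * l * (a + ln (u 0)) * p 0 + (\<Sum>k<n. (2 * l * (a + ln (u (Suc k))) - 2 * l * (a + ln (u k))) * p k)"
      by (rule sum_by_parts_decreasing)
    also have "\<dots> = 2 * l * (a + (\<Sum>k<n. (ln (u (Suc k)) - ln (u k)) * p k))"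
      by (simp add: u0 p0 sum_distrib_left algebra_simps flip: sum_subtractf)
    finally show ?thesis by (simp add: l_def field_simps)
  qed
  have crude: "p n \<le> 66 * (a + ln (u n)) / sqrt (u n)" for n
  proof (cases "u n \<ge> 2 \<and> a + ln (u n) \<le> sqrt (u n)")
    case True
    have "(\<Sum>k<n. (ln (u (Suc k)) - ln (u k)) * p k) \<le> (\<Sum>k<n. (ln (u (Suc k)) - ln (u k)) * 1)"
      using p1 lnu by (intro sum_mono mult_left_mono) auto
    also have "\<dots> = ln (u n)" using sum_lessThan_telescope[of "\<lambda>k. ln (u k)" n] u0 by simp
    finally have "66 / sqrt (u n) * (a + (\<Sum>k<n. (ln (u (Suc k)) - ln (u k)) * p k)) \<le> 66 / sqrt (u n) * (a + ln (u n))"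
      using upos[of n] by (intro mult_left_mono) auto
    then show ?thesis using main[of n] True by simp
  next
    case False
    have "sqrt (u n) \<le> 66 * (a + ln (u n))"
    proof (cases "u n \<ge> 2")
      case True
      then show ?thesis using False a ln_ge_zero[OF u1[of n]] by argo
    next
      case f: False
      have "sqrt (u n) \<le> u n" using u1[of n] by (intro real_le_lsqrt) (auto simp: self_le_power)
      then show ?thesis using f a ln_ge_zero[OF u1[of n]] by argo
    qed
    then have "1 \<le> 66 * (a + ln (u n)) / sqrt (u n)" using upos[of n] by simp
    then show ?thesis using p1[of n] by linarith
  qed
  have crude': "p n \<le> 66 * (a + 4) * u n powr (-1/4)" for n
  proof -
    have q1: "u n powr (1/4) \<ge> 1" using u1[of n] by (simp add: ge_one_powr_ge_zero)
    have "a + ln (u n) \<le> a * u n powr (1/4) + 4 * u n powr (1/4)"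
      using ln_le_four_root[OF upos[of n]] q1 a by (intro add_mono) auto
    then have "66 * (a + ln (u n)) / sqrt (u n) \<le> 66 * ((a + 4) * u n powr (1/4)) / sqrt (u n)"
      using upos[of n] by (intro divide_right_mono mult_left_mono) (auto simp: algebra_simps)
    also have "\<dots> = 66 * (a + 4) * (u n powr (1/4) / u n powr (1/2))"
      using upos[of n] by (simp add: powr_half_sqrt)
    also have "u n powr (1/4) / u n powr (1/2) = u n powr (-1/4)"
      by (simp flip: powr_diff)
    finally show ?thesis using crude[of n] by linarith
  qed
  \<comment> \<open>Discrete version of integrating \<open>u powr (-5/4)\<close>: the product
    telescopes, at the price of the bounded ratio \<open>u (Suc k) \<le> 2 * u k\<close>.\<close>
  have inc: "(ln (u (Suc k)) - ln (u k)) * p k \<le> 528 * (a + 4) * (u k powr (-1/4) - u (Suc k) powr (-1/4))" for k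
  proof -
    define y where "y = u (Suc k) / u k"
    have y: "1 \<le> y" "y \<le> 2" using um[of k] u2[of k] upos[of k] by (auto simp: y_def field_simps)
    have s: "y powr (1/4) \<le> 2"
    proof -
      have "y powr (1/4) \<le> y powr 1" using y by (intro powr_mono) auto
      then show ?thesis using y by simp
    qed
    have s1: "y powr (1/4) \<ge> 1" using y by (simp add: ge_one_powr_ge_zero)
    have "ln y = 4 * ln (y powr (1/4))" using y by (simp add: ln_powr)
    also have "\<dots> \<le> 4 * (y powr (1/4) - 1)" using y ln_le_minus_one[of "y powr (1/4)"] by simp
    also have "\<dots> = 4 * (y powr (1/4) * (1 - y powr (-1/4)))"
      using y by (simp add: algebra_simps flip: powr_add)
    also have "\<dots> \<le> 4 * (2 * (1 - y powr (-1/4)))"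
      using s y by (intro mult_left_mono mult_right_mono) (auto simp: powr_minus_divide field_simps s1)
    finally have lny: "ln y \<le> 8 * (1 - y powr (-1/4))" by simp
    have "(ln (u (Suc k)) - ln (u k)) * p k = ln y * p k"
      using upos[of k] upos[of "Suc k"] by (simp add: y_def ln_div)
    also have "\<dots> \<le> 8 * (1 - y powr (-1/4)) * (66 * (a + 4) * u k powr (-1/4))"
      using lny crude'[of k] pn[of k] ln_ge_zero[OF y(1)] by (intro mult_mono) linarith+
    also have "\<dots> = 528 * (a + 4) * (u k powr (-1/4) - y powr (-1/4) * u k powr (-1/4))"
      by (simp add: algebra_simps)
    also have "y powr (-1/4) * u k powr (-1/4) = u (Suc k) powr (-1/4)"
      using upos[of k] upos[of "Suc k"] by (simp add: y_def powr_divide)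
    finally show ?thesis .
  qed
  have tot: "(\<Sum>k<n. (ln (u (Suc k)) - ln (u k)) * p k) \<le> 528 * (a + 4)" for n
  proof -
    have "(\<Sum>k<n. (ln (u (Suc k)) - ln (u k)) * p k)
       \<le> (\<Sum>k<n. 528 * (a + 4) * (u k powr (-1/4) - u (Suc k) powr (-1/4)))"
      by (intro sum_mono inc)
    also have "\<dots> = 528 * (a + 4) * (1 - u n powr (-1/4))"
      using sum_lessThan_telescope'[of "\<lambda>k. u k powr (-1/4)" n] u0 by (simp flip: sum_distrib_left)
    also have "\<dots> \<le> 528 * (a + 4) * 1" using a by (intro mult_left_mono) auto
    finally show ?thesis by simp
  qed
  show ?thesis
  proof (cases "u n \<ge> 2 \<and> a + ln (u n) \<le> sqrt (u n)")
    case True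
    have "p n \<le> 66 / sqrt (u n) * (a + 528 * (a + 4))"
      using main[of n] True tot[of n] upos[of n]
      by (meson add_left_mono divide_nonneg_nonneg mult_left_mono order_trans real_sqrt_ge_zero less_imp_le zero_le_numeral)
    also have "\<dots> = 66 * (a + 528 * (a + 4)) / sqrt (u n)" by simp
    also have "\<dots> \<le> 200000 * (a + 1) / sqrt (u n)"
      using a upos[of n] by (intro divide_right_mono) auto
    finally show ?thesis .
  next
    case False
    \<comment> \<open>Outside the range of \<open>main\<close> the claim is trivial. If
      \<open>u n \<ge> 2\<close>, either \<open>a\<close> is at least half of
      \<open>sqrt (u n)\<close> or \<open>ln (u n)\<close> exceeds half of it, and the latter forces
      \<open>u n powr (1/4) < 8\<close>.\<close>
    have "sqrt (u n) \<le> 64 * (a + 1)"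
    proof (cases "u n \<ge> 2")
      case True
      show ?thesis
      proof (cases "2 * a \<ge> sqrt (u n)")
        case t: True
        then show ?thesis using a by argo
      next
        case f: False
        define w where "w = u n powr (1/4)"
        have w: "w > 0" using upos[of n] by (simp add: w_def)
        have w2: "w * w = sqrt (u n)"
          using upos[of n] by (simp add: w_def powr_half_sqrt flip: powr_add)
        have "ln (u n) \<le> 4 * w" using ln_le_four_root[OF upos[of n]] by (simp add: w_def)
        moreover have "ln (u n) > sqrt (u n) / 2" using False True f by argo
        ultimately have "w * w < 8 * w" using w2 by simp
        then have "w < 8" using w by simp
        then have "w * w \<le> 8 * 8" using w by (intro mult_mono) auto
        then show ?thesis using w2 a by simp
      qed
    next
      case f: False
      have "sqrt (u n) \<le> u n" using u1[of n] by (intro real_le_lsqrt) (auto simp: self_le_power)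
      then show ?thesis using f a by argo
    qed
    then have "1 \<le> 200000 * (a + 1) / sqrt (u n)" using upos[of n] a by simp
    then show ?thesis using p1[of n] by linarith
  qed
qed

text \<open>With \<open>d\<close> the increment of \<open>u\<close>, the relative increment of
  \<open>W^2\<close> is at most \<open>2 * d\<close>, and \<open>d / (u k * u (Suc k))\<close>
  telescopes. This is the summability that the growing thresholds of the maximal inequality are
  designed for.\<close>

lemma sum_log_square_increments_le:
  fixes W :: "nat \<Rightarrow> real"
  assumes W0: "W 0 = 1" and W: "\<And>n. W n \<le> W (Suc n)"
  defines "u \<equiv> \<lambda>n. 1 + ln (W n)"
  shows "(\<Sum>k<n. ((W (Suc k))^2 - (W k)^2) / ((W (Suc k))^2 * (u (Suc k))^2)) \<le> 2"
proof -
  have W1: "W n \<ge> 1" for n using lift_Suc_mono_le[of W 0 n] W W0 by simp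
  have u1: "u n \<ge> 1" for n using W1[of n] by (simp add: u_def)
  have "((W (Suc k))^2 - (W k)^2) / ((W (Suc k))^2 * (u (Suc k))^2) \<le> 2 * (1 / u k - 1 / u (Suc k))" for k
  proof -
    define d where "d = u (Suc k) - u k"
    have pos: "W k > 0" "W (Suc k) > 0" "u k > 0" "u (Suc k) > 0"
      using W1[of k] W1[of "Suc k"] u1[of k] u1[of "Suc k"] by linarith+
    have d0: "d \<ge> 0" using W[of k] pos by (simp add: d_def u_def)
    have "W k / W (Suc k) = exp (-d)" using pos by (simp add: d_def u_def exp_diff)
    then have "(W k)^2 / (W (Suc k))^2 = exp (-d) ^ 2" by (metis power_divide)
    also have "\<dots> = exp (- (2 * d))" by (simp flip: exp_double)
    also have "\<dots> \<ge> 1 - 2 * d" using exp_ge_add_one_self[of "-(2 * d)"] by simp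
    finally have "((W (Suc k))^2 - (W k)^2) / (W (Suc k))^2 \<le> 2 * d"
      using pos by (simp add: diff_divide_distrib)
    then have "((W (Suc k))^2 - (W k)^2) / (W (Suc k))^2 / (u (Suc k))^2 \<le> 2 * d / (u (Suc k))^2"
      by (intro divide_right_mono) auto
    also have "\<dots> \<le> 2 * d / (u k * u (Suc k))"
      using pos d0 W[of k] by (intro divide_left_mono) (auto simp: power2_eq_square d_def)
    also have "\<dots> = 2 * (1 / u k - 1 / u (Suc k))"
      using pos by (simp add: d_def field_simps)
    finally show ?thesis by (simp add: field_simps)
  qed
  then have "(\<Sum>k<n. ((W (Suc k))^2 - (W k)^2) / ((W (Suc k))^2 * (u (Suc k))^2)) \<le> (\<Sum>k<n. 2 * (1 / u k - 1 / u (Suc k)))"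
    by (intro sum_mono)
  also have "\<dots> = 2 * (1 / u 0 - 1 / u n)"
    by (simp only: sum_distrib_left[symmetric] sum_lessThan_telescope'[of "\<lambda>k. 1 / u k" n])
  also have "\<dots> \<le> 2" using u1[of n] by (simp add: u_def W0)
  finally show ?thesis .
qed

text \<open>The supremum \<open>S\<close> over all \<open>q\<close> satisfies
  \<open>S \<le> K + S / 2\<close>. The bound \<open>B\<close> only ensures that \<open>S\<close> is
  finite, so it may be as bad as one likes.\<close>

lemma halving_recursion_bound:
  fixes z :: "real \<Rightarrow> real"
  assumes rec: "\<And>q. 1/2 \<le> q \<Longrightarrow> q < 1 \<Longrightarrow> z q \<le> K + z ((1 + q) / 2) / 2"
    and bd: "\<And>q. 1/2 \<le> q \<Longrightarrow> q < 1 \<Longrightarrow> z q \<le> B"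
    and q: "1/2 \<le> q" "q < 1"
  shows "z q \<le> 2 * K"
proof -
  define S where "S = (SUP q\<in>{1/2..<1}. z q)"
  have bdd: "bdd_above (z ` {1/2..<1})" using bd by (intro bdd_aboveI[of _ B]) auto
  have le: "z q \<le> S" if "1/2 \<le> q" "q < 1" for q
    unfolding S_def using that by (intro cSUP_upper bdd) auto
  have "S \<le> K + S / 2"
    unfolding S_def
  proof (rule cSUP_least)
    fix q assume "q \<in> {1/2..<1::real}"
    then have q: "1/2 \<le> q" "q < 1" by auto
    have "z q \<le> K + z ((1 + q) / 2) / 2" by (rule rec[OF q])
    also have "\<dots> \<le> K + S / 2" using le[of "(1 + q) / 2"] q by simp
    finally show "z q \<le> K + (SUP q\<in>{1/2..<1}. z q) / 2" by (simp add: S_def)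
  qed auto
  then show ?thesis using le[OF q] by simp
qed

section \<open>One circle-valued random variable\<close>

lemma norm_one_minus_square:
  fixes z :: complex and r :: real
  shows "(1 - r * z) * (1 - r * cnj z) = (norm (1 - r * z))^2"
proof -
  have "cnj (1 - r * z) = 1 - r * cnj z" by simp
  then show ?thesis by (metis complex_norm_square of_real_power)
qed

lemma (in prob_space) integrable_bounded:
  fixes g :: "'a \<Rightarrow> 'c::{banach,second_countable_topology}"
  assumes "g \<in> borel_measurable M" "\<And>x. norm (g x) \<le> B"
  shows "integrable M g"
  using assms by (intro integrable_const_bound[where B = B]) auto

text \<open>Vanishing positive moments are all that holomorphic test functions see of the uniform
  law. The modulus is \<open>1\<close> at every point, so that no bound needs an exceptional
  set.\<close>

locale circle_variable = prob_space M for M :: "'a measure" +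
  fixes Y :: "'a \<Rightarrow> complex"
  assumes measurable_Y [measurable]: "Y \<in> borel_measurable M"
    and norm_Y [simp]: "\<And>x. norm (Y x) = 1"
    and moments: "\<And>m. m > 0 \<Longrightarrow> (LINT x|M. Y x ^ m) = 0"
begin

text \<open>The Poisson kernel of the disc at the point \<open>r\<close>. Up to the factor
  \<open>1 - r^2\<close> it is the squared modulus of an Euler factor, hence the density of the
  tilted law of one variable.\<close>

definition poisson :: "real \<Rightarrow> 'a \<Rightarrow> real" where
  "poisson r x = (1 - r^2) / (norm (1 - r * Y x))^2"

lemma poisson_measurable [measurable]: "poisson r \<in> borel_measurable M"
  unfolding poisson_def by measurable

lemma norm_one_minus_ge:
  assumes "0 \<le> r"
  shows "norm (1 - complex_of_real r * Y x) \<ge> 1 - r"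
  using norm_triangle_ineq2[of 1 "complex_of_real r * Y x"] assms by (simp add: norm_mult)

lemma poisson_nonneg: "0 \<le> r \<Longrightarrow> r < 1 \<Longrightarrow> poisson r x \<ge> 0"
  unfolding poisson_def by (intro divide_nonneg_nonneg) (auto simp: power_le_one)

lemma poisson_bounded:
  assumes "0 \<le> r" "r < 1"
  shows "poisson r x \<le> 1 / (1 - r)^2"
proof -
  have "(1 - r)^2 \<le> (norm (1 - r * Y x))^2"
    using assms norm_one_minus_ge by (intro power_mono) auto
  then show ?thesis using assms unfolding poisson_def by (intro frac_le) auto
qed

lemma expectation_mult_power_series:
  fixes f :: "complex \<Rightarrow> complex"
  assumes a: "summable (\<lambda>n. norm (a n))" and f: "\<And>z. norm z = 1 \<Longrightarrow> (\<lambda>n. a n * z ^ n) sums f z"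
    and g: "g \<in> borel_measurable M" "\<And>x. norm (g x) \<le> B"
  shows "(\<lambda>n. a n * (LINT x|M. g x * Y x ^ n)) sums (LINT x|M. g x * f (Y x))"
proof -
  note g(1) [measurable]
  have B: "B \<ge> 0" using g(2) norm_ge_zero order_trans by blast
  have int: "integrable M (\<lambda>x. a n * (g x * Y x ^ n))" for n
    using g(2) by (intro integrable_bounded[where B = "norm (a n) * B"])
      (auto simp: norm_mult norm_power intro!: mult_left_mono)
  have "(\<lambda>n. LINT x|M. a n * (g x * Y x ^ n)) sums (LINT x|M. (\<Sum>n. a n * (g x * Y x ^ n)))"
  proof (rule sums_integral[OF int])
    show "AE x in M. summable (\<lambda>n. norm (a n * (g x * Y x ^ n)))"
      using a by (auto simp: norm_mult norm_power intro!: summable_mult2)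
    show "summable (\<lambda>n. LINT x|M. norm (a n * (g x * Y x ^ n)))"
    proof (rule summable_comparison_test')
      show "summable (\<lambda>n. norm (a n) * B)" by (intro summable_mult2 a)
      fix n
      have "(LINT x|M. norm (a n * (g x * Y x ^ n))) \<le> (LINT x|M. norm (a n) * B)"
        using g(2) by (intro integral_mono integrable_norm int) (auto simp: norm_mult norm_power intro!: mult_left_mono)
      then show "norm (LINT x|M. norm (a n * (g x * Y x ^ n))) \<le> norm (a n) * B" by (simp add: prob_space)
    qed
  qed
  moreover have "(\<Sum>n. a n * (g x * Y x ^ n)) = g x * f (Y x)" for x
    using sums_mult[OF f[OF norm_Y], of "g x" x] by (auto simp: sums_iff mult_ac)
  ultimately show ?thesis by simp
qed

text \<open>Convergence at a point beyond the unit circle makes the coefficients absolutely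
  summable, which term-by-term integration on the circle requires.\<close>

lemma holomorphic_power_series_at_0:
  assumes "f holomorphic_on ball 0 R" "R > 1"
  obtains a :: "nat \<Rightarrow> complex" where "summable (\<lambda>n. norm (a n))"
    "\<And>z. norm z \<le> 1 \<Longrightarrow> (\<lambda>n. a n * z ^ n) sums f z"
proof
  define a where "a n = (deriv ^^ n) f 0 / fact n" for n
  have s: "(\<lambda>n. a n * z ^ n) sums f z" if "norm z < R" for z
    using holomorphic_power_series[OF assms(1), of z] that by (simp add: a_def)
  show "(\<lambda>n. a n * z ^ n) sums f z" if "norm z \<le> 1" for z using s[of z] that assms by auto
  obtain \<rho> where \<rho>: "1 < \<rho>" "\<rho> < R" using dense assms(2) by blast
  have "summable (\<lambda>n. a n * complex_of_real \<rho> ^ n)" using s[of "of_real \<rho>"] \<rho> by (auto simp: sums_iff)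
  from powser_insidea[OF this, of 1] show "summable (\<lambda>n. norm (a n))" using \<rho> by simp
qed

text \<open>Only the constant term has non-zero mean: the mean value property. It is the source of
  the martingale property of \<open>F^2\<close> and of its derivative.\<close>

lemma expectation_holomorphic:
  assumes "f holomorphic_on ball 0 R" "R > 1"
  shows "(LINT x|M. f (Y x)) = f 0"
proof -
  obtain a where a: "summable (\<lambda>n. norm (a n))" "\<And>z. norm z \<le> 1 \<Longrightarrow> (\<lambda>n. a n * z ^ n) sums f z"
    using holomorphic_power_series_at_0[OF assms] by blast
  have "(\<lambda>n. a n * (LINT x|M. 1 * Y x ^ n)) sums (LINT x|M. 1 * f (Y x))"
    using a by (intro expectation_mult_power_series[where B = 1]) auto
  moreover have "(\<lambda>n. a n * (LINT x|M. 1 * Y x ^ n)) = (\<lambda>n. if n = 0 then a 0 else 0)"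
    by (auto simp: moments prob_space)
  ultimately have "(\<lambda>n. if n = 0 then a 0 else 0) sums (LINT x|M. f (Y x))" by simp
  moreover have "(\<lambda>n. if n = 0 then a 0 else 0) sums a 0" by (rule sums_single)
  ultimately have "(LINT x|M. f (Y x)) = a 0" by (rule sums_unique2)
  moreover have "f 0 = a 0" using a(2)[of 0] by (simp add: powser_sums_zero_iff)
  ultimately show ?thesis by simp
qed

lemma ball_scaled_into_unit_disc:
  assumes "0 \<le> r" "r < 1"
  obtains R where "R > 1" "\<And>z. z \<in> ball 0 R \<Longrightarrow> norm (complex_of_real r * z) < 1"
proof (cases "r = 0")
  case True
  then show ?thesis using that[of 2] by auto
next
  case False
  then have r: "0 < r" "r < 1" using assms by auto
  show ?thesis
  proof (rule that[of "1 / r"])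
    fix z :: complex assume "z \<in> ball 0 (1 / r)"
    then show "norm (complex_of_real r * z) < 1" using r by (simp add: norm_mult field_simps)
  qed (use r in auto)
qed

text \<open>Recursion in \<open>m\<close>: multiplying the kernel by
  \<open>1 - r * cnj (Y x)\<close> cancels the antiholomorphic factor of its denominator, so moment
  \<open>Suc m\<close> minus \<open>r\<close> times moment \<open>m\<close> is the mean of a
  holomorphic function vanishing at 0.\<close>

lemma poisson_moment:
  assumes r: "0 \<le> r" "r < 1"
  shows "(LINT x|M. poisson r x * Y x ^ m) = r ^ m"
proof -
  obtain R where R: "R > 1" "\<And>z. z \<in> ball 0 R \<Longrightarrow> norm (complex_of_real r * z) < 1"
    using ball_scaled_into_unit_disc[OF r] by blast
  have ne: "1 - complex_of_real r * z \<noteq> 0" if "z \<in> ball 0 R" for z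
    using R(2)[OF that] by auto
  have int: "integrable M (\<lambda>x. complex_of_real (poisson r x) * Y x ^ m)" for m
    using poisson_bounded[OF r] poisson_nonneg[OF r]
    by (intro integrable_bounded[where B = "1 / (1 - r)^2"]) (auto simp: norm_mult norm_power)
  have nz: "1 - complex_of_real r * Y x \<noteq> 0" for x
    using norm_one_minus_ge[of r x] r by auto
  have key: "poisson r x * (1 - r * cnj (Y x)) = (1 - r^2) / (1 - r * Y x)" for x
  proof -
    have "complex_of_real (poisson r x) = (1 - r^2) / ((1 - r * Y x) * (1 - r * cnj (Y x)))"
      using norm_one_minus_square[of r "Y x"] unfolding poisson_def by simp
    moreover have "1 - r * cnj (Y x) \<noteq> 0"
      using nz[of x] by (metis complex_cnj_cancel_iff complex_cnj_complex_of_real complex_cnj_diff complex_cnj_mult complex_cnj_one complex_cnj_zero)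
    ultimately show ?thesis using nz by simp
  qed
  have step: "(LINT x|M. poisson r x * Y x ^ Suc m) = r * (LINT x|M. poisson r x * Y x ^ m)" for m
  proof -
    have "(LINT x|M. poisson r x * Y x ^ Suc m) - r * (LINT x|M. poisson r x * Y x ^ m)
      = (LINT x|M. poisson r x * Y x ^ Suc m - r * (poisson r x * Y x ^ m))"
      using int[of m] int[of "Suc m"] by simp
    also have "\<dots> = (LINT x|M. (1 - r^2) * Y x ^ Suc m / (1 - r * Y x))"
    proof (rule Bochner_Integration.integral_cong)
      fix x
      have "Y x * cnj (Y x) = 1" by (simp add: complex_norm_square[symmetric])
      then have "Y x ^ m = Y x ^ Suc m * cnj (Y x)" by (simp add: mult_ac)
      then have "poisson r x * Y x ^ Suc m - r * (poisson r x * Y x ^ m)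
        = Y x ^ Suc m * (poisson r x * (1 - r * cnj (Y x)))" by (simp only:) (simp add: algebra_simps)
      then show "poisson r x * Y x ^ Suc m - r * (poisson r x * Y x ^ m) = (1 - r^2) * Y x ^ Suc m / (1 - r * Y x)"
        unfolding key by (simp add: mult_ac)
    qed simp
    also have "\<dots> = (\<lambda>z::complex. (1 - r^2) * z ^ Suc m / (1 - r * z)) 0"
      using ne by (intro expectation_holomorphic[OF _ R(1)] holomorphic_intros) auto
    finally show ?thesis by simp
  qed
  \<comment> \<open>The kernel is the real part of \<open>2 / (1 - r * z) - 1\<close> on the circle,
    so the base case is again a mean value.\<close>
  have zero: "(LINT x|M. poisson r x * Y x ^ 0) = 1"
  proof -
    define g where "g z = 2 / (1 - complex_of_real r * z) - 1" for z
    have "g holomorphic_on ball 0 R"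
      unfolding g_def by (intro holomorphic_intros) (use ne in auto)
    then have "(LINT x|M. g (Y x)) = 1"
      by (subst expectation_holomorphic[OF _ R(1)]) (auto simp: g_def)
    moreover have "integrable M (\<lambda>x. g (Y x))"
    proof (rule integrable_bounded)
      show "(\<lambda>x. g (Y x)) \<in> borel_measurable M" unfolding g_def by measurable
      fix x
      have "norm (g (Y x)) \<le> 2 / norm (1 - r * Y x) + 1"
        unfolding g_def by (metis (no_types) norm_divide norm_numeral norm_one norm_triangle_ineq4)
      also have "\<dots> \<le> 2 / (1 - r) + 1"
        using norm_one_minus_ge[of r x] r by (intro add_right_mono divide_left_mono mult_pos_pos) auto
      finally show "norm (g (Y x)) \<le> 2 / (1 - r) + 1" .
    qed
    ultimately have "(LINT x|M. Re (g (Y x))) = 1" by simp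
    moreover have "Re (g (Y x)) = poisson r x" for x
    proof -
      have n1: "(Re (Y x))^2 + (Im (Y x))^2 = 1"
        using norm_Y[of x] by (simp add: cmod_def)
      have d: "(norm (1 - r * Y x))^2 = 1 - 2 * r * Re (Y x) + r^2"
        using n1 by (simp add: cmod_power2) algebra
      have "Re (1 / (1 - r * Y x)) = (1 - r * Re (Y x)) / (norm (1 - r * Y x))^2"
        by (simp add: Re_divide cmod_power2)
      moreover have "g (Y x) = 2 * (1 / (1 - r * Y x)) - 1"
        by (simp add: g_def)
      moreover have "Re (2 * w - 1) = 2 * Re w - 1" for w :: complex by simp
      ultimately have "Re (g (Y x)) = 2 * ((1 - r * Re (Y x)) / (norm (1 - r * Y x))^2) - 1"
        by metis
      also have "\<dots> = (2 * (1 - r * Re (Y x)) - (norm (1 - r * Y x))^2) / (norm (1 - r * Y x))^2"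
        using nz by (simp add: diff_divide_distrib)
      also have "2 * (1 - r * Re (Y x)) - (norm (1 - r * Y x))^2 = 1 - r^2" unfolding d by simp
      finally show ?thesis unfolding poisson_def .
    qed
    ultimately have "(LINT x|M. poisson r x) = 1" by simp
    then show ?thesis by simp
  qed
  show ?thesis
  proof (induction m)
    case (Suc m)
    then show ?case using step[of m] by simp
  qed (use zero in simp)
qed

text \<open>Tilting by the kernel moves the evaluation point of the mean value property from
  \<open>0\<close> to \<open>r\<close>; term by term this is \<open>poisson_moment\<close>.\<close>

lemma poisson_holomorphic:
  fixes f :: "complex \<Rightarrow> complex"
  assumes r: "0 \<le> r" "r < 1" and f: "f holomorphic_on ball 0 R" "R > 1"
  shows "(LINT x|M. poisson r x * f (Y x)) = f r"
proof -
  obtain a where a: "summable (\<lambda>n. norm (a n))" "\<And>z. norm z \<le> 1 \<Longrightarrow> (\<lambda>n. a n * z ^ n) sums f z"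
    using holomorphic_power_series_at_0[OF f] by blast
  have "(\<lambda>n. a n * (LINT x|M. poisson r x * Y x ^ n)) sums (LINT x|M. poisson r x * f (Y x))"
    using a poisson_bounded[OF r] poisson_nonneg[OF r]
    by (intro expectation_mult_power_series[where B = "1 / (1 - r)^2"]) auto
  then have "(\<lambda>n. a n * complex_of_real r ^ n) sums (LINT x|M. poisson r x * f (Y x))"
    using poisson_moment[OF r] by simp
  moreover have "(\<lambda>n. a n * complex_of_real r ^ n) sums f r" using r by (intro a) simp
  ultimately show ?thesis by (rule sums_unique2)
qed

lemma expectation_poisson: "0 \<le> r \<Longrightarrow> r < 1 \<Longrightarrow> (LINT x|M. poisson r x) = 1"
proof -
  assume r: "0 \<le> r" "r < 1"
  have "complex_of_real (LINT x|M. poisson r x) = (LINT x|M. poisson r x * Y x ^ 0)" by simp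
  also have "\<dots> = 1" using poisson_moment[OF r, of 0] by simp
  finally show ?thesis by (simp only: of_real_eq_1_iff)
qed


section \<open>Moments of one Euler factor\<close>

definition factor :: "real \<Rightarrow> 'a \<Rightarrow> complex" where
  "factor r x = 1 / (1 - r * Y x)"

lemma factor_measurable [measurable]: "factor r \<in> borel_measurable M"
  unfolding factor_def by measurable

lemma norm_factor_square:
  assumes "0 \<le> r" "r < 1"
  shows "(norm (factor r x))^2 = poisson r x / (1 - r^2)"
proof -
  have "r^2 < 1" using assms by (simp add: power_less_one_iff)
  then show ?thesis unfolding factor_def poisson_def by (simp add: norm_divide power_divide)
qed

lemma expectation_norm_factor_square:
  assumes "0 \<le> r" "r < 1"
  shows "(LINT x|M. (norm (factor r x))^2) = 1 / (1 - r^2)"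
  using expectation_poisson[OF assms] by (simp add: norm_factor_square[OF assms])

lemma expectation_factor_square:
  assumes "0 \<le> r" "r < 1"
  shows "(LINT x|M. factor r x ^ 2) = 1"
proof -
  obtain R where R: "R > 1" "\<And>z. z \<in> ball 0 R \<Longrightarrow> norm (complex_of_real r * z) < 1"
    using ball_scaled_into_unit_disc[OF assms] by blast
  have "(LINT x|M. factor r x ^ 2) = (\<lambda>z::complex. (1 / (1 - r * z)) ^ 2) 0"
    unfolding factor_def
    by (intro expectation_holomorphic[OF _ R(1)] holomorphic_intros) (use R(2) in fastforce)
  then show ?thesis by simp
qed

text \<open>For \<open>k(z) = 1 / (1 - r z)\<close> this is \<open>z k'(z) / k(z)\<close> at
  \<open>z = Y x\<close>. If \<open>Y\<close> is rotated by \<open>cis (- (t * h))\<close>, the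
  logarithmic derivative of the factor in \<open>h\<close> is \<open>- \<i> * t\<close> times
  it.\<close>

definition logder :: "real \<Rightarrow> 'a \<Rightarrow> complex" where
  "logder r x = r * Y x / (1 - r * Y x)"

lemma logder_measurable [measurable]: "logder r \<in> borel_measurable M"
  unfolding logder_def by measurable

lemma expectation_factor_square_logder:
  assumes "0 \<le> r" "r < 1"
  shows "(LINT x|M. factor r x ^ 2 * logder r x) = 0"
proof -
  obtain R where R: "R > 1" "\<And>z. z \<in> ball 0 R \<Longrightarrow> norm (complex_of_real r * z) < 1"
    using ball_scaled_into_unit_disc[OF assms] by blast
  have "(LINT x|M. factor r x ^ 2 * logder r x) = (\<lambda>z::complex. (1 / (1 - r * z)) ^ 2 * (r * z / (1 - r * z))) 0"
    unfolding factor_def logder_def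
    by (intro expectation_holomorphic[OF _ R(1)] holomorphic_intros) (use R(2) in fastforce)+
  then show ?thesis by simp
qed

text \<open>The tilt gives the logarithmic derivative a drift, the value
  \<open>r^2 / (1 - r^2)\<close> of \<open>r z / (1 - r z)\<close> at \<open>z = r\<close>; the
  second factor is the mean of the squared modulus.\<close>

lemma expectation_poisson_logder:
  assumes "0 \<le> r" "r < 1"
  shows "(LINT x|M. (norm (factor r x))^2 * logder r x) = r^2 / (1 - r^2) * (1 / (1 - r^2))"
proof -
  obtain R where R: "R > 1" "\<And>z. z \<in> ball 0 R \<Longrightarrow> norm (complex_of_real r * z) < 1"
    using ball_scaled_into_unit_disc[OF assms] by blast
  have "(LINT x|M. poisson r x * logder r x) = (\<lambda>z::complex. r * z / (1 - r * z)) r"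
    unfolding logder_def
    by (intro poisson_holomorphic[OF assms _ R(1)] holomorphic_intros) (use R(2) in fastforce)
  moreover have "complex_of_real ((norm (factor r x))^2) * logder r x = poisson r x * logder r x / (1 - r^2)" for x
    unfolding norm_factor_square[OF assms] by simp
  ultimately show ?thesis by (simp add: power2_eq_square)
qed

text \<open>The Poisson integral of \<open>h(z) = (1 - r z) powr (- l / 2)\<close> is \<open>h(r)\<close>, which gives the bound
  without its second-order term; that term comes from projecting \<open>h\<close> also onto \<open>z - r\<close>.\<close>

lemma poisson_powr_lower_bound:
  assumes r: "0 \<le> r" "r^2 \<le> 1 / 2" and l: "0 \<le> l" "l \<le> 1"
  shows "(LINT x|M. poisson r x * norm (1 - r * Y x) powr -l) \<ge> (1 - r^2) powr -l * (1 + l^2 * r^2 / 8)"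
proof (cases "r = 0")
  case True
  then show ?thesis by (simp add: poisson_def prob_space)
next
  case False
  then have r0: "r > 0" using r by simp
  have r1: "r < 1"
  proof (rule ccontr)
    assume "\<not> r < 1"
    then have "1 \<le> r^2" by (simp add: one_le_power)
    with r show False by simp
  qed
  obtain R where R: "R > 1" "\<And>z. z \<in> ball 0 R \<Longrightarrow> norm (complex_of_real r * z) < 1"
    using ball_scaled_into_unit_disc[OF r(1) r1] by blast
  \<comment> \<open>On the circle \<open>(norm (h z))^2 = norm (1 - r * z) powr -l\<close>, so the
    left side of the claim is the squared L2 norm of a holomorphic function under the tilted
    law.\<close>
  define h where "h z = exp (-(l/2) * Ln (1 - complex_of_real r * z))" for z
  have half: "Re (1 - complex_of_real r * z) > 0" if "z \<in> ball 0 R" for z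
    using R(2)[OF that] abs_Re_le_cmod[of "complex_of_real r * z"] by auto
  have hol: "h holomorphic_on ball 0 R"
    unfolding h_def
    by (intro holomorphic_intros) (use half in \<open>auto simp: complex_nonpos_Reals_iff not_le\<close>)
  \<comment> \<open>On the circle \<open>h z * cnj z = g z + h 0 * cnj z\<close>, so the inner
    product of \<open>h\<close> with \<open>z\<close> also reduces to values of holomorphic
    functions.\<close>
  define g where "g z = (if z = 0 then deriv h 0 else (h z - h 0) / (z - 0))" for z
  have holg: "g holomorphic_on ball 0 R"
    unfolding g_def by (intro pole_lemma_open hol) auto
  have h0: "h 0 = 1" by (simp add: h_def)
  define H where "H = (1 - r^2) powr -(l/2)"
  have rr: "1 / 2 \<le> 1 - r^2" "1 - r^2 > 0" using r by auto
  have hr: "h r = H"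
  proof -
    have "h r = exp (-(l/2) * Ln (complex_of_real (1 - r^2)))" unfolding h_def by (simp add: power2_eq_square)
    also have "Ln (complex_of_real (1 - r^2)) = complex_of_real (ln (1 - r^2))"
      using rr by (intro Ln_of_real) auto
    also have "exp (-(l/2) * complex_of_real (ln (1 - r^2))) = complex_of_real (exp (-(l/2) * ln (1 - r^2)))"
      by (simp add: exp_of_real[symmetric])
    also have "exp (-(l/2) * ln (1 - r^2)) = H" using rr by (simp add: H_def powr_def)
    finally show ?thesis .
  qed
  have nz: "1 - complex_of_real r * Y x \<noteq> 0" for x
    using norm_one_minus_ge[of r x] r r1 by auto
  have hnorm: "(norm (h (Y x)))^2 = norm (1 - r * Y x) powr -l" for x
  proof -
    have "(norm (h (Y x)))^2 = exp (2 * Re (-(l/2) * Ln (1 - complex_of_real r * Y x)))"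
      unfolding h_def norm_exp_eq_Re by (simp only: exp_double)
    also have "Re (-(l/2) * Ln (1 - complex_of_real r * Y x)) = -(l/2) * ln (norm (1 - r * Y x))"
      using nz[of x] by simp
    finally show ?thesis using nz[of x] by (simp add: powr_def)
  qed
  have hmeas [measurable]: "(\<lambda>x. h (Y x)) \<in> borel_measurable M" unfolding h_def by measurable
  have gmeas [measurable]: "(\<lambda>x. g (Y x)) \<in> borel_measurable M" unfolding g_def by measurable
  define B where "B = (1 - r) powr -l"
  have B1: "norm (1 - r * Y x) powr -l \<le> B" for x
    unfolding B_def using norm_one_minus_ge[of r x] r1 r l by (intro powr_mono2') auto
  have B0: "B \<ge> 1" unfolding B_def
    using r r1 l by (simp add: powr_minus field_simps powr_le1)
  have hb: "norm (h (Y x)) \<le> B" for x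
  proof -
    have "(norm (h (Y x)))^2 \<le> B" using B1 hnorm by simp
    also have "B \<le> B^2" using B0 by (simp add: power2_eq_square)
    finally show ?thesis using B0 by (simp add: abs_le_square_iff[symmetric])
  qed
  have gb: "norm (g (Y x)) \<le> B + 1" for x
  proof -
    have "Y x \<noteq> 0" using norm_Y[of x] by (metis norm_zero zero_neq_one)
    then have "norm (g (Y x)) = norm (h (Y x) - 1)" by (simp add: g_def h0 norm_divide)
    also have "\<dots> \<le> norm (h (Y x)) + 1" using norm_triangle_ineq4[of "h (Y x)" 1] by simp
    finally show ?thesis using hb[of x] by simp
  qed
  have pb: "poisson r x \<le> 1 / (1 - r)^2" "poisson r x \<ge> 0" for x
    using poisson_bounded poisson_nonneg r r1 by auto
  have int: "integrable M (\<lambda>x. poisson r x * f x)"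
    if "f \<in> borel_measurable M" "\<And>x. norm (f x) \<le> C" for f :: "'a \<Rightarrow> complex" and C
  proof (rule integrable_bounded[where B = "1 / (1 - r)^2 * C"])
    show "norm (poisson r x * f x) \<le> 1 / (1 - r)^2 * C" for x
      using mult_mono[OF pb(1) that(2)] pb(2) by (simp add: norm_mult)
  qed (use that in measurable)
  have intr: "integrable M (\<lambda>x. poisson r x * f x)"
    if "f \<in> borel_measurable M" "\<And>x. norm (f x) \<le> C" for f :: "'a \<Rightarrow> real" and C
  proof (rule integrable_bounded[where B = "1 / (1 - r)^2 * C"])
    show "norm (poisson r x * f x) \<le> 1 / (1 - r)^2 * C" for x
      using mult_mono[OF pb(1) that(2)] pb(2) by (simp add: abs_mult)
  qed (use that in measurable)
  have ReE: "(LINT x|M. poisson r x * Re (f x)) = Re (LINT x|M. poisson r x * f x)"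
    if "f \<in> borel_measurable M" "\<And>x. norm (f x) \<le> C" for f :: "'a \<Rightarrow> complex" and C
    using int[OF that] by (subst integral_Re[symmetric]) auto
  have Eh: "(LINT x|M. poisson r x * Re (h (Y x))) = H"
    by (subst ReE[OF hmeas hb]) (simp add: poisson_holomorphic[OF r(1) r1 hol R(1)] hr)
  have Eg: "(LINT x|M. poisson r x * Re (g (Y x))) = (H - 1) / r"
  proof -
    have "g r = (H - 1) / r" using r0 by (simp add: g_def hr h0)
    then show ?thesis
      by (subst ReE[OF gmeas gb]) (simp add: poisson_holomorphic[OF r(1) r1 holg R(1)] Re_divide_of_real)
  qed
  have EY: "(LINT x|M. poisson r x * Re (Y x)) = r"
    using poisson_moment[OF r(1) r1, of 1] by (subst ReE[of Y 1]) auto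
  \<comment> \<open>With the constant term \<open>1\<close>,
    \<open>1 + c * z = H + c * (z - r)\<close> is the orthogonal projection of \<open>h\<close> to
    the span of \<open>1\<close> and \<open>z\<close> under the tilted law; \<open>z - r\<close> is
    orthogonal to \<open>1\<close> and has squared norm \<open>1 - r^2\<close>.\<close>
  define c where "c = (H - 1) / r"
  define \<alpha> :: real where "\<alpha> = 1"
  define E where "E = (LINT x|M. poisson r x * norm (1 - r * Y x) powr -l)"
  have ex: "(norm (h (Y x) - \<alpha> - c * Y x))^2 = norm (1 - r * Y x) powr -l + (\<alpha>^2 + c^2)
      + (2 * \<alpha> * c - 2 * c) * Re (Y x) - 2 * \<alpha> * Re (h (Y x)) - 2 * c * Re (g (Y x))" for x
  proof -
    have n1: "(Re (Y x))^2 + (Im (Y x))^2 = 1"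
      using norm_Y[of x] by (simp add: cmod_def)
    have "Y x \<noteq> 0" using norm_Y[of x] by (metis norm_zero zero_neq_one)
    then have "h (Y x) = g (Y x) * Y x + 1" by (simp add: g_def h0)
    then have "Re (h (Y x)) * Re (Y x) + Im (h (Y x)) * Im (Y x)
       = Re (g (Y x)) * ((Re (Y x))^2 + (Im (Y x))^2) + Re (Y x)"
      by (simp add: algebra_simps power2_eq_square)
    then have m: "Re (h (Y x)) * Re (Y x) + Im (h (Y x)) * Im (Y x) = Re (g (Y x)) + Re (Y x)"
      using n1 by simp
    have "(norm (h (Y x) - \<alpha> - c * Y x))^2 = (norm (h (Y x)))^2 + \<alpha>^2 + c^2 * ((Re (Y x))^2 + (Im (Y x))^2)
      + 2 * \<alpha> * c * Re (Y x) - 2 * \<alpha> * Re (h (Y x)) - 2 * c * (Re (h (Y x)) * Re (Y x) + Im (h (Y x)) * Im (Y x))"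
      unfolding cmod_power2 by (simp add: power2_eq_square algebra_simps)
    then show ?thesis unfolding m n1 hnorm by (simp add: algebra_simps)
  qed
  have "0 \<le> (LINT x|M. poisson r x * (norm (h (Y x) - \<alpha> - c * Y x))^2)"
    using pb by (intro integral_nonneg_AE) auto
  also have "\<dots> = (LINT x|M. poisson r x * norm (1 - r * Y x) powr -l + (\<alpha>^2 + c^2) * poisson r x
      + (2 * \<alpha> * c - 2 * c) * (poisson r x * Re (Y x)) - 2 * \<alpha> * (poisson r x * Re (h (Y x))) - 2 * c * (poisson r x * Re (g (Y x))))"
    unfolding ex by (simp add: algebra_simps)
  also have "\<dots> = E + (\<alpha>^2 + c^2) + (2 * \<alpha> * c - 2 * c) * r - 2 * \<alpha> * H - 2 * c * ((H - 1) / r)"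
  proof -
    have i1: "integrable M (\<lambda>x. poisson r x * norm (1 - r * Y x) powr -l)"
      using B1 by (intro intr[of _ B]) auto
    have i2: "integrable M (\<lambda>x. poisson r x * Re (Y x))"
      by (intro intr[of _ 1]) (auto intro: order_trans[OF abs_Re_le_cmod])
    have i3: "integrable M (\<lambda>x. poisson r x * Re (h (Y x)))"
      using hb by (intro intr[of _ B]) (auto intro: order_trans[OF abs_Re_le_cmod])
    have i4: "integrable M (\<lambda>x. poisson r x * Re (g (Y x)))"
      using gb by (intro intr[of _ "B + 1"]) (auto intro: order_trans[OF abs_Re_le_cmod])
    have i5: "integrable M (poisson r)"
      using pb by (intro integrable_bounded[where B = "1 / (1 - r)^2"]) auto
    have lin: "(LINT x|M. f1 x + b1 * f2 x + b2 * f3 x - b3 * f4 x - b4 * f5 x)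
        = integral\<^sup>L M f1 + b1 * integral\<^sup>L M f2 + b2 * integral\<^sup>L M f3 - b3 * integral\<^sup>L M f4 - b4 * integral\<^sup>L M f5"
      if "integrable M f1" "integrable M f2" "integrable M f3" "integrable M f4" "integrable M f5"
      for f1 f2 f3 f4 f5 :: "'a \<Rightarrow> real" and b1 b2 b3 b4
      using that by simp
    show ?thesis
      unfolding lin[OF i1 i5 i2 i3 i4] Eh Eg EY expectation_poisson[OF r(1) r1] E_def by simp
  qed
  also have "\<dots> = E - H^2 - c^2 * (1 - r^2)"
  proof -
    have "H = 1 + c * r" using r0 by (simp add: c_def)
    moreover have "(H - 1) / r = c" by (simp add: c_def)
    ultimately show ?thesis by (simp add: \<alpha>_def power2_eq_square algebra_simps)
  qed
  finally have E1: "E \<ge> H^2 + c^2 * (1 - r^2)" by simp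
  have H0: "H > 0" using rr by (simp add: H_def)
  have H2: "H^2 = (1 - r^2) powr -l"
    using rr by (simp add: H_def power2_eq_square flip: powr_add)
  \<comment> \<open>Weighted arithmetic-geometric mean. It yields
    \<open>c^2 \<ge> l^2 * r^2 / 4 * H^2\<close>, and \<open>1 - r^2 \<ge> 1/2\<close> turns the
    \<open>4\<close> into the \<open>8\<close> of the claim.\<close>
  have "1 / H \<le> 1 - l / 2 * r^2"
  proof -
    have "(1 - r^2) powr (l/2) * 1 powr (1 - l/2) \<le> (l/2) * (1 - r^2) + (1 - l/2) * 1"
      using l rr by (intro Youngs_inequality_0) auto
    moreover have "1 / H = (1 - r^2) powr (l/2)" unfolding H_def powr_minus_divide by simp
    ultimately show ?thesis by (simp add: algebra_simps)
  qed
  then have "l / 2 * r^2 * H \<le> H - 1" using H0 by (simp add: field_simps)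
  then have "(l / 2 * r^2 * H)^2 \<le> (H - 1)^2" using l H0 by (intro power_mono) auto
  then have "(l / 2 * r^2 * H)^2 / r^2 \<le> c^2" unfolding c_def power_divide by (intro divide_right_mono) auto
  then have "l^2 * r^2 / 4 * H^2 \<le> c^2" using r0 by (simp add: power_mult_distrib power_divide field_simps power2_eq_square)
  then have "l^2 * r^2 / 4 * H^2 * (1 / 2) \<le> c^2 * (1 - r^2)"
    using rr by (intro mult_mono) auto
  then have "H^2 * (1 + l^2 * r^2 / 8) \<le> E" using E1 by (simp add: algebra_simps)
  then show ?thesis by (simp add: H2 E_def)
qed

end

section \<open>Random Euler products and the barrier estimate\<close>

text \<open>For the Steinhaus Euler product \<open>I\<close> is the set of primes, \<open>r p = 1 / sqrt p\<close> and
  \<open>t p = ln p\<close>, so that \<open>fac p h\<close> is the Euler factor at \<open>1/2 + ih\<close>; it is \<open>1\<close> off \<open>I\<close>.\<close>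

locale circle_chaos = prob_space M for M :: "'a measure" +
  fixes X :: "nat \<Rightarrow> 'a \<Rightarrow> complex" and I :: "nat set" and r t :: "nat \<Rightarrow> real"
  assumes indep: "indep_vars (\<lambda>_. borel) X I"
    and norm_X: "\<And>j x. norm (X j x) = 1"
    and moment_X: "\<And>j m. j \<in> I \<Longrightarrow> m > 0 \<Longrightarrow> (LINT x|M. X j x ^ m) = 0"
    and zero_notin: "0 \<notin> I"
    and r_nonneg: "\<And>j. 0 \<le> r j"
    and r_le: "\<And>j. (r j)^2 \<le> 1 / 2"
    and r_off: "\<And>j. j \<notin> I \<Longrightarrow> r j = 0"
    and t_nonneg: "\<And>j. 0 \<le> t j"
begin

section \<open>Measurability in the past and factorisation\<close>

definition X' :: "nat \<Rightarrow> 'a \<Rightarrow> complex" where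
  "X' j x = (if j \<in> I then X j x else 1)"

text \<open>The sigma-algebra generated by the variables of index at most \<open>n\<close>;
  measurability with respect to it serves as adaptedness.\<close>

definition past :: "nat \<Rightarrow> 'a measure" where
  "past n = vimage_algebra (space M) (\<lambda>x. restrict (\<lambda>j. X j x) (I \<inter> {..n})) (PiM (I \<inter> {..n}) (\<lambda>_. borel))"

lemma space_past [simp]: "space (past n) = space M"
  by (simp add: past_def)

lemma X_measurable: "j \<in> I \<Longrightarrow> X j \<in> borel_measurable M"
  using indep unfolding indep_vars_def by auto

lemma restrict_X_measurable:
  "(\<lambda>x. restrict (\<lambda>j. X j x) (I \<inter> {..n})) \<in> measurable M (PiM (I \<inter> {..n}) (\<lambda>_. borel))"
  by (intro measurable_restrict) (auto intro: X_measurable)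

lemma past_subset: "Y \<in> measurable (past n) N \<Longrightarrow> Y \<in> measurable M N"
proof (rule measurable_mono[THEN subsetD, rotated -1])
  show "sets (past n) \<subseteq> sets M"
    unfolding past_def using restrict_X_measurable
    by (auto simp: sets_vimage_algebra2[OF measurable_space[OF restrict_X_measurable, THEN funcsetI]] measurable_sets)
qed (auto simp: past_def)

lemma X'_measurable_past: "j \<le> n \<Longrightarrow> X' j \<in> borel_measurable (past n)"
proof (cases "j \<in> I")
  case True
  assume "j \<le> n"
  have "(\<lambda>x. restrict (\<lambda>j. X j x) (I \<inter> {..n})) \<in> measurable (past n) (PiM (I \<inter> {..n}) (\<lambda>_. borel))"
    unfolding past_def by (rule measurable_vimage_algebra1) (use measurable_space[OF restrict_X_measurable] in auto)
  moreover have "(\<lambda>y. y j) \<in> borel_measurable (PiM (I \<inter> {..n}) (\<lambda>_. borel :: complex measure))"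
    using True \<open>j \<le> n\<close> by (intro measurable_component_singleton) simp
  ultimately have "(\<lambda>x. restrict (\<lambda>j. X j x) (I \<inter> {..n}) j) \<in> borel_measurable (past n)"
    by (rule measurable_compose)
  then show ?thesis using True \<open>j \<le> n\<close> by (simp add: X'_def[abs_def])
qed (simp add: X'_def[abs_def])

lemma X'_measurable [measurable]: "X' j \<in> borel_measurable M"
  using past_subset[OF X'_measurable_past[of j j]] by simp

lemma norm_X' [simp]: "norm (X' j x) = 1"
  by (simp add: X'_def norm_X)

text \<open>The index blocks up to \<open>n\<close> and \<open>{Suc n}\<close> are independent, and
  functions of a block generate smaller sigma-algebras.\<close>

lemma indep_past:
  fixes Y :: "'a \<Rightarrow> 'c::topological_space" and \<phi> :: "complex \<Rightarrow> 'c"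
  assumes Y: "Y \<in> borel_measurable (past n)" and \<phi> [measurable]: "\<phi> \<in> borel_measurable borel" and I: "Suc n \<in> I"
  shows "indep_var borel Y borel (\<lambda>x. \<phi> (X (Suc n) x))"
proof -
  let ?f = "\<lambda>x. restrict (\<lambda>j. X j x) (I \<inter> {..n})"
  let ?P = "PiM (I \<inter> {..n}) (\<lambda>_. borel :: complex measure)"
  let ?g = "\<lambda>x. restrict (\<lambda>j. X j x) {Suc n}"
  let ?Q = "PiM {Suc n} (\<lambda>_. borel :: complex measure)"
  have "indep_var ?P ?f ?Q ?g"
    using I by (intro indep_var_restrict[OF indep]) auto
  then have ind: "indep_set (sigma_sets (space M) {?f -` A \<inter> space M | A. A \<in> sets ?P})
      (sigma_sets (space M) {?g -` A \<inter> space M | A. A \<in> sets ?Q})"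
    unfolding indep_var_eq by auto
  have sub1: "{Y -` A \<inter> space M | A. A \<in> sets borel} \<subseteq> {?f -` A \<inter> space M | A. A \<in> sets ?P}"
  proof safe
    fix A :: "'c set" assume "A \<in> sets borel"
    then have "Y -` A \<inter> space (past n) \<in> sets (past n)" by (rule measurable_sets[OF Y])
    moreover have "?f \<in> space M \<rightarrow> space ?P" using measurable_space[OF restrict_X_measurable] by auto
    ultimately show "\<exists>B. Y -` A \<inter> space M = ?f -` B \<inter> space M \<and> B \<in> sets ?P"
      unfolding past_def by (simp add: sets_vimage_algebra2)
  qed
  have sub2: "{(\<lambda>x. \<phi> (X (Suc n) x)) -` A \<inter> space M | A. A \<in> sets borel} \<subseteq> {?g -` A \<inter> space M | A. A \<in> sets ?Q}"
  proof safe
    fix A :: "'c set" assume A: "A \<in> sets borel"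
    have "(\<lambda>y. y (Suc n)) \<in> borel_measurable ?Q" by (rule measurable_component_singleton) simp
    then have "(\<lambda>y. \<phi> (y (Suc n))) \<in> borel_measurable ?Q" by (rule measurable_compose) (rule \<phi>)
    note meas = measurable_sets[OF this A]
    have "?g x \<in> space ?Q" for x unfolding space_PiM by (simp only: restrict_PiE) simp
    then have "(\<lambda>x. \<phi> (X (Suc n) x)) -` A \<inter> space M = ?g -` ((\<lambda>y. \<phi> (y (Suc n))) -` A \<inter> space ?Q) \<inter> space M"
      by (intro set_eqI) (simp only: Int_iff vimage_eq restrict_apply singletonI if_True simp_thms)
    with meas show "\<exists>B. (\<lambda>x. \<phi> (X (Suc n) x)) -` A \<inter> space M = ?g -` B \<inter> space M \<and> B \<in> sets ?Q"
      by blast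
  qed
  have "indep_set (sigma_sets (space M) {Y -` A \<inter> space M | A. A \<in> sets borel})
      (sigma_sets (space M) {(\<lambda>x. \<phi> (X (Suc n) x)) -` A \<inter> space M | A. A \<in> sets borel})"
    using ind unfolding indep_set_def
  proof (rule indep_sets_mono_sets)
    fix b :: bool
    show "case_bool (sigma_sets (space M) {Y -` A \<inter> space M | A. A \<in> sets borel})
        (sigma_sets (space M) {(\<lambda>x. \<phi> (X (Suc n) x)) -` A \<inter> space M | A. A \<in> sets borel}) b
      \<subseteq> case_bool (sigma_sets (space M) {?f -` A \<inter> space M | A. A \<in> sets ?P})
        (sigma_sets (space M) {?g -` A \<inter> space M | A. A \<in> sets ?Q}) b"
      using sigma_sets_mono'[OF sub1] sigma_sets_mono'[OF sub2] by (cases b) (simp_all only: bool.case)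
  qed
  moreover have "(\<lambda>x. \<phi> (X (Suc n) x)) \<in> borel_measurable M"
    using X_measurable[OF I] by (rule measurable_compose) (rule \<phi>)
  ultimately show ?thesis
    unfolding indep_var_eq using past_subset[OF Y] by auto
qed

text \<open>Stands in for conditioning on the past. If \<open>Suc n \<notin> I\<close>, then
  \<open>X'\<close> is constantly \<open>1\<close> there, so steps on and off \<open>I\<close> are
  treated alike.\<close>

lemma expectation_mult_step:
  fixes Y :: "'a \<Rightarrow> 'c::{real_normed_field,banach,second_countable_topology}" and \<phi> :: "complex \<Rightarrow> 'c"
  assumes Y: "Y \<in> borel_measurable (past n)" "\<And>x. norm (Y x) \<le> B"
    and \<phi>: "\<phi> \<in> borel_measurable borel" "\<And>x. norm (\<phi> (X' (Suc n) x)) \<le> B'"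
  shows "(LINT x|M. Y x * \<phi> (X' (Suc n) x)) = (LINT x|M. Y x) * (LINT x|M. \<phi> (X' (Suc n) x))"
proof (cases "Suc n \<in> I")
  case True
  have "indep_var borel Y borel (\<lambda>x. \<phi> (X (Suc n) x))"
    by (rule indep_past[OF Y(1) \<phi>(1) True])
  moreover have "integrable M Y" using Y by (intro integrable_bounded past_subset) auto
  moreover have "integrable M (\<lambda>x. \<phi> (X' (Suc n) x))"
    using \<phi> by (intro integrable_bounded) (auto intro: measurable_compose[OF X'_measurable])
  ultimately show ?thesis using True by (simp add: X'_def indep_var_lebesgue_integral)
qed (simp add: X'_def prob_space)

section \<open>The factor at a given height and its moments\<close>

definition fac :: "nat \<Rightarrow> real \<Rightarrow> 'a \<Rightarrow> complex" where
  "fac j h x = 1 / (1 - r j * (cis (-(t j * h)) * X' j x))"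

definition ld :: "nat \<Rightarrow> real \<Rightarrow> 'a \<Rightarrow> complex" where
  "ld j h x = r j * (cis (-(t j * h)) * X' j x) / (1 - r j * (cis (-(t j * h)) * X' j x))"

definition w :: "nat \<Rightarrow> real" where
  "w j = 1 / (1 - (r j)^2)"

lemma r_lt_1: "r j < 1"
proof (rule ccontr)
  assume "\<not> r j < 1"
  then have "1 \<le> (r j)^2" by (simp add: one_le_power)
  with r_le[of j] show False by simp
qed

text \<open>A rational bound above \<open>sqrt (1/2)\<close>; it is the origin of the constant
  \<open>4\<close> in the bounds for factors, overshoots and logarithmic derivatives.\<close>

lemma r_le_three_quarters: "r j \<le> 3 / 4"
proof (rule ccontr)
  assume "\<not> r j \<le> 3 / 4"
  then have "(3/4)^2 \<le> (r j)^2" by (intro power_mono) auto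
  with r_le[of j] show False by (simp add: power2_eq_square)
qed

lemma w_ge_1: "w j \<ge> 1" and w_le_2: "w j \<le> 2"
  using r_le[of j] by (auto simp: w_def divide_simps)

lemma circle_X':
  assumes "j \<in> I"
  shows "circle_variable M (\<lambda>x. cis (-(t j * h)) * X' j x)"
proof
  show "(LINT x|M. (cis (- (t j * h)) * X' j x) ^ m) = 0" if "m > 0" for m
    using moment_X[OF assms that] assms by (simp add: power_mult_distrib X'_def)
qed (auto simp: norm_mult)

lemma norm_denominator_ge: "norm (1 - complex_of_real (r j) * (cis (-(t j * h)) * X' j x)) \<ge> 1 / 4"
proof -
  have "norm (complex_of_real (r j) * (cis (-(t j * h)) * X' j x)) = r j"
    using r_nonneg by (simp add: norm_mult)
  then show ?thesis
    using norm_triangle_ineq2[of 1 "complex_of_real (r j) * (cis (-(t j * h)) * X' j x)"] r_le_three_quarters[of j]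
    by simp
qed

lemma denominator_nonzero: "1 - complex_of_real (r j) * (cis (-(t j * h)) * X' j x) \<noteq> 0"
  using norm_denominator_ge[of j h x] by auto

lemma norm_fac_le: "norm (fac j h x) \<le> 4"
proof -
  have "norm (fac j h x) = 1 / norm (1 - complex_of_real (r j) * (cis (-(t j * h)) * X' j x))"
    by (simp only: fac_def norm_divide norm_one)
  also have "\<dots> \<le> 1 / (1 / 4)"
    using norm_denominator_ge[of j h x] by (intro divide_left_mono) auto
  finally show ?thesis by simp
qed

lemma norm_ld_le: "norm (ld j h x) \<le> 4 * r j"
proof -
  have "norm (ld j h x) = r j / norm (1 - complex_of_real (r j) * (cis (-(t j * h)) * X' j x))"
    unfolding ld_def using r_nonneg by (simp add: norm_divide norm_mult)
  also have "\<dots> \<le> r j / (1 / 4)"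
    using norm_denominator_ge[of j h x] r_nonneg[of j] by (intro divide_left_mono) auto
  finally show ?thesis by simp
qed

lemma expectation_fac_norm_square: "(LINT x|M. (norm (fac j h x))^2) = w j"
proof (cases "j \<in> I")
  case True
  interpret c: circle_variable M "\<lambda>x. cis (-(t j * h)) * X' j x" by (rule circle_X'[OF True])
  have "c.factor (r j) = fac j h" "c.logder (r j) = ld j h"
    by (simp_all only: c.factor_def fac_def c.logder_def ld_def fun_eq_iff simp_thms)
  then show ?thesis
    using c.expectation_norm_factor_square[OF r_nonneg[of j] r_lt_1[of j]] by (simp only: w_def)
qed (simp add: fac_def w_def r_off prob_space)

lemma expectation_fac_square: "(LINT x|M. (fac j h x)^2) = 1"
proof (cases "j \<in> I")
  case True
  interpret c: circle_variable M "\<lambda>x. cis (-(t j * h)) * X' j x" by (rule circle_X'[OF True])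
  have "c.factor (r j) = fac j h" "c.logder (r j) = ld j h"
    by (simp_all only: c.factor_def fac_def c.logder_def ld_def fun_eq_iff simp_thms)
  then show ?thesis
    using c.expectation_factor_square[OF r_nonneg[of j] r_lt_1[of j]] by (simp only:)
qed (simp add: fac_def r_off prob_space)

lemma expectation_fac_square_ld: "(LINT x|M. (fac j h x)^2 * ld j h x) = 0"
proof (cases "j \<in> I")
  case True
  interpret c: circle_variable M "\<lambda>x. cis (-(t j * h)) * X' j x" by (rule circle_X'[OF True])
  have "c.factor (r j) = fac j h" "c.logder (r j) = ld j h"
    by (simp_all only: c.factor_def fac_def c.logder_def ld_def fun_eq_iff simp_thms)
  then show ?thesis
    using c.expectation_factor_square_logder[OF r_nonneg[of j] r_lt_1[of j]] by (simp only:)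
qed (simp add: ld_def r_off)

lemma expectation_fac_norm_square_ld:
  "(LINT x|M. complex_of_real ((norm (fac j h x))^2) * ld j h x) = complex_of_real ((r j)^2 * w j * w j)"
proof (cases "j \<in> I")
  case True
  interpret c: circle_variable M "\<lambda>x. cis (-(t j * h)) * X' j x" by (rule circle_X'[OF True])
  have "c.factor (r j) = fac j h" "c.logder (r j) = ld j h"
    by (simp_all only: c.factor_def fac_def c.logder_def ld_def fun_eq_iff simp_thms)
  then have "(LINT x|M. complex_of_real ((norm (fac j h x))^2) * ld j h x)
      = complex_of_real ((r j)^2 / (1 - (r j)^2) * (1 / (1 - (r j)^2)))"
    using c.expectation_poisson_logder[OF r_nonneg[of j] r_lt_1[of j]] by (simp only: of_real_power of_real_mult of_real_divide of_real_diff of_real_1)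
  also have "(r j)^2 / (1 - (r j)^2) * (1 / (1 - (r j)^2)) = (r j)^2 * w j * w j" by (simp only: w_def) simp
  finally show ?thesis .
qed (simp add: ld_def r_off)

text \<open>The power splits as \<open>w j\<close> times the Poisson kernel times
  \<open>norm (1 - r z) powr -l\<close>, which brings the one-variable bound into play.\<close>

lemma expectation_fac_powr_ge:
  assumes "0 \<le> l" "l \<le> 1"
  shows "(LINT x|M. norm (fac j h x) powr (2 + l)) \<ge> w j powr (1 + l) * (1 + l^2 * (r j)^2 / 8)"
proof (cases "j \<in> I")
  case True
  interpret c: circle_variable M "\<lambda>x. cis (-(t j * h)) * X' j x" by (rule circle_X'[OF True])
  have w0: "w j > 0" using w_ge_1[of j] by simp
  have eq: "norm (fac j h x) powr (2 + l) = w j * (c.poisson (r j) x * norm (1 - r j * (cis (-(t j * h)) * X' j x)) powr -l)" for x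
  proof -
    define d where "d = norm (1 - complex_of_real (r j) * (cis (-(t j * h)) * X' j x))"
    have d: "d > 0" unfolding d_def using norm_denominator_ge[of j h x] by linarith
    have "norm (fac j h x) = 1 / d" by (simp only: fac_def d_def norm_divide norm_one)
    then have "norm (fac j h x) powr (2 + l) = (1 / d) powr 2 * (1 / d) powr l"
      by (simp only: powr_add)
    also have "(1 / d) powr 2 = 1 / d^2" using d by (simp add: power_divide)
    also have "(1 / d) powr l = d powr -l" using d by (simp add: powr_divide powr_minus_divide)
    also have "1 / d^2 = w j * c.poisson (r j) x"
    proof -
      have "c.poisson (r j) x = (1 - (r j)^2) / d^2" by (simp only: c.poisson_def d_def)
      then show ?thesis using r_le[of j] by (simp add: w_def)
    qed
    finally show ?thesis unfolding d_def by (simp only: mult.assoc)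
  qed
  have "w j powr l = (1 - (r j)^2) powr -l"
    using r_le[of j] by (simp add: w_def powr_divide powr_minus_divide)
  moreover have "w j powr (1 + l) = w j * w j powr l" using w0 by (simp add: powr_add)
  ultimately have "w j powr (1 + l) * (1 + l^2 * (r j)^2 / 8) = w j * ((1 - (r j)^2) powr -l * (1 + l^2 * (r j)^2 / 8))"
    by simp
  also have "\<dots> \<le> w j * (LINT x|M. c.poisson (r j) x * norm (1 - r j * (cis (-(t j * h)) * X' j x)) powr -l)"
    using w0 c.poisson_powr_lower_bound[OF r_nonneg[of j] r_le[of j] assms] by (intro mult_left_mono) auto
  finally show ?thesis unfolding eq by simp
qed (simp add: fac_def w_def r_off prob_space)

section \<open>The truncated product and its path under the tilt\<close>

definition F :: "nat \<Rightarrow> real \<Rightarrow> 'a \<Rightarrow> complex" where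
  "F n h x = (\<Prod>j\<le>n. fac j h x)"

definition W :: "nat \<Rightarrow> real" where
  "W n = (\<Prod>j\<le>n. w j)"

text \<open>The clock of the walk: \<open>ln (W n)\<close> has the order of the variance of
  \<open>ln (norm (F n h x))\<close> under the tilted law, and the shift keeps \<open>u\<close> at
  least \<open>1\<close>.\<close>

definition u :: "nat \<Rightarrow> real" where
  "u n = 1 + ln (W n)"

lemma F_0 [simp]: "F 0 h x = 1"
  by (simp add: F_def fac_def r_off zero_notin)

lemma F_Suc: "F (Suc n) h x = F n h x * fac (Suc n) h x"
  by (simp add: F_def)

lemma W_0 [simp]: "W 0 = 1"
  by (simp add: W_def w_def r_off zero_notin)

lemma W_Suc: "W (Suc n) = W n * w (Suc n)"
  by (simp add: W_def)

lemma W_ge_1: "W n \<ge> 1"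
  unfolding W_def using w_ge_1 by (intro prod_ge_1) auto

lemma W_pos: "W n > 0"
  using W_ge_1[of n] by linarith

lemma W_mono: "W n \<le> W (Suc n)"
  using w_ge_1[of "Suc n"] W_pos[of n] by (simp add: W_Suc)

lemma u_0 [simp]: "u 0 = 1" by (simp add: u_def)

lemma u_ge_1: "u n \<ge> 1" using W_ge_1[of n] by (simp add: u_def)

lemma u_mono: "u n \<le> u (Suc n)" using W_mono[of n] W_pos by (simp add: u_def)

lemma u_Suc_le: "u (Suc n) \<le> 2 * u n"
proof -
  have "ln (W (Suc n)) = ln (W n) + ln (w (Suc n))"
    using W_pos[of n] w_ge_1[of "Suc n"] by (simp add: W_Suc ln_mult)
  moreover have "ln (w (Suc n)) \<le> 1"
    using ln_le_minus_one[of "w (Suc n)"] w_ge_1[of "Suc n"] w_le_2[of "Suc n"] by simp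
  ultimately show ?thesis using u_ge_1[of n] by (simp add: u_def)
qed

lemma norm_F_le: "norm (F n h x) \<le> 4 ^ Suc n"
proof -
  have "norm (F n h x) = (\<Prod>j\<le>n. norm (fac j h x))" by (simp add: F_def prod_norm)
  also have "\<dots> \<le> (\<Prod>j\<le>n. 4)" using norm_fac_le by (intro prod_mono) auto
  finally show ?thesis by simp
qed

lemma fac_measurable_past: "j \<le> n \<Longrightarrow> (\<lambda>x. fac j (fst x) (snd x)) \<in> borel_measurable (borel \<Otimes>\<^sub>M past n)"
proof -
  assume "j \<le> n"
  note X'_measurable_past[OF this, measurable]
  have [measurable]: "cis \<in> borel_measurable borel" by (intro borel_measurable_continuous_onI continuous_intros)
  show ?thesis unfolding fac_def by measurable
qed

lemma ld_measurable_past: "j \<le> n \<Longrightarrow> (\<lambda>x. ld j (fst x) (snd x)) \<in> borel_measurable (borel \<Otimes>\<^sub>M past n)"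
proof -
  assume "j \<le> n"
  note X'_measurable_past[OF this, measurable]
  have [measurable]: "cis \<in> borel_measurable borel" by (intro borel_measurable_continuous_onI continuous_intros)
  show ?thesis unfolding ld_def by measurable
qed

lemma F_measurable_past_pair: "k \<le> n \<Longrightarrow> (\<lambda>x. F k (fst x) (snd x)) \<in> borel_measurable (borel \<Otimes>\<^sub>M past n)"
  unfolding F_def by (intro borel_measurable_prod fac_measurable_past) auto

lemma F_measurable_past: "k \<le> n \<Longrightarrow> F k h \<in> borel_measurable (past n)"
  using measurable_compose[OF measurable_Pair1'[of h borel "past n"] F_measurable_past_pair[of k n]] by simp

lemma F_measurable [measurable]: "F k h \<in> borel_measurable M"
  using past_subset[OF F_measurable_past[of k k h]] by simp

lemma expectation_step:
  fixes Y :: "'a \<Rightarrow> 'c::{real_normed_field,banach,second_countable_topology}" and \<phi> :: "complex \<Rightarrow> complex \<Rightarrow> 'c"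
  assumes Y: "Y \<in> borel_measurable (past n)" "\<And>x. norm (Y x) \<le> B"
    and \<phi> [measurable]: "(\<lambda>y. \<phi> (fst y) (snd y)) \<in> borel_measurable (borel \<Otimes>\<^sub>M borel)"
    and B': "\<And>x. norm (\<phi> (fac (Suc n) h x) (ld (Suc n) h x)) \<le> B'"
  shows "(LINT x|M. Y x * \<phi> (fac (Suc n) h x) (ld (Suc n) h x))
     = (LINT x|M. Y x) * (LINT x|M. \<phi> (fac (Suc n) h x) (ld (Suc n) h x))"
proof -
  define f where "f z = 1 / (1 - r (Suc n) * (cis (-(t (Suc n) * h)) * z))" for z
  define g where "g z = r (Suc n) * (cis (-(t (Suc n) * h)) * z) / (1 - r (Suc n) * (cis (-(t (Suc n) * h)) * z))" for z
  have eq: "fac (Suc n) h x = f (X' (Suc n) x)" "ld (Suc n) h x = g (X' (Suc n) x)" for x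
    by (simp_all add: fac_def f_def ld_def g_def)
  have [measurable]: "f \<in> borel_measurable borel" "g \<in> borel_measurable borel"
    unfolding f_def g_def by measurable
  have "(\<lambda>z. (\<lambda>y. \<phi> (fst y) (snd y)) (f z, g z)) \<in> borel_measurable borel"
    by (rule measurable_compose[OF _ \<phi>]) measurable
  then show ?thesis
    using B' unfolding eq by (intro expectation_mult_step[OF Y, where \<phi> = "\<lambda>z. \<phi> (f z) (g z)"]) auto
qed


text \<open>\<open>ln (w j) \<le> 2 * (r j)^2\<close> converts each gain
  \<open>l^2 * (r j)^2 / 8\<close> into an increment of the clock, and
  \<open>(1 + d) * (1 + y) \<ge> 1 + d + y\<close> accumulates the gains.\<close>

lemma W_moment_lower_bound:
  assumes l: "0 \<le> l" "l \<le> 1"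
  shows "(\<Prod>j\<le>n. LINT x|M. norm (fac j h x) powr (2 + l)) \<ge> W n powr (1 + l) * (1 + l^2 * (u n - 1) / 16)"
proof (induction n)
  case 0
  have "fac 0 h = (\<lambda>_. 1)" using F_0[of h] by (auto simp: F_def)
  then show ?case by (simp add: prob_space)
next
  case (Suc n)
  let ?m = "\<lambda>j. LINT x|M. norm (fac j h x) powr (2 + l)"
  have wS: "w (Suc n) \<ge> 1" by (rule w_ge_1)
  have "ln (w (Suc n)) \<le> 2 * (r (Suc n))^2"
  proof -
    have "ln (w (Suc n)) \<le> w (Suc n) - 1" using ln_le_minus_one wS by simp
    also have "\<dots> = (r (Suc n))^2 * w (Suc n)" using r_le[of "Suc n"] by (simp add: w_def field_simps)
    also have "\<dots> \<le> (r (Suc n))^2 * 2" using w_le_2 by (intro mult_left_mono) auto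
    finally show ?thesis by simp
  qed
  then have lnw: "l^2 * ln (w (Suc n)) / 16 \<le> l^2 * (r (Suc n))^2 / 8"
    using mult_left_mono[of "ln (w (Suc n))" "2 * (r (Suc n))^2" "l^2"] by simp
  have uS: "u (Suc n) - 1 = (u n - 1) + ln (w (Suc n))"
    using W_pos[of n] wS by (simp add: u_def W_Suc ln_mult)
  have A0: "l^2 * (u n - 1) / 16 \<ge> 0" using u_ge_1[of n] by simp
  have "1 + l^2 * (u (Suc n) - 1) / 16 \<le> 1 + l^2 * (u n - 1) / 16 + l^2 * (r (Suc n))^2 / 8"
    unfolding uS distrib_left add_divide_distrib using lnw by linarith
  also have "\<dots> \<le> (1 + l^2 * (u n - 1) / 16) * (1 + l^2 * (r (Suc n))^2 / 8)"
  proof -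
    have "1 + d + y \<le> (1 + d) * (1 + y)" if "0 \<le> d" "0 \<le> y" for d y :: real
      using that by (simp add: algebra_simps)
    then show ?thesis using A0 by simp
  qed
  finally have "W (Suc n) powr (1 + l) * (1 + l^2 * (u (Suc n) - 1) / 16)
     \<le> W (Suc n) powr (1 + l) * ((1 + l^2 * (u n - 1) / 16) * (1 + l^2 * (r (Suc n))^2 / 8))"
    by (intro mult_left_mono) auto
  also have "\<dots> = (W n powr (1 + l) * (1 + l^2 * (u n - 1) / 16)) * (w (Suc n) powr (1 + l) * (1 + l^2 * (r (Suc n))^2 / 8))"
    using W_pos[of n] wS by (simp add: W_Suc powr_mult)
  also have "\<dots> \<le> (\<Prod>j\<le>n. ?m j) * ?m (Suc n)"
    using l A0 by (intro mult_mono Suc.IH expectation_fac_powr_ge prod_nonneg) auto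
  finally show ?case by simp
qed

definition below :: "(nat \<Rightarrow> real) \<Rightarrow> nat \<Rightarrow> real \<Rightarrow> 'a \<Rightarrow> real" where
  "below b n h x = (if \<forall>k\<le>n. norm (F k h x) \<le> b k then 1 else 0)"

lemma below_measurable_past: "below b n h \<in> borel_measurable (past n)"
proof -
  have [measurable]: "F k h \<in> borel_measurable (past n)" if "k \<in> {..n}" for k
    using F_measurable_past that by simp
  have "Measurable.pred (past n) (\<lambda>x. \<forall>k\<in>{..n}. norm (F k h x) \<le> b k)" by measurable
  then have "(\<lambda>x. if \<forall>k\<in>{..n}. norm (F k h x) \<le> b k then 1 else 0 :: real) \<in> borel_measurable (past n)" by measurable
  then show ?thesis by (simp add: below_def[abs_def] Ball_def)
qed

lemma below_measurable [measurable]: "below b n h \<in> borel_measurable M"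
  using past_subset[OF below_measurable_past] .

lemma below_bounds: "0 \<le> below b n h x" "below b n h x \<le> 1"
  by (auto simp: below_def)

lemma below_Suc_le: "below b (Suc n) h x \<le> below b n h x"
  by (auto simp: below_def)

lemma norm_F_powr_le: "0 \<le> s \<Longrightarrow> norm (F n h x) powr s \<le> (4 ^ Suc n) powr s"
  using norm_F_le[of n h x] by (intro powr_mono2) auto

lemma integrable_F_powr_below:
  "0 \<le> s \<Longrightarrow> integrable M (\<lambda>x. norm (F n h x) powr s * below b k h x)"
  using norm_F_powr_le[of s n h] below_bounds[of b k h]
  by (intro integrable_bounded[where B = "(4 ^ Suc n) powr s * 1"])
    (auto simp: abs_mult simp del: mult_1_right intro!: mult_mono)

lemma expectation_F_powr_below_step:
  assumes "0 \<le> s"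
  shows "(LINT x|M. norm (F (Suc n) h x) powr s * below b n h x)
    = (LINT x|M. norm (F n h x) powr s * below b n h x) * (LINT x|M. norm (fac (Suc n) h x) powr s)"
proof -
  have "(LINT x|M. norm (F (Suc n) h x) powr s * below b n h x)
     = (LINT x|M. (norm (F n h x) powr s * below b n h x) * norm (fac (Suc n) h x) powr s)"
    by (simp add: F_Suc norm_mult powr_mult mult_ac)
  also have "\<dots> = (LINT x|M. norm (F n h x) powr s * below b n h x) * (LINT x|M. norm (fac (Suc n) h x) powr s)"
  proof (rule expectation_step[where \<phi> = "\<lambda>a _. norm a powr s"])
    show "(\<lambda>x. norm (F n h x) powr s * below b n h x) \<in> borel_measurable (past n)"
      using F_measurable_past[of n n h] below_measurable_past[of b n h] by measurable
    show "norm (norm (F n h x) powr s * below b n h x) \<le> (4 ^ Suc n) powr s * 1" for x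
      using norm_F_powr_le[OF assms, of n h x] below_bounds[of b n h x]
      by (auto simp: abs_mult simp del: mult_1_right intro!: mult_mono)
    show "norm (norm (fac (Suc n) h x) powr s) \<le> 4 powr s" for x
      using norm_fac_le[of "Suc n" h x] assms by (auto intro!: powr_mono2)
  qed measurable
  finally show ?thesis .
qed

text \<open>The probability of staying below \<open>b\<close> up to time \<open>n\<close> under the
  measure with density \<open>(norm (F n h x))^2 / W n\<close>.\<close>

definition survival :: "(nat \<Rightarrow> real) \<Rightarrow> nat \<Rightarrow> real \<Rightarrow> real" where
  "survival b n h = (LINT x|M. (norm (F n h x))^2 * below b n h x) / W n"

text \<open>The martingale property lifts the term at time \<open>n\<close> to time
  \<open>Suc n\<close>; in a common tilted measure the difference is the mass of first crossings at
  \<open>Suc n\<close>.\<close>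

lemma survival_diff:
  "survival b n h - survival b (Suc n) h
     = (LINT x|M. (norm (F (Suc n) h x))^2 * (below b n h x - below b (Suc n) h x)) / W (Suc n)"
proof -
  have "(LINT x|M. (norm (F (Suc n) h x))^2 * below b n h x)
     = (LINT x|M. (norm (F n h x))^2 * below b n h x) * w (Suc n)"
    using expectation_F_powr_below_step[of 2 n h b] by (simp add: expectation_fac_norm_square)
  then have "survival b n h = (LINT x|M. (norm (F (Suc n) h x))^2 * below b n h x) / W (Suc n)"
    using w_ge_1[of "Suc n"] by (simp add: survival_def W_Suc)
  moreover have "integrable M (\<lambda>x. (norm (F (Suc n) h x))^2 * below b k h x)" for k
    using integrable_F_powr_below[of 2 "Suc n" h b k] by simp
  ultimately show ?thesis
    by (simp add: survival_def right_diff_distrib diff_divide_distrib)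
qed

lemma survival_antimono: "survival b (Suc n) h \<le> survival b n h"
proof -
  have "0 \<le> survival b n h - survival b (Suc n) h"
    unfolding survival_diff using below_Suc_le W_pos[of "Suc n"]
    by (intro divide_nonneg_nonneg integral_nonneg_AE) (auto intro!: mult_nonneg_nonneg)
  then show ?thesis by simp
qed

lemma survival_nonneg: "survival b n h \<ge> 0"
  unfolding survival_def using below_bounds W_pos[of n]
  by (intro divide_nonneg_nonneg integral_nonneg_AE) (auto intro!: mult_nonneg_nonneg)

text \<open>For \<open>norm (F n h x) powr (2 + l)\<close> divided by its mean \<open>m n\<close>,
  the initial mass \<open>1\<close> splits into first crossings and survivors. Before a crossing the
  path is below \<open>b k\<close> and one factor is at most \<open>4\<close>, whence
  \<open>ln 4\<close>. The gain of \<open>m n\<close> over \<open>W n powr (1 + l)\<close> is kept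
  only for the survivors.\<close>

lemma survival_optional_stopping:
  assumes A: "A \<ge> 0" and l: "0 < l" "l \<le> 1"
  defines "b \<equiv> \<lambda>k. exp A * W k * u k"
  shows "1 \<le> (\<Sum>k<n. exp (l * (A + ln 4 + ln (u (Suc k)))) * (survival b k h - survival b (Suc k) h))
          + exp (l * (A + ln 4 + ln (u n))) / (1 + l^2 * (u n - 1) / 16) * survival b n h"
proof -
  define \<mu> where "\<mu> j = (LINT x|M. norm (fac j h x) powr (2 + l))" for j
  define m where "m n = (\<Prod>j\<le>n. \<mu> j)" for n
  define v where "v n = (LINT x|M. norm (F n h x) powr (2 + l) * below b n h x) / m n" for n
  define \<beta> where "\<beta> k = exp (l * (A + ln 4 + ln (u k)))" for k
  have upos: "u k > 0" for k using u_ge_1[of k] by linarith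
  have bpos: "b k > 0" for k using W_pos[of k] upos[of k] by (simp add: b_def)
  have bmono: "b k \<le> b (Suc k)" for k
    unfolding b_def using W_mono[of k] u_mono[of k] W_pos[of k] upos[of k] by (intro mult_mono) auto
  have mlow: "m n \<ge> W n powr (1 + l) * (1 + l^2 * (u n - 1) / 16)" for n
    unfolding m_def \<mu>_def using W_moment_lower_bound l by simp
  have \<Psi>: "1 + l^2 * (u n - 1) / 16 \<ge> 1" for n using u_ge_1[of n] by simp
  have mW: "m n \<ge> W n powr (1 + l)" for n
  proof -
    have "W n powr (1 + l) * 1 \<le> W n powr (1 + l) * (1 + l^2 * (u n - 1) / 16)"
      using \<Psi> by (intro mult_left_mono) auto
    then show ?thesis using mlow[of n] by simp
  qed
  have mpos: "m n > 0" for n using mW[of n] W_pos[of n] by (smt (verit) powr_gt_zero)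
  have \<mu>pos: "\<mu> (Suc n) > 0" for n
    using mpos[of n] mpos[of "Suc n"] by (simp add: m_def zero_less_mult_iff)
  \<comment> \<open>The factor \<open>W k\<close> of the barrier is what the exponent
    \<open>1 + l\<close> of the mean consumes; only the level and the logarithm of the clock remain
    in \<open>\<beta> k\<close>.\<close>
  have \<beta>: "(4 * b k) powr l * W k = \<beta> k * W k powr (1 + l)" for k
  proof -
    have "(4 * b k) powr l = exp (l * ln (4 * b k))" using bpos[of k] by (simp add: powr_def)
    also have "ln (4 * b k) = (A + ln 4 + ln (u k)) + ln (W k)"
      using W_pos[of k] upos[of k] by (simp add: b_def ln_mult)
    also have "exp (l * \<dots>) = \<beta> k * W k powr l"
      using W_pos[of k] by (simp add: \<beta>_def powr_def distrib_left exp_add)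
    finally show ?thesis using W_pos[of k] by (simp add: powr_add)
  qed
  have split: "norm z powr (2 + l) = (norm z)^2 * norm z powr l" for z :: complex
    by (cases "z = 0") (simp_all add: powr_add)
  have sq_int: "integrable M (\<lambda>x. (norm (F n h x))^2 * below b k h x)" for n k
    using integrable_F_powr_below[of 2 n h b k] by simp
  have step: "v k - v (Suc k) \<le> \<beta> (Suc k) * (survival b k h - survival b (Suc k) h)" for k
  proof -
    have "v k = (LINT x|M. norm (F (Suc k) h x) powr (2 + l) * below b k h x) / m (Suc k)"
      using expectation_F_powr_below_step[of "2 + l" k h b] l \<mu>pos[of k]
      by (simp add: v_def m_def \<mu>_def)
    then have "v k - v (Suc k) = (LINT x|M. norm (F (Suc k) h x) powr (2 + l) * (below b k h x - below b (Suc k) h x)) / m (Suc k)"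
      using integrable_F_powr_below[of "2 + l" "Suc k" h b] l
      by (simp add: v_def right_diff_distrib diff_divide_distrib)
    also have "\<dots> \<le> (LINT x|M. (4 * b (Suc k)) powr l * ((norm (F (Suc k) h x))^2 * (below b k h x - below b (Suc k) h x))) / m (Suc k)"
    proof (intro divide_right_mono integral_mono)
      show "integrable M (\<lambda>x. norm (F (Suc k) h x) powr (2 + l) * (below b k h x - below b (Suc k) h x))"
        using integrable_F_powr_below[of "2 + l" "Suc k" h b] l by (simp add: right_diff_distrib)
      show "integrable M (\<lambda>x. (4 * b (Suc k)) powr l * ((norm (F (Suc k) h x))^2 * (below b k h x - below b (Suc k) h x)))"
        using sq_int by (simp add: right_diff_distrib)
      fix x
      show "norm (F (Suc k) h x) powr (2 + l) * (below b k h x - below b (Suc k) h x)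
        \<le> (4 * b (Suc k)) powr l * ((norm (F (Suc k) h x))^2 * (below b k h x - below b (Suc k) h x))"
      proof (cases "below b k h x = 1")
        case True
        then have "norm (F k h x) \<le> b k" by (auto simp: below_def split: if_splits)
        then have "norm (F k h x) * norm (fac (Suc k) h x) \<le> b k * 4"
          using norm_fac_le bpos[of k] by (intro mult_mono) auto
        also have "\<dots> \<le> 4 * b (Suc k)" using bmono[of k] by simp
        finally have "norm (F (Suc k) h x) \<le> 4 * b (Suc k)" by (simp add: F_Suc norm_mult)
        then have "norm (F (Suc k) h x) powr l \<le> (4 * b (Suc k)) powr l"
          using l by (intro powr_mono2) auto
        then have "norm (F (Suc k) h x) powr l * ((norm (F (Suc k) h x))^2 * (below b k h x - below b (Suc k) h x))
          \<le> (4 * b (Suc k)) powr l * ((norm (F (Suc k) h x))^2 * (below b k h x - below b (Suc k) h x))"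
          using below_Suc_le[of b k h x] by (intro mult_right_mono mult_nonneg_nonneg) auto
        then show ?thesis unfolding split by (simp add: mult_ac)
      next
        case False
        then have 0: "below b k h x = 0" by (auto simp: below_def split: if_splits)
        then have "below b (Suc k) h x = 0"
          using below_Suc_le[of b k h x] below_bounds(1)[of b "Suc k" h x] by linarith
        with 0 show ?thesis by simp
      qed
    qed (use mpos[of "Suc k"] in auto)
    also have "\<dots> = (4 * b (Suc k)) powr l * W (Suc k) * (survival b k h - survival b (Suc k) h) / m (Suc k)"
      unfolding survival_diff using W_pos[of "Suc k"] by simp
    also have "\<dots> = \<beta> (Suc k) * (survival b k h - survival b (Suc k) h) * (W (Suc k) powr (1 + l) / m (Suc k))"
      unfolding \<beta> by simp
    also have "\<dots> \<le> \<beta> (Suc k) * (survival b k h - survival b (Suc k) h) * 1"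
      using mW[of "Suc k"] mpos[of "Suc k"] survival_antimono[of b k h]
      by (intro mult_left_mono mult_nonneg_nonneg) (auto simp: \<beta>_def)
    finally show ?thesis by simp
  qed
  have last: "v n \<le> \<beta> n / (1 + l^2 * (u n - 1) / 16) * survival b n h"
  proof -
    have "v n \<le> (LINT x|M. (4 * b n) powr l * ((norm (F n h x))^2 * below b n h x)) / m n"
      unfolding v_def
    proof (intro divide_right_mono integral_mono)
      show "integrable M (\<lambda>x. norm (F n h x) powr (2 + l) * below b n h x)"
        using integrable_F_powr_below l by simp
      show "integrable M (\<lambda>x. (4 * b n) powr l * ((norm (F n h x))^2 * below b n h x))"
        using sq_int by simp
      fix x
      show "norm (F n h x) powr (2 + l) * below b n h x \<le> (4 * b n) powr l * ((norm (F n h x))^2 * below b n h x)"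
      proof (cases "below b n h x = 1")
        case True
        then have "norm (F n h x) \<le> b n" by (auto simp: below_def split: if_splits)
        then have "norm (F n h x) powr l \<le> (4 * b n) powr l"
          using l bpos[of n] by (intro powr_mono2) auto
        then have "norm (F n h x) powr l * (norm (F n h x))^2 \<le> (4 * b n) powr l * (norm (F n h x))^2"
          by (intro mult_right_mono) auto
        then show ?thesis unfolding split True by (simp add: mult_ac)
      qed (auto simp: below_def split: if_splits)
    qed (use mpos[of n] in auto)
    also have "\<dots> = (4 * b n) powr l * W n * survival b n h / m n"
      using W_pos[of n] by (simp add: survival_def)
    also have "\<dots> = \<beta> n * survival b n h * (W n powr (1 + l) / m n)"
      unfolding \<beta> by simp
    also have "\<dots> \<le> \<beta> n * survival b n h * (1 / (1 + l^2 * (u n - 1) / 16))"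
      using mlow[of n] mpos[of n] \<Psi>[of n] survival_nonneg[of b n h]
      by (intro mult_left_mono mult_nonneg_nonneg) (auto simp: \<beta>_def divide_simps mult_ac)
    finally show ?thesis by simp
  qed
  have v0: "v 0 = 1"
  proof -
    have "below b 0 h x = 1" for x using A by (simp add: below_def b_def)
    moreover have "fac 0 h = (\<lambda>_. 1)" using F_0[of h] by (auto simp: F_def)
    ultimately show ?thesis by (simp add: v_def m_def \<mu>_def prob_space)
  qed
  have "1 = (\<Sum>k<n. v k - v (Suc k)) + v n"
    using sum_lessThan_telescope'[of v n] v0 by simp
  also have "\<dots> \<le> (\<Sum>k<n. \<beta> (Suc k) * (survival b k h - survival b (Suc k) h)) + \<beta> n / (1 + l^2 * (u n - 1) / 16) * survival b n h"
    by (intro add_mono sum_mono step last)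
  finally show ?thesis by (simp add: \<beta>_def)
qed

lemma survival_le:
  assumes A: "A \<ge> 0"
  shows "survival (\<lambda>k. exp A * W k * u k) n h \<le> 200000 * (A + 3) / sqrt (u n)"
proof -
  \<comment> \<open>The overshoot term also supplies the requirement \<open>a \<ge> 1\<close> when
    \<open>A = 0\<close>; its upper bound \<open>2\<close> gives the \<open>3\<close> in the
    conclusion.\<close>
  have l4: "1 \<le> ln (4::real)" "ln (4::real) \<le> 2"
  proof -
    have "exp 1 \<le> (4::real)" using exp_le by linarith
    then show "1 \<le> ln (4::real)" by (subst ln_ge_iff) auto
    have "ln (4::real) = 2 * ln 2" using ln_realpow[of 2 2] by simp
    then show "ln (4::real) \<le> 2" using ln_2_less_1 by simp
  qed
  have "survival (\<lambda>k. exp A * W k * u k) n h \<le> 200000 * ((A + ln 4) + 1) / sqrt (u n)"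
  proof (rule barrier_decay)
    show "survival (\<lambda>k. exp A * W k * u k) 0 h = 1"
      using A by (simp add: survival_def below_def prob_space)
  qed (use A l4 survival_nonneg survival_antimono u_mono u_Suc_le survival_optional_stopping[OF A] in auto)
  also have "\<dots> \<le> 200000 * (A + 3) / sqrt (u n)"
    using l4 u_ge_1[of n] by (intro divide_right_mono) auto
  finally show ?thesis .
qed

end

section \<open>Suprema over the unit interval\<close>

text \<open>Average over \<open>y\<close> the bound of \<open>norm (f h)\<close> by
  \<open>norm (f y)\<close> plus the total variation. This one-dimensional Sobolev inequality makes
  a supremum accessible to expectations at fixed height.\<close>

lemma norm_le_integral_norm_plus_derivative:
  fixes f f' :: "real \<Rightarrow> complex"
  assumes f: "\<And>x. (f has_vector_derivative f' x) (at x)" and f': "continuous_on UNIV f'"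
    and h: "h \<in> {0..1}"
  shows "norm (f h) \<le> integral {0..1} (\<lambda>y. norm (f y) + norm (f' y))"
proof -
  have cf: "continuous_on UNIV f"
    using f by (intro continuous_at_imp_continuous_on) (auto intro: has_vector_derivative_continuous)
  have c1: "continuous_on S (\<lambda>y. norm (f y))" "continuous_on S (\<lambda>y. norm (f' y))" for S
    by (auto intro!: continuous_intros continuous_on_subset[OF cf] continuous_on_subset[OF f'])
  define J where "J = integral {0..1} (\<lambda>y. norm (f' y))"
  have inc: "norm (f b - f a) \<le> J" if "0 \<le> a" "a \<le> b" "b \<le> 1" for a b
  proof -
    have "(f' has_integral f b - f a) {a..b}"
      using that f by (intro fundamental_theorem_of_calculus) (auto intro: has_vector_derivative_at_within)
    then have "norm (f b - f a) \<le> integral {a..b} (\<lambda>y. norm (f' y))"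
      using c1 by (metis integral_norm_bound_integral has_integral_integrable has_integral_unique integrable_continuous_interval integrable_integral order_refl)
    also have "\<dots> \<le> J" unfolding J_def
      using that c1 by (intro integral_subset_le integrable_continuous_interval) auto
    finally show ?thesis .
  qed
  have bound: "norm (f h) \<le> norm (f y) + J" if "y \<in> {0..1}" for y
  proof -
    have "norm (f h - f y) \<le> J"
      using inc[of h y] inc[of y h] that h by (cases "h \<le> y") (auto simp: norm_minus_commute)
    then show ?thesis using norm_triangle_sub[of "f h" "f y"] by linarith
  qed
  have "norm (f h) = integral {0..1::real} (\<lambda>y. norm (f h))" by simp
  also have "\<dots> \<le> integral {0..1} (\<lambda>y. norm (f y) + J)"
    using bound by (intro integral_le integrable_continuous_interval continuous_intros c1) auto
  also have "\<dots> = integral {0..1} (\<lambda>y. norm (f y)) + J"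
    using c1 by (subst Henstock_Kurzweil_Integration.integral_add) (auto intro: integrable_continuous_interval)
  also have "\<dots> = integral {0..1} (\<lambda>y. norm (f y) + norm (f' y))"
    unfolding J_def using c1 by (subst Henstock_Kurzweil_Integration.integral_add) (auto intro: integrable_continuous_interval)
  finally show ?thesis .
qed

definition unit_interval :: "real measure" where
  "unit_interval = restrict_space lborel {0..1}"

lemma space_unit_interval [simp]: "space unit_interval = {0..1}"
  by (simp add: unit_interval_def space_restrict_space)

lemma prob_space_unit_interval: "prob_space unit_interval"
  by (rule prob_spaceI) (simp add: unit_interval_def emeasure_restrict_space space_restrict_space)

lemma measurable_unit_interval: "f \<in> borel_measurable borel \<Longrightarrow> f \<in> borel_measurable unit_interval"
  unfolding unit_interval_def by (intro measurable_restrict_space1) simp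

lemma integral_unit_interval:
  fixes f :: "real \<Rightarrow> real"
  shows "integral\<^sup>L unit_interval f = (LBINT h:{0..1}. f h)"
  unfolding unit_interval_def set_lebesgue_integral_def by (subst integral_restrict_space) auto

lemma integral_unit_interval_continuous:
  fixes f :: "real \<Rightarrow> real"
  assumes "continuous_on UNIV f"
  shows "integral\<^sup>L unit_interval f = integral {0..1} f"
  unfolding integral_unit_interval
  by (intro set_borel_integral_eq_integral borel_integrable_atLeastAtMost' continuous_on_subset[OF assms]) auto

context circle_chaos
begin

section \<open>Logarithmic derivative and the Sobolev submartingale\<close>

definition LD :: "nat \<Rightarrow> real \<Rightarrow> 'a \<Rightarrow> complex" where
  "LD n h x = (\<Sum>j\<le>n. - (\<i> * t j) * ld j h x)"

lemma LD_Suc: "LD (Suc n) h x = LD n h x - \<i> * t (Suc n) * ld (Suc n) h x"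
  by (simp add: LD_def)

lemma LD_0 [simp]: "LD 0 h x = 0"
  by (simp add: LD_def ld_def r_off zero_notin)

lemma has_derivative_fac:
  "((\<lambda>h. fac j h x) has_vector_derivative fac j h x * (- (\<i> * t j) * ld j h x)) (at h)"
proof -
  define \<Phi> where "\<Phi> z = 1 / (1 - r j * (exp (- (\<i> * t j * z)) * X' j x))" for z
  have c: "cis (-(t j * y)) = exp (- (\<i> * t j * of_real y))" for y
    by (simp add: cis_conv_exp mult.assoc)
  have nz: "1 - r j * (exp (- (\<i> * t j * of_real h)) * X' j x) \<noteq> 0"
    using denominator_nonzero[of j h x] by (simp only: c not_False_eq_True)
  have "(\<Phi> has_field_derivative fac j h x * (- (\<i> * t j) * ld j h x)) (at (of_real h))"
    unfolding \<Phi>_def fac_def ld_def c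
    using nz by (auto intro!: derivative_eq_intros simp: power2_eq_square)
  from has_vector_derivative_real_field[OF this] show ?thesis
    unfolding \<Phi>_def fac_def c .
qed

lemma has_derivative_F:
  "((\<lambda>h. F n h x) has_vector_derivative F n h x * LD n h x) (at h)"
proof (induction n)
  case (Suc n)
  have "((\<lambda>h. F n h x * fac (Suc n) h x) has_vector_derivative
      F n h x * (fac (Suc n) h x * (- (\<i> * t (Suc n)) * ld (Suc n) h x)) + F n h x * LD n h x * fac (Suc n) h x) (at h)"
    by (rule has_vector_derivative_mult[OF Suc has_derivative_fac])
  moreover have "F n h x * (fac (Suc n) h x * (- (\<i> * t (Suc n)) * ld (Suc n) h x)) + F n h x * LD n h x * fac (Suc n) h x
    = F (Suc n) h x * LD (Suc n) h x"
    by (simp add: F_Suc LD_Suc algebra_simps)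
  ultimately show ?case by (simp only: F_Suc)
qed simp

lemma has_derivative_F_square:
  "((\<lambda>h. (F n h x)^2) has_vector_derivative 2 * (F n h x)^2 * LD n h x) (at h)"
  using has_vector_derivative_mult[OF has_derivative_F[of n x h] has_derivative_F[of n x h]]
  by (simp add: power2_eq_square algebra_simps)

lemma continuous_F: "continuous_on UNIV (\<lambda>h. F n h x)"
  using has_derivative_F by (intro continuous_at_imp_continuous_on) (auto intro: has_vector_derivative_continuous)

lemma continuous_LD: "continuous_on UNIV (\<lambda>h. LD n h x)"
  unfolding LD_def ld_def
  by (intro continuous_intros continuous_on_divide) (use denominator_nonzero in auto)

definition g :: "nat \<Rightarrow> real \<Rightarrow> 'a \<Rightarrow> real" where
  "g n h x = norm ((F n h x)^2) + norm (2 * (F n h x)^2 * LD n h x)"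

definition Q :: "nat \<Rightarrow> 'a \<Rightarrow> real" where
  "Q n x = (LINT h|unit_interval. g n h x)"

lemma norm_F_square_le_Q: "h \<in> {0..1} \<Longrightarrow> (norm (F n h x))^2 \<le> Q n x"
proof -
  assume h: "h \<in> {0..1}"
  have c: "continuous_on UNIV (\<lambda>h. 2 * (F n h x)^2 * LD n h x)"
    by (intro continuous_intros continuous_F continuous_LD)
  have "norm ((F n h x)^2) \<le> integral {0..1} (\<lambda>h. g n h x)"
    unfolding g_def by (rule norm_le_integral_norm_plus_derivative[OF has_derivative_F_square c h])
  also have "\<dots> = Q n x"
    unfolding Q_def g_def
    by (intro integral_unit_interval_continuous[symmetric] continuous_intros c continuous_F)
  finally show ?thesis by (simp add: norm_power)
qed

lemma LD_measurable_past_pair: "k \<le> n \<Longrightarrow> (\<lambda>x. LD k (fst x) (snd x)) \<in> borel_measurable (borel \<Otimes>\<^sub>M past n)"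
  unfolding LD_def
proof (intro borel_measurable_sum borel_measurable_times)
  fix i assume "k \<le> n" "i \<in> {..k}"
  then show "(\<lambda>x. ld i (fst x) (snd x)) \<in> borel_measurable (borel \<Otimes>\<^sub>M past n)"
    by (intro ld_measurable_past) auto
qed auto

lemma LD_measurable_past: "k \<le> n \<Longrightarrow> LD k h \<in> borel_measurable (past n)"
  using measurable_compose[OF measurable_Pair1'[of h borel "past n"] LD_measurable_past_pair[of k n]] by simp

lemma LD_measurable [measurable]: "LD k h \<in> borel_measurable M"
  using past_subset[OF LD_measurable_past[of k k h]] by simp

lemma g_measurable_past_pair: "k \<le> n \<Longrightarrow> (\<lambda>x. g k (fst x) (snd x)) \<in> borel_measurable (borel \<Otimes>\<^sub>M past n)"
proof -
  assume "k \<le> n"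
  note F_measurable_past_pair[OF this, measurable] LD_measurable_past_pair[OF this, measurable]
  show ?thesis unfolding g_def by measurable
qed

lemma id_measurable_M_past: "(\<lambda>x. x) \<in> measurable M (past n)"
  by (rule measurable_ident[of "past n", THEN past_subset, unfolded id_def])

lemma g_measurable_pair: "(\<lambda>x. g n (fst x) (snd x)) \<in> borel_measurable (unit_interval \<Otimes>\<^sub>M past n)"
proof -
  have "(\<lambda>x. x) \<in> measurable unit_interval borel" by (rule measurable_unit_interval) simp
  then have "(\<lambda>x. (fst x, snd x)) \<in> measurable (unit_interval \<Otimes>\<^sub>M past n) (borel \<Otimes>\<^sub>M past n)"
    by (intro measurable_Pair) (auto intro: measurable_compose[OF measurable_fst])
  from measurable_compose[OF this g_measurable_past_pair[of n n]] show ?thesis by simp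
qed

lemma g_measurable_pair_M: "(\<lambda>x. g n (fst x) (snd x)) \<in> borel_measurable (unit_interval \<Otimes>\<^sub>M M)"
proof -
  have "(\<lambda>x. (fst x, snd x)) \<in> measurable (unit_interval \<Otimes>\<^sub>M M) (unit_interval \<Otimes>\<^sub>M past n)"
    by (intro measurable_Pair measurable_fst measurable_compose[OF measurable_snd id_measurable_M_past])
  from measurable_compose[OF this g_measurable_pair] show ?thesis by simp
qed

lemma g_measurable [measurable]: "g n h \<in> borel_measurable M"
  unfolding g_def[abs_def] by measurable

lemma sigma_finite_unit_interval: "sigma_finite_measure unit_interval"
  using prob_space_unit_interval prob_space_imp_sigma_finite by blast

lemma Q_measurable_past: "Q n \<in> borel_measurable (past n)"
proof -
  interpret U: sigma_finite_measure unit_interval by (rule sigma_finite_unit_interval)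
  have "(\<lambda>y. (snd y, fst y)) \<in> measurable (past n \<Otimes>\<^sub>M unit_interval) (unit_interval \<Otimes>\<^sub>M past n)"
    by measurable
  from measurable_compose[OF this g_measurable_pair]
  have "(\<lambda>(x, h). g n h x) \<in> borel_measurable (past n \<Otimes>\<^sub>M unit_interval)"
    by (simp add: case_prod_beta')
  then show ?thesis unfolding Q_def[abs_def] by (rule U.borel_measurable_lebesgue_integral)
qed

lemma Q_measurable [measurable]: "Q n \<in> borel_measurable M"
  using past_subset[OF Q_measurable_past] .

text \<open>A crude deterministic bound that serves integrability only; its growth in
  \<open>n\<close> enters no estimate.\<close>

definition gB :: "nat \<Rightarrow> real" where
  "gB n = (4 ^ Suc n)^2 + 2 * (4 ^ Suc n)^2 * (\<Sum>j\<le>n. t j * (4 * r j))"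

lemma norm_LD_le: "norm (LD n h x) \<le> (\<Sum>j\<le>n. t j * (4 * r j))"
  unfolding LD_def
proof (rule sum_norm_le)
  fix j show "norm (- (\<i> * t j) * ld j h x) \<le> t j * (4 * r j)"
    using norm_ld_le[of j h x] t_nonneg[of j] by (simp add: norm_mult mult_left_mono)
qed

lemma g_bounds: "0 \<le> g n h x" "g n h x \<le> gB n"
proof -
  show "0 \<le> g n h x" by (simp add: g_def)
  have "(norm (F n h x))^2 \<le> (4 ^ Suc n)^2" using norm_F_le by (intro power_mono) auto
  then have "(norm (F n h x))^2 + 2 * (norm (F n h x))^2 * norm (LD n h x)
     \<le> (4 ^ Suc n)^2 + 2 * (4 ^ Suc n)^2 * (\<Sum>j\<le>n. t j * (4 * r j))"
    using norm_LD_le[of n h x] by (intro add_mono mult_mono) auto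
  then show "g n h x \<le> gB n"
    unfolding g_def gB_def by (simp only: norm_mult norm_power norm_numeral)
qed

lemma Q_bounds: "0 \<le> Q n x" "Q n x \<le> gB n"
proof -
  interpret U: prob_space unit_interval by (rule prob_space_unit_interval)
  show "0 \<le> Q n x" unfolding Q_def using g_bounds by (intro integral_nonneg_AE) auto
  have m: "(\<lambda>h. g n h x) \<in> borel_measurable unit_interval"
    unfolding g_def
    by (intro measurable_unit_interval borel_measurable_continuous_onI continuous_intros continuous_F continuous_LD)
  have "Q n x \<le> (LINT h|unit_interval. gB n)"
    unfolding Q_def using g_bounds m order_trans[OF g_bounds]
    by (intro integral_mono U.integrable_const_bound[where B = "gB n"]) auto
  then show "Q n x \<le> gB n" using U.prob_space by simp
qed

lemma expectation_Q_mult: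
  assumes c: "c \<in> borel_measurable M" "\<And>x. 0 \<le> c x \<and> c x \<le> (1::real)"
  shows "(LINT x|M. Q n x * c x) = (LINT h|unit_interval. (LINT x|M. g n h x * c x))"
    and "(\<lambda>h. LINT x|M. g n h x * c x) \<in> borel_measurable unit_interval"
proof -
  interpret U: prob_space unit_interval by (rule prob_space_unit_interval)
  interpret P: pair_prob_space unit_interval M ..
  note g_measurable_pair_M[of n, measurable] c(1) [measurable]
  have meas: "(\<lambda>y. g n (fst y) (snd y) * c (snd y)) \<in> borel_measurable (unit_interval \<Otimes>\<^sub>M M)" by measurable
  have int: "integrable (unit_interval \<Otimes>\<^sub>M M) (\<lambda>y. g n (fst y) (snd y) * c (snd y))"
  proof (rule P.P.integrable_const_bound[where B = "gB n * 1"])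
    have "norm (g n h x * c x) \<le> gB n * 1" for h x
      unfolding norm_mult using g_bounds[of n h x] c(2)[of x] by (intro mult_mono) auto
    then show "AE y in unit_interval \<Otimes>\<^sub>M M. norm (g n (fst y) (snd y) * c (snd y)) \<le> gB n * 1" by simp
  qed (rule meas)
  have "(LINT x|M. (LINT h|unit_interval. g n h x * c x)) = (LINT h|unit_interval. (LINT x|M. g n h x * c x))"
    using P.Fubini_integral[of "\<lambda>h x. g n h x * c x"] int by (simp add: case_prod_beta')
  then show "(LINT x|M. Q n x * c x) = (LINT h|unit_interval. (LINT x|M. g n h x * c x))"
    by (simp add: Q_def)
  show "(\<lambda>h. LINT x|M. g n h x * c x) \<in> borel_measurable unit_interval"
    using meas by (intro borel_measurable_lebesgue_integral) (simp add: case_prod_beta')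
qed


lemma fac_measurable [measurable]: "fac n h \<in> borel_measurable M"
  and ld_measurable [measurable]: "ld n h \<in> borel_measurable M"
  unfolding fac_def[abs_def] ld_def[abs_def] by measurable

lemma phase_measurable:
  assumes "Y \<in> borel_measurable (past n)"
  shows "(\<lambda>x. cnj (sgn (Y x))) \<in> borel_measurable (past n)"
proof -
  note assms [measurable]
  have [measurable]: "cnj \<in> borel_measurable borel" by (intro borel_measurable_continuous_onI continuous_intros)
  show ?thesis unfolding sgn_div_norm by measurable
qed

text \<open>Both terms of \<open>g\<close> are moduli of complex martingales: a step multiplies by
  \<open>fac^2\<close>, of mean \<open>1\<close>, and for the derivative adds a multiple of
  \<open>fac^2 * ld\<close>, of mean \<open>0\<close>. Testing against all past weights
  \<open>c\<close> replaces conditioning.\<close>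

lemma g_submartingale:
  assumes c: "c \<in> borel_measurable (past n)" "\<And>x. 0 \<le> c x \<and> c x \<le> (1::real)"
  shows "(LINT x|M. g n h x * c x) \<le> (LINT x|M. g (Suc n) h x * c x)"
proof -
  note c(1) [measurable] F_measurable_past[of n n h, simplified, measurable] LD_measurable_past[of n n h, simplified, measurable]
  have cM [measurable]: "c \<in> borel_measurable M" by (rule past_subset[OF c(1)])
  have Fb: "norm ((F n h x)^2) \<le> (4 ^ Suc n)^2" for x
    unfolding norm_power using norm_F_le by (intro power_mono) auto
  have Db: "norm (2 * (F n h x)^2 * LD n h x) \<le> 2 * (4 ^ Suc n)^2 * (\<Sum>j\<le>n. t j * (4 * r j))" for x
    unfolding norm_mult norm_numeral using norm_LD_le[of n h x] Fb[of x] by (intro mult_mono) auto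
  have mart: "(LINT x|M. norm (U x) * c x) \<le> (LINT x|M. norm (V x) * c x)"
    if U: "U \<in> borel_measurable (past n)" "\<And>x. norm (U x) \<le> C"
      and T: "T \<in> borel_measurable (past n)" "\<And>x. norm (T x) \<le> C"
      and V: "\<And>x. V x = U x * (fac (Suc n) h x)^2 + T x * ((fac (Suc n) h x)^2 * ld (Suc n) h x)"
      and Vb: "V \<in> borel_measurable M" "\<And>x. norm (V x) \<le> C'"
    for U T V :: "'a \<Rightarrow> complex" and C C'
  proof -
    note U(1) [measurable] T(1) [measurable] Vb(1) [measurable]
    have UM [measurable]: "U \<in> borel_measurable M" and TM [measurable]: "T \<in> borel_measurable M"
      using past_subset U(1) T(1) by blast+
    \<comment> \<open>Duality instead of conditional Jensen: the conjugate phase of \<open>U\<close>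
      makes \<open>norm (U x) * c x\<close> linear in \<open>U\<close> and is measurable in the
      past, so \<open>U\<close> may be exchanged for \<open>V\<close> under the mean.\<close>
    define \<eta> where "\<eta> x = cnj (sgn (U x)) * c x" for x
    have \<eta> [measurable]: "\<eta> \<in> borel_measurable (past n)"
      using phase_measurable[OF U(1)] unfolding \<eta>_def by measurable
    have \<eta>M [measurable]: "\<eta> \<in> borel_measurable M" by (rule past_subset[OF \<eta>])
    have \<eta>n: "norm (\<eta> x) \<le> c x" for x
      using c(2)[of x] unfolding \<eta>_def by (simp add: norm_mult norm_sgn)
    have \<eta>1: "norm (\<eta> x) \<le> 1" for x using \<eta>n[of x] c(2)[of x] by linarith
    have C0: "C \<ge> 0" "C' \<ge> 0" using U(2) Vb(2) norm_ge_zero order_trans by blast+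
    have f2: "norm ((fac (Suc n) h x)^2) \<le> 4^2" for x
      unfolding norm_power using norm_fac_le by (intro power_mono) auto
    have f3: "norm ((fac (Suc n) h x)^2 * ld (Suc n) h x) \<le> 4^2 * (4 * r (Suc n))" for x
      unfolding norm_mult using f2[unfolded norm_power, of x] norm_ld_le by (intro mult_mono) (auto simp: norm_power)
    have prodb: "norm (\<eta> x * Y) \<le> C" if "norm Y \<le> C" for x Y C
      using mult_mono[OF \<eta>1[of x] that] by (simp add: norm_mult)
    have "(LINT x|M. norm (U x) * c x) = norm (LINT x|M. \<eta> x * U x)"
    proof -
      have "\<eta> x * U x = complex_of_real (norm (U x) * c x)" for x
      proof (cases "U x = 0")
        case False
        have "cnj (sgn (U x)) * U x = norm (U x)"
          using False by (simp add: sgn_div_norm scaleR_conv_of_real mult.assoc)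
            (simp add: mult.commute[of "cnj _"] complex_norm_square[symmetric] power2_eq_square)
        then show ?thesis by (simp add: \<eta>_def mult_ac)
      qed (simp add: \<eta>_def)
      then have "(LINT x|M. \<eta> x * U x) = complex_of_real (LINT x|M. norm (U x) * c x)"
        by (simp only: integral_complex_of_real)
      moreover have "(LINT x|M. norm (U x) * c x) \<ge> 0"
        using c(2) by (intro integral_nonneg_AE) auto
      ultimately show ?thesis by simp
    qed
    also have "(LINT x|M. \<eta> x * U x) = (LINT x|M. \<eta> x * V x)"
    proof -
      have e1: "(LINT x|M. (\<eta> x * U x) * (fac (Suc n) h x)^2) = (LINT x|M. \<eta> x * U x)"
        using prodb[OF U(2)] f2
        by (subst expectation_step[where \<phi> = "\<lambda>a _. a^2" and B = C and B' = "4^2"]) (auto simp: expectation_fac_square)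
      have e2: "(LINT x|M. (\<eta> x * T x) * ((fac (Suc n) h x)^2 * ld (Suc n) h x)) = 0"
        using prodb[OF T(2)] f3
        by (subst expectation_step[where \<phi> = "\<lambda>a b. a^2 * b" and B = C and B' = "4^2 * (4 * r (Suc n))"])
          (auto simp: expectation_fac_square_ld)
      have i1: "integrable M (\<lambda>x. (\<eta> x * U x) * (fac (Suc n) h x)^2)"
      proof (rule integrable_bounded)
        show "norm ((\<eta> x * U x) * (fac (Suc n) h x)^2) \<le> C * 4^2" for x
          using mult_mono[OF prodb[OF U(2), of x x] f2[of x] C0(1)] by (simp only: norm_mult norm_ge_zero simp_thms)
      qed measurable
      have i2: "integrable M (\<lambda>x. (\<eta> x * T x) * ((fac (Suc n) h x)^2 * ld (Suc n) h x))"
      proof (rule integrable_bounded)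
        show "norm ((\<eta> x * T x) * ((fac (Suc n) h x)^2 * ld (Suc n) h x)) \<le> C * (4^2 * (4 * r (Suc n)))" for x
          using mult_mono[OF prodb[OF T(2), of x x] f3[of x] C0(1)] by (simp only: norm_mult norm_ge_zero mult_nonneg_nonneg simp_thms)
      qed measurable
      have "(LINT x|M. \<eta> x * V x) = (LINT x|M. (\<eta> x * U x) * (fac (Suc n) h x)^2 + (\<eta> x * T x) * ((fac (Suc n) h x)^2 * ld (Suc n) h x))"
        unfolding V by (simp add: algebra_simps)
      also have "\<dots> = (LINT x|M. \<eta> x * U x)"
        unfolding Bochner_Integration.integral_add[OF i1 i2] e1 e2 by simp
      finally show ?thesis by simp
    qed
    also have "norm (LINT x|M. \<eta> x * V x) \<le> (LINT x|M. norm (\<eta> x * V x))"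
      by (rule integral_norm_bound)
    also have "\<dots> \<le> (LINT x|M. norm (V x) * c x)"
    proof (rule integral_mono)
      show "integrable M (\<lambda>x. norm (\<eta> x * V x))"
        using prodb[OF Vb(2)] by (intro integrable_bounded[where B = C']) auto
      show "integrable M (\<lambda>x. norm (V x) * c x)"
      proof (rule integrable_bounded)
        show "norm (norm (V x) * c x) \<le> C' * 1" for x
          unfolding norm_mult using Vb(2)[of x] c(2)[of x] C0 by (intro mult_mono) auto
      qed measurable
      show "norm (\<eta> x * V x) \<le> norm (V x) * c x" for x
        using mult_right_mono[OF \<eta>n[of x], of "norm (V x)"] by (simp add: norm_mult mult_ac)
    qed
    finally show ?thesis .
  qed
  have b0: "norm (2 * (F n h x)^2 * (- (\<i> * t (Suc n)))) \<le> 2 * (4 ^ Suc n)^2 * t (Suc n)" for x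
    using mult_right_mono[OF Fb[of x] t_nonneg[of "Suc n"]] t_nonneg[of "Suc n"] by (simp add: norm_mult mult_ac)
  have Fb': "norm ((F (Suc n) h x)^2) \<le> (4 ^ Suc (Suc n))^2" for x
    unfolding norm_power by (intro power_mono norm_F_le) simp
  have Db': "norm (2 * (F (Suc n) h x)^2 * LD (Suc n) h x) \<le> 2 * (4 ^ Suc (Suc n))^2 * (\<Sum>j\<le>Suc n. t j * (4 * r j))" for x
    unfolding norm_mult norm_numeral using norm_LD_le[of "Suc n" h x] Fb'[of x] by (intro mult_mono) auto
  have m1: "(LINT x|M. norm ((F n h x)^2) * c x) \<le> (LINT x|M. norm ((F (Suc n) h x)^2) * c x)"
  proof (rule mart[of _ _ "\<lambda>_. 0", OF _ Fb _ _ _ _ Fb'])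
    show "(F (Suc n) h x)^2 = (F n h x)^2 * (fac (Suc n) h x)^2 + 0 * ((fac (Suc n) h x)^2 * ld (Suc n) h x)" for x
      by (simp add: F_Suc power_mult_distrib)
  qed auto
  have m2: "(LINT x|M. norm (2 * (F n h x)^2 * LD n h x) * c x) \<le> (LINT x|M. norm (2 * (F (Suc n) h x)^2 * LD (Suc n) h x) * c x)"
  proof (rule mart[of _ _ "\<lambda>x. 2 * (F n h x)^2 * (- (\<i> * t (Suc n)))", OF _ order_trans[OF Db max.cobounded1] _ order_trans[OF b0 max.cobounded2] _ _ Db'])
    show "2 * (F (Suc n) h x)^2 * LD (Suc n) h x = 2 * (F n h x)^2 * LD n h x * (fac (Suc n) h x)^2
      + 2 * (F n h x)^2 * (- (\<i> * t (Suc n))) * ((fac (Suc n) h x)^2 * ld (Suc n) h x)" for x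
      by (simp add: F_Suc LD_Suc power_mult_distrib algebra_simps)
  qed measurable
  have int: "integrable M (\<lambda>x. norm (Y x) * c x)"
    if "Y \<in> borel_measurable M" "\<And>x. norm (Y x) \<le> C" for Y :: "'a \<Rightarrow> complex" and C
  proof (rule integrable_bounded)
    show "norm (norm (Y x) * c x) \<le> C * 1" for x
      unfolding norm_mult using that(2)[of x] c(2)[of x] order_trans[OF norm_ge_zero that(2)[of x]]
      by (intro mult_mono) auto
  qed (use that(1) in measurable)
  have "(LINT x|M. g n h x * c x) = (LINT x|M. norm ((F n h x)^2) * c x) + (LINT x|M. norm (2 * (F n h x)^2 * LD n h x) * c x)"
    unfolding g_def distrib_right by (intro Bochner_Integration.integral_add int[OF _ Fb] int[OF _ Db]) measurable
  also have "\<dots> \<le> (LINT x|M. norm ((F (Suc n) h x)^2) * c x) + (LINT x|M. norm (2 * (F (Suc n) h x)^2 * LD (Suc n) h x) * c x)"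
    by (intro add_mono m1 m2)
  also have "\<dots> = (LINT x|M. g (Suc n) h x * c x)"
    unfolding g_def distrib_right by (intro Bochner_Integration.integral_add[symmetric] int[OF _ Fb'] int[OF _ Db']) measurable
  finally show ?thesis .
qed

lemma expectation_Q_mult_le:
  assumes c: "c \<in> borel_measurable M" "\<And>x. 0 \<le> c x \<and> c x \<le> (1::real)"
    and le: "\<And>h. (LINT x|M. g n h x * c x) \<le> (LINT x|M. g m h x * d x)"
    and d: "d \<in> borel_measurable M" "\<And>x. 0 \<le> d x \<and> d x \<le> (1::real)"
  shows "(LINT x|M. Q n x * c x) \<le> (LINT x|M. Q m x * d x)"
proof -
  interpret U: prob_space unit_interval by (rule prob_space_unit_interval)
  have int: "integrable unit_interval (\<lambda>h. LINT x|M. g n h x * c x)"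
    if c: "c \<in> borel_measurable M" "\<And>x. 0 \<le> c x \<and> c x \<le> (1::real)" for c n
  proof (rule U.integrable_const_bound[where B = "gB n"])
    have b: "norm (g n h x * c x) \<le> gB n * 1" for h x
      unfolding norm_mult using g_bounds[of n h x] c(2)[of x] by (intro mult_mono) auto
    have "norm (LINT x|M. g n h x * c x) \<le> gB n" for h
    proof -
      have "norm (LINT x|M. g n h x * c x) \<le> (LINT x|M. norm (g n h x * c x))"
        by (rule integral_norm_bound)
      also have "\<dots> \<le> (LINT x|M. gB n * 1)"
        using b c(1) by (intro integral_mono integrable_norm integrable_bounded) auto
      finally show ?thesis by (simp add: prob_space)
    qed
    then show "AE h in unit_interval. norm (LINT x|M. g n h x * c x) \<le> gB n" by simp
  qed (rule expectation_Q_mult(2)[OF c])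
  show ?thesis
    unfolding expectation_Q_mult(1)[OF c] expectation_Q_mult(1)[OF d]
    by (intro integral_mono int c d le)
qed

lemma Q_submartingale:
  assumes c: "c \<in> borel_measurable (past n)" "\<And>x. 0 \<le> c x \<and> c x \<le> (1::real)"
  shows "(LINT x|M. Q n x * c x) \<le> (LINT x|M. Q (Suc n) x * c x)"
  using past_subset[OF c(1)] by (intro expectation_Q_mult_le g_submartingale c) auto


section \<open>Tilted moments of the logarithmic derivative\<close>

lemma norm_fac_square_le: "(norm (fac n h x))^2 \<le> 4^2"
  using norm_fac_le by (intro power_mono) auto

lemma norm_F_square_le: "(norm (F n h x))^2 \<le> (4 ^ Suc n)^2"
  using norm_F_le by (intro power_mono) auto

lemma expectation_norm_F_square: "(LINT x|M. (norm (F n h x))^2) = W n"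
proof (induction n)
  case (Suc n)
  have "(LINT x|M. (norm (F (Suc n) h x))^2) = (LINT x|M. (norm (F n h x))^2 * (norm (fac (Suc n) h x))^2)"
    by (simp add: F_Suc norm_mult power_mult_distrib)
  also have "\<dots> = W n * w (Suc n)"
    using norm_F_square_le[of n h] norm_fac_square_le[of "Suc n" h] F_measurable_past[of n n h]
    by (subst expectation_step[where \<phi> = "\<lambda>a _. (norm a)^2" and B = "(4 ^ Suc n)^2" and B' = "4^2"])
      (auto simp: Suc expectation_fac_norm_square)
  finally show ?case by (simp add: W_Suc)
qed (simp add: prob_space)

text \<open>The drift of the derivative: under the tilted law \<open>LD n h x\<close> has mean
  \<open>- \<i> * \<alpha> n\<close>.\<close>

definition \<alpha> :: "nat \<Rightarrow> real" where
  "\<alpha> n = (\<Sum>j\<le>n. t j * (r j)^2 * w j)"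

lemma \<alpha>_nonneg: "\<alpha> n \<ge> 0"
  unfolding \<alpha>_def using t_nonneg w_ge_1 by (intro sum_nonneg mult_nonneg_nonneg) (auto intro: order_trans[OF zero_le_one])

lemma expectation_norm_F_square_LD:
  "(LINT x|M. complex_of_real ((norm (F n h x))^2) * LD n h x) = - \<i> * of_real (\<alpha> n * W n)"
proof (induction n)
  case 0
  have "r 0 = 0" using r_off zero_notin by simp
  then show ?case by (simp add: \<alpha>_def)
next
  case (Suc n)
  note F_measurable_past[of n n h, simplified, measurable] LD_measurable_past[of n n h, simplified, measurable]
  let ?S = "\<Sum>j\<le>n. t j * (4 * r j)"
  let ?a = "fac (Suc n) h" and ?y = "ld (Suc n) h"
  have S0: "?S \<ge> 0" using t_nonneg r_nonneg by (intro sum_nonneg) auto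
  have b1: "norm (complex_of_real ((norm (F n h x))^2) * LD n h x) \<le> (4 ^ Suc n)^2 * ?S" for x
    unfolding norm_mult norm_of_real using norm_F_square_le[of n h x] norm_LD_le[of n h x]
    by (intro mult_mono) auto
  have b1': "norm (complex_of_real ((norm (F n h x))^2)) \<le> (4 ^ Suc n)^2" for x
    unfolding norm_of_real abs_power2 by (rule norm_F_square_le)
  have b2: "norm (complex_of_real ((norm (?a x))^2)) \<le> 4^2" for x
    unfolding norm_of_real abs_power2 by (rule norm_fac_square_le)
  have b3: "norm (complex_of_real ((norm (?a x))^2) * ?y x) \<le> 4^2 * (4 * r (Suc n))" for x
    unfolding norm_mult using b2[of x] norm_ld_le[of "Suc n" h x] by (intro mult_mono) auto
  have e1: "(LINT x|M. (complex_of_real ((norm (F n h x))^2) * LD n h x) * complex_of_real ((norm (?a x))^2))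
    = - \<i> * of_real (\<alpha> n * W n) * of_real (w (Suc n))"
  proof (subst expectation_step[where \<phi> = "\<lambda>a _. complex_of_real ((norm a)^2)", OF _ b1 _ b2])
    show "(LINT x|M. complex_of_real ((norm (F n h x))^2) * LD n h x) * (LINT x|M. complex_of_real ((norm (?a x))^2))
      = - \<i> * of_real (\<alpha> n * W n) * of_real (w (Suc n))"
      unfolding Suc integral_complex_of_real expectation_fac_norm_square ..
  qed measurable
  have e2: "(LINT x|M. complex_of_real ((norm (F n h x))^2) * (complex_of_real ((norm (?a x))^2) * ?y x))
    = of_real (W n) * of_real ((r (Suc n))^2 * w (Suc n) * w (Suc n))"
  proof (subst expectation_step[where \<phi> = "\<lambda>a b. complex_of_real ((norm a)^2) * b", OF _ b1' _ b3])
    show "(LINT x|M. complex_of_real ((norm (F n h x))^2)) * (LINT x|M. complex_of_real ((norm (?a x))^2) * ?y x)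
      = of_real (W n) * of_real ((r (Suc n))^2 * w (Suc n) * w (Suc n))"
      unfolding expectation_fac_norm_square_ld integral_complex_of_real expectation_norm_F_square ..
  qed measurable
  have i1: "integrable M (\<lambda>x. (complex_of_real ((norm (F n h x))^2) * LD n h x) * complex_of_real ((norm (?a x))^2))"
  proof (rule integrable_bounded)
    show "norm ((complex_of_real ((norm (F n h x))^2) * LD n h x) * complex_of_real ((norm (?a x))^2)) \<le> (4 ^ Suc n)^2 * ?S * 4^2" for x
      unfolding norm_mult[of _ "complex_of_real ((norm (?a x))^2)"] using b1[of x] b2[of x] S0 by (intro mult_mono) auto
  qed measurable
  have i2: "integrable M (\<lambda>x. complex_of_real ((norm (F n h x))^2) * (complex_of_real ((norm (?a x))^2) * ?y x))"
  proof (rule integrable_bounded)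
    show "norm (complex_of_real ((norm (F n h x))^2) * (complex_of_real ((norm (?a x))^2) * ?y x)) \<le> (4 ^ Suc n)^2 * (4^2 * (4 * r (Suc n)))" for x
      unfolding norm_mult[of "complex_of_real ((norm (F n h x))^2)"] using b1'[of x] b3[of x] by (intro mult_mono) auto
  qed measurable
  have "(LINT x|M. complex_of_real ((norm (F (Suc n) h x))^2) * LD (Suc n) h x)
     = (LINT x|M. (complex_of_real ((norm (F n h x))^2) * LD n h x) * complex_of_real ((norm (?a x))^2)
        - \<i> * t (Suc n) * (complex_of_real ((norm (F n h x))^2) * (complex_of_real ((norm (?a x))^2) * ?y x)))"
    by (simp add: F_Suc LD_Suc norm_mult power_mult_distrib algebra_simps)
  also have "\<dots> = - \<i> * of_real (\<alpha> n * W n) * of_real (w (Suc n)) - \<i> * t (Suc n) * (of_real (W n) * of_real ((r (Suc n))^2 * w (Suc n) * w (Suc n)))"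
    using i2 by (subst Bochner_Integration.integral_diff[OF i1]) (simp_all only: integral_mult_right_zero integrable_mult_right e1 e2)
  also have "\<dots> = - \<i> * of_real (\<alpha> (Suc n) * W (Suc n))"
    by (simp add: \<alpha>_def W_Suc algebra_simps)
  finally show ?case .
qed

text \<open>Squared mean plus variance under the tilt. The cross term of a step is exact, through
  \<open>expectation_norm_F_square_LD\<close>, and completes the square of
  \<open>\<alpha> (Suc n)\<close>; the fresh term costs at most
  \<open>16 * t^2 * r^2\<close>.\<close>

lemma expectation_norm_F_LD_square_le:
  "(LINT x|M. (norm (F n h x))^2 * (norm (LD n h x))^2) \<le> W n * ((\<alpha> n)^2 + 16 * (\<Sum>j\<le>n. (t j)^2 * (r j)^2))"
proof (induction n)
  case 0
  have "r 0 = 0" using r_off zero_notin by simp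
  then show ?case by (simp add: \<alpha>_def)
next
  case (Suc n)
  note F_measurable_past[of n n h, simplified, measurable] LD_measurable_past[of n n h, simplified, measurable]
  let ?S = "\<Sum>j\<le>n. t j * (4 * r j)"
  let ?a = "fac (Suc n) h" and ?d = "ld (Suc n) h"
  let ?Y = "\<lambda>x. complex_of_real ((norm (F n h x))^2) * LD n h x"
  define T where "T = t (Suc n)"
  define R where "R = r (Suc n)"
  define v where "v = w (Suc n)"
  have v: "v \<ge> 1" "v \<le> 2" unfolding v_def by (rule w_ge_1 w_le_2)+
  have T0: "T \<ge> 0" "R \<ge> 0" unfolding T_def R_def by (rule t_nonneg r_nonneg)+
  have S0: "?S \<ge> 0" using t_nonneg r_nonneg by (intro sum_nonneg) auto
  have L2: "(norm (LD n h x))^2 \<le> ?S^2" for x using norm_LD_le by (intro power_mono) auto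
  have a2: "(norm (?a x))^2 \<le> 4^2" for x by (rule norm_fac_square_le)
  have x1: "norm (?d x) \<le> 4 * R" for x unfolding R_def by (rule norm_ld_le)
  have x2: "(norm (?d x))^2 \<le> (4 * R)^2" for x using x1 by (intro power_mono) auto
  have b0: "norm ((norm (F n h x))^2 * (norm (LD n h x))^2) \<le> (4 ^ Suc n)^2 * ?S^2" for x
    using mult_mono[OF norm_F_square_le[of n h x] L2[of x]] by simp
  have b1: "norm (?Y x) \<le> (4 ^ Suc n)^2 * ?S" for x
    unfolding norm_mult norm_of_real using norm_F_square_le[of n h x] norm_LD_le[of n h x]
    by (intro mult_mono) auto
  have b3: "norm (complex_of_real ((norm (?a x))^2) * cnj (?d x)) \<le> 4^2 * (4 * R)" for x
    unfolding norm_mult norm_of_real using a2[of x] x1[of x] by (intro mult_mono) auto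
  have [measurable]: "cnj \<in> borel_measurable borel" by (intro borel_measurable_continuous_onI continuous_intros)
  have e1: "(LINT x|M. ((norm (F n h x))^2 * (norm (LD n h x))^2) * (norm (?a x))^2)
    = (LINT x|M. (norm (F n h x))^2 * (norm (LD n h x))^2) * v"
    unfolding v_def expectation_fac_norm_square[of "Suc n" h, symmetric]
  proof (rule expectation_step[where \<phi> = "\<lambda>a _. (norm a)^2", OF _ b0])
    show "norm ((norm (?a x))^2) \<le> 4^2" for x using a2[of x] by simp
  qed measurable
  have e2: "(LINT x|M. ?Y x * (complex_of_real ((norm (?a x))^2) * cnj (?d x))) = (- \<i> * of_real (\<alpha> n * W n)) * of_real (R^2 * v * v)"
  proof (subst expectation_step[where \<phi> = "\<lambda>a b. complex_of_real ((norm a)^2) * cnj b", OF _ b1 _ b3])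
    have "(LINT x|M. complex_of_real ((norm (?a x))^2) * cnj (?d x)) = cnj (LINT x|M. complex_of_real ((norm (?a x))^2) * ?d x)"
      by (subst Bochner_Integration.integral_cnj[symmetric]) simp
    then show "(LINT x|M. ?Y x) * (LINT x|M. complex_of_real ((norm (?a x))^2) * cnj (?d x))
      = (- \<i> * of_real (\<alpha> n * W n)) * of_real (R^2 * v * v)"
      unfolding expectation_fac_norm_square_ld expectation_norm_F_square_LD R_def v_def by simp
  qed measurable
  have e3: "(LINT x|M. (norm (F n h x))^2 * ((norm (?a x))^2 * (norm (?d x))^2)) \<le> W n * (v * (4 * R)^2)"
  proof -
    have "(LINT x|M. (norm (F n h x))^2 * ((norm (?a x))^2 * (norm (?d x))^2))
      = (LINT x|M. (norm (F n h x))^2) * (LINT x|M. (norm (?a x))^2 * (norm (?d x))^2)"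
    proof (rule expectation_step[where \<phi> = "\<lambda>a b. (norm a)^2 * (norm b)^2"])
      show "norm ((norm (F n h x))^2) \<le> (4 ^ Suc n)^2" for x using norm_F_square_le[of n h x] by simp
      show "norm ((norm (?a x))^2 * (norm (?d x))^2) \<le> 4^2 * (4 * R)^2" for x
        using mult_mono[OF a2[of x] x2[of x]] by simp
    qed measurable
    also have "(LINT x|M. (norm (F n h x))^2) = W n" by (rule expectation_norm_F_square)
    also have "(LINT x|M. (norm (?a x))^2 * (norm (?d x))^2) \<le> (LINT x|M. (norm (?a x))^2 * (4 * R)^2)"
    proof (intro integral_mono mult_left_mono x2)
      show "integrable M (\<lambda>x. (norm (?a x))^2 * (norm (?d x))^2)"
        using mult_mono[OF a2 x2] by (intro integrable_bounded[where B = "4^2 * (4 * R)^2"]) auto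
      show "integrable M (\<lambda>x. (norm (?a x))^2 * (4 * R)^2)"
        using a2 by (intro integrable_mult_left integrable_bounded[where B = "4^2"]) auto
    qed auto
    also have "\<dots> = v * (4 * R)^2" by (simp add: expectation_fac_norm_square v_def)
    finally show ?thesis using W_pos[of n] by simp
  qed
  have i1: "integrable M (\<lambda>x. ((norm (F n h x))^2 * (norm (LD n h x))^2) * (norm (?a x))^2)"
  proof (rule integrable_bounded)
    show "norm (((norm (F n h x))^2 * (norm (LD n h x))^2) * (norm (?a x))^2) \<le> (4 ^ Suc n)^2 * ?S^2 * 4^2" for x
      using mult_mono[OF b0[of x] a2[of x]] S0 by simp
  qed measurable
  have i2: "integrable M (\<lambda>x. ?Y x * (complex_of_real ((norm (?a x))^2) * cnj (?d x)))"
  proof (rule integrable_bounded)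
    show "norm (?Y x * (complex_of_real ((norm (?a x))^2) * cnj (?d x))) \<le> (4 ^ Suc n)^2 * ?S * (4^2 * (4 * R))" for x
      unfolding norm_mult[of "?Y x"] using b1[of x] b3[of x] S0 by (intro mult_mono) auto
  qed measurable
  have i3: "integrable M (\<lambda>x. (norm (F n h x))^2 * ((norm (?a x))^2 * (norm (?d x))^2))"
  proof (rule integrable_bounded)
    show "norm ((norm (F n h x))^2 * ((norm (?a x))^2 * (norm (?d x))^2)) \<le> (4 ^ Suc n)^2 * (4^2 * (4 * R)^2)" for x
      using mult_mono[OF norm_F_square_le[of n h x] mult_mono[OF a2[of x] x2[of x]]] by simp
  qed measurable
  have ex: "(norm (F (Suc n) h x))^2 * (norm (LD (Suc n) h x))^2
     = ((norm (F n h x))^2 * (norm (LD n h x))^2) * (norm (?a x))^2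
      + Re (2 * \<i> * T * (?Y x * (complex_of_real ((norm (?a x))^2) * cnj (?d x))))
      + T^2 * ((norm (F n h x))^2 * ((norm (?a x))^2 * (norm (?d x))^2))" for x
  proof -
    have e1: "(norm (LD n h x - \<i> * T * ?d x))^2 = (norm (LD n h x))^2 + Re (2 * \<i> * T * (LD n h x * cnj (?d x))) + T^2 * (norm (?d x))^2"
      unfolding cmod_power2 by (simp add: power2_eq_square algebra_simps)
    have e2: "Re (2 * \<i> * T * (?Y x * (complex_of_real ((norm (?a x))^2) * cnj (?d x))))
      = (norm (F n h x))^2 * (norm (?a x))^2 * Re (2 * \<i> * T * (LD n h x * cnj (?d x)))"
    proof -
      have "2 * \<i> * T * (?Y x * (complex_of_real ((norm (?a x))^2) * cnj (?d x)))
        = complex_of_real ((norm (F n h x))^2 * (norm (?a x))^2) * (2 * \<i> * T * (LD n h x * cnj (?d x)))"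
        by (simp add: mult_ac)
      moreover have "Re (complex_of_real d * z) = d * Re z" for d z by simp
      ultimately show ?thesis by (simp only:)
    qed
    have e3: "(norm (F (Suc n) h x))^2 = (norm (F n h x))^2 * (norm (?a x))^2"
      by (simp add: F_Suc norm_mult power_mult_distrib)
    have e4: "LD (Suc n) h x = LD n h x - \<i> * T * ?d x" by (simp add: LD_Suc T_def)
    have e5: "f * a * (m + d + s * y) = f * m * a + f * a * d + s * (f * (a * y))" for f a m d s y :: real
      by (simp add: algebra_simps)
    show ?thesis unfolding e2 e3 e4 e1 by (rule e5)
  qed
  have "(LINT x|M. (norm (F (Suc n) h x))^2 * (norm (LD (Suc n) h x))^2)
     = (LINT x|M. (norm (F n h x))^2 * (norm (LD n h x))^2) * v
       + Re (2 * \<i> * T * ((- \<i> * of_real (\<alpha> n * W n)) * of_real (R^2 * v * v)))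
       + T^2 * (LINT x|M. (norm (F n h x))^2 * ((norm (?a x))^2 * (norm (?d x))^2))"
    unfolding ex e1[symmetric] e2[symmetric]
    using i1 i2 i3 by (simp only: Bochner_Integration.integral_add integrable_mult_right integrable_Re Bochner_Integration.integrable_add integral_mult_right_zero integral_Re)
  also have "Re (2 * \<i> * T * ((- \<i> * of_real (\<alpha> n * W n)) * of_real (R^2 * v * v))) = 2 * T * (\<alpha> n * W n) * (R^2 * v * v)"
    by simp
  also have "(LINT x|M. (norm (F n h x))^2 * (norm (LD n h x))^2) * v + 2 * T * (\<alpha> n * W n) * (R^2 * v * v)
       + T^2 * (LINT x|M. (norm (F n h x))^2 * ((norm (?a x))^2 * (norm (?d x))^2))
    \<le> W n * ((\<alpha> n)^2 + 16 * (\<Sum>j\<le>n. (t j)^2 * (r j)^2)) * v + 2 * T * (\<alpha> n * W n) * (R^2 * v * v) + T^2 * (W n * (v * (4 * R)^2))"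
    using v by (intro add_mono order_refl mult_right_mono[OF Suc.IH] mult_left_mono[OF e3]) auto
  also have "\<dots> = W n * v * ((\<alpha> n)^2 + 2 * \<alpha> n * (T * R^2 * v) + 16 * ((\<Sum>j\<le>n. (t j)^2 * (r j)^2) + T^2 * R^2))"
    by (simp add: algebra_simps power2_eq_square)
  also have "\<dots> \<le> W n * v * ((\<alpha> n + T * R^2 * v)^2 + 16 * ((\<Sum>j\<le>n. (t j)^2 * (r j)^2) + T^2 * R^2))"
    using W_pos[of n] v by (intro mult_left_mono add_right_mono) (auto simp: power2_sum)
  finally show ?case by (simp add: \<alpha>_def W_Suc T_def R_def v_def)
qed


lemma expectation_Q_le:
  assumes C1: "(\<Sum>j\<le>n. t j * (r j)^2) \<le> C * W n" and C2: "(\<Sum>j\<le>n. (t j)^2 * (r j)^2) \<le> (C * W n)^2"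
  shows "(LINT x|M. Q n x) \<le> (2 + 20 * C^2) * (W n)^2"
proof -
  interpret U: prob_space unit_interval by (rule prob_space_unit_interval)
  have "\<alpha> n \<le> 2 * (C * W n)"
  proof -
    have "\<alpha> n \<le> (\<Sum>j\<le>n. t j * (r j)^2 * 2)"
      unfolding \<alpha>_def using t_nonneg w_le_2 by (intro sum_mono mult_left_mono) auto
    also have "\<dots> = 2 * (\<Sum>j\<le>n. t j * (r j)^2)" by (simp add: sum_distrib_left mult_ac)
    finally show ?thesis using C1 by simp
  qed
  then have "(\<alpha> n)^2 \<le> (2 * (C * W n))^2" using \<alpha>_nonneg by (intro power_mono) auto
  \<comment> \<open>The \<open>20\<close> is \<open>4\<close> from
    \<open>\<alpha> n \<le> 2 * (C * W n)\<close> plus \<open>16\<close> from the variance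
    term.\<close>
  then have tot: "(\<alpha> n)^2 + 16 * (\<Sum>j\<le>n. (t j)^2 * (r j)^2) \<le> 20 * (C * W n)^2"
    using C2 by (simp add: power_mult_distrib)
  have Eg: "(LINT x|M. g n h x) \<le> (2 + 20 * C^2) * (W n)^2" for h
  proof -
    let ?S = "\<Sum>j\<le>n. t j * (4 * r j)"
    have L2: "(norm (LD n h x))^2 \<le> ?S^2" for x using norm_LD_le by (intro power_mono) auto
    have i1: "integrable M (\<lambda>x. (norm (F n h x))^2)"
      using norm_F_square_le[of n h] by (intro integrable_bounded[where B = "(4 ^ Suc n)^2"]) auto
    have i2: "integrable M (\<lambda>x. (norm (F n h x))^2 * (norm (LD n h x))^2)"
    proof (rule integrable_bounded)
      show "norm ((norm (F n h x))^2 * (norm (LD n h x))^2) \<le> (4 ^ Suc n)^2 * ?S^2" for x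
        using mult_mono[OF norm_F_square_le[of n h x] L2[of x]] by simp
    qed measurable
    \<comment> \<open>The weight \<open>W n\<close> is the order of \<open>norm (LD n h x)\<close>
      under the tilt, so both halves of \<open>2 * y \<le> W n + y^2 / W n\<close> contribute the
      order \<open>(W n)^2\<close>.\<close>
    have le: "g n h x \<le> (1 + W n) * (norm (F n h x))^2 + 1 / W n * ((norm (F n h x))^2 * (norm (LD n h x))^2)" for x
    proof -
      have "2 * y \<le> W n + y^2 / W n" for y
      proof -
        have "0 \<le> (W n - y)^2" by simp
        then have "2 * y * W n \<le> W n * W n + y^2" by (simp add: power2_eq_square algebra_simps)
        then show ?thesis using W_pos[of n] by (simp add: field_simps)
      qed
      from mult_left_mono[OF this[of "norm (LD n h x)"], of "(norm (F n h x))^2"]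
      show ?thesis by (simp add: g_def norm_mult norm_power algebra_simps)
    qed
    have "(LINT x|M. g n h x) \<le> (LINT x|M. (1 + W n) * (norm (F n h x))^2 + 1 / W n * ((norm (F n h x))^2 * (norm (LD n h x))^2))"
    proof (intro integral_mono le)
      show "integrable M (g n h)"
        using g_bounds[of n h] by (intro integrable_bounded[where B = "gB n"]) auto
    qed (use i1 i2 in simp)
    also have "\<dots> = (1 + W n) * (LINT x|M. (norm (F n h x))^2) + 1 / W n * (LINT x|M. (norm (F n h x))^2 * (norm (LD n h x))^2)"
      using i1 i2 by (simp only: Bochner_Integration.integral_add integrable_mult_right integral_mult_right_zero)
    also have "\<dots> \<le> (1 + W n) * W n + 1 / W n * (W n * ((\<alpha> n)^2 + 16 * (\<Sum>j\<le>n. (t j)^2 * (r j)^2)))"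
      unfolding expectation_norm_F_square using W_pos[of n]
      by (intro add_left_mono mult_left_mono expectation_norm_F_LD_square_le) auto
    also have "\<dots> \<le> (1 + W n) * W n + 20 * (C * W n)^2"
      using tot W_pos[of n] by simp
    also have "\<dots> \<le> (2 + 20 * C^2) * (W n)^2"
      using W_ge_1[of n] by (simp add: power2_eq_square algebra_simps)
    finally show ?thesis .
  qed
  have "(LINT x|M. Q n x) = (LINT h|unit_interval. (LINT x|M. g n h x))"
    using expectation_Q_mult(1)[of "\<lambda>_. 1" n] by simp
  also have "\<dots> \<le> (LINT h|unit_interval. (2 + 20 * C^2) * (W n)^2)"
  proof (intro integral_mono Eg)
    have nn: "0 \<le> (LINT x|M. g n h x)" for h using g_bounds by (intro integral_nonneg_AE) auto
    show "integrable unit_interval (\<lambda>h. LINT x|M. g n h x)"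
      using expectation_Q_mult(2)[of "\<lambda>_. 1" n] Eg nn
      by (intro U.integrable_const_bound[where B = "(2 + 20 * C^2) * (W n)^2"]) auto
  qed simp
  also have "\<dots> = (2 + 20 * C^2) * (W n)^2" using U.prob_space by simp
  finally show ?thesis .
qed

section \<open>Maximal inequality with growing thresholds\<close>

definition safe :: "(nat \<Rightarrow> real) \<Rightarrow> nat \<Rightarrow> 'a \<Rightarrow> real" where
  "safe T n x = (if \<forall>k\<le>n. Q k x \<le> T k then 1 else 0)"

lemma past_mono: "k \<le> n \<Longrightarrow> Y \<in> borel_measurable (past k) \<Longrightarrow> Y \<in> borel_measurable (past n)"
proof -
  assume kn: "k \<le> n" and Y: "Y \<in> borel_measurable (past k)"
  have "(\<lambda>x. restrict (\<lambda>j. X j x) (I \<inter> {..k})) \<in> measurable (past n) (PiM (I \<inter> {..k}) (\<lambda>_. borel))"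
  proof (rule measurable_restrict)
    fix j assume j: "j \<in> I \<inter> {..k}"
    then have "X' j \<in> borel_measurable (past n)" using kn by (intro X'_measurable_past) auto
    then show "X j \<in> borel_measurable (past n)" using j by (simp add: X'_def[abs_def])
  qed
  then have "(\<lambda>x. x) \<in> measurable (past n) (past k)"
    unfolding past_def[of k] by (intro measurable_vimage_algebra2) auto
  from measurable_compose[OF this Y] show ?thesis .
qed

lemma safe_measurable_past: "safe T n \<in> borel_measurable (past n)"
proof -
  have [measurable]: "Q k \<in> borel_measurable (past n)" if "k \<in> {..n}" for k
    using past_mono[OF _ Q_measurable_past] that by simp
  have "Measurable.pred (past n) (\<lambda>x. \<forall>k\<in>{..n}. Q k x \<le> T k)" by measurable
  then have "(\<lambda>x. if \<forall>k\<in>{..n}. Q k x \<le> T k then 1 else 0 :: real) \<in> borel_measurable (past n)" by measurable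
  then show ?thesis by (simp add: safe_def[abs_def] Ball_def)
qed

lemma safe_measurable [measurable]: "safe T n \<in> borel_measurable M"
  using past_subset[OF safe_measurable_past] .

lemma safe_bounds: "0 \<le> safe T n x" "safe T n x \<le> 1"
  by (auto simp: safe_def)

text \<open>Chow's maximal inequality for the submartingale \<open>Q\<close>.\<close>

lemma expectation_unsafe_le:
  assumes T: "\<And>k. T k > 0" "\<And>k. T k \<le> T (Suc k)" and R: "\<And>k. (LINT x|M. Q k x) \<le> R k"
  shows "1 - (LINT x|M. safe T n x) \<le> R 0 / T 0 + (\<Sum>k<n. (R (Suc k) - R k) / T (Suc k))"
proof -
  define s where "s k = (LINT x|M. safe T k x)" for k
  define d where "d k = (LINT x|M. Q k x * (1 - safe T k x))" for k
  have iQ: "integrable M (\<lambda>x. Q n x * c x)"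
    if "c \<in> borel_measurable M" "\<And>x. 0 \<le> c x \<and> c x \<le> 1" for n and c :: "'a \<Rightarrow> real"
  proof (rule integrable_bounded)
    show "norm (Q n x * c x) \<le> gB n * 1" for x
      unfolding norm_mult using Q_bounds[of n x] that(2)[of x] by (intro mult_mono) auto
  qed (use that(1) in measurable)
  have isf: "integrable M (safe T k)" for k
    using safe_bounds[of T k] by (intro integrable_bounded[where B = 1]) auto
  have mono: "safe T (Suc k) x \<le> safe T k x" for k x by (auto simp: safe_def)
  have dR: "d k \<le> R k" for k
  proof -
    have "d k \<le> (LINT x|M. Q k x * 1)"
      unfolding d_def using safe_bounds[of T k] Q_bounds[of k]
      by (intro integral_mono iQ mult_left_mono) auto
    then show ?thesis using R[of k] by simp
  qed
  have d0: "T 0 * (1 - s 0) \<le> d 0"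
  proof -
    have "T 0 * (1 - s 0) = (LINT x|M. T 0 * (1 - safe T 0 x))" using isf by (simp add: s_def prob_space)
    also have "\<dots> \<le> d 0"
      unfolding d_def
    proof (intro integral_mono iQ)
      show "T 0 * (1 - safe T 0 x) \<le> Q 0 x * (1 - safe T 0 x)" for x
        by (auto simp: safe_def)
    qed (use isf safe_bounds in auto)
    finally show ?thesis .
  qed
  \<comment> \<open>At a first crossing \<open>Q (Suc k) x\<close> exceeds \<open>T (Suc k)\<close>;
    the submartingale property with weight \<open>1 - safe T k\<close> handles earlier crossings and
    leaves an increment of \<open>d\<close>.\<close>
  have dS: "T (Suc k) * (s k - s (Suc k)) \<le> d (Suc k) - d k" for k
  proof -
    have "T (Suc k) * (s k - s (Suc k)) = (LINT x|M. T (Suc k) * (safe T k x - safe T (Suc k) x))"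
      using isf by (simp add: s_def)
    also have "\<dots> \<le> (LINT x|M. Q (Suc k) x * (safe T k x - safe T (Suc k) x))"
    proof (intro integral_mono iQ)
      fix x
      show "0 \<le> safe T k x - safe T (Suc k) x \<and> safe T k x - safe T (Suc k) x \<le> 1"
        using mono[of k x] safe_bounds[of T k x] safe_bounds[of T "Suc k" x] by linarith
      show "T (Suc k) * (safe T k x - safe T (Suc k) x) \<le> Q (Suc k) x * (safe T k x - safe T (Suc k) x)"
        by (auto simp: safe_def le_Suc_eq)
    qed (use isf in auto)
    also have "\<dots> = (LINT x|M. Q (Suc k) x * (1 - safe T (Suc k) x) - Q (Suc k) x * (1 - safe T k x))"
      by (simp add: algebra_simps)
    also have "\<dots> = d (Suc k) - (LINT x|M. Q (Suc k) x * (1 - safe T k x))"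
      unfolding d_def using safe_bounds by (intro Bochner_Integration.integral_diff iQ) auto
    finally have "T (Suc k) * (s k - s (Suc k)) \<le> d (Suc k) - (LINT x|M. Q (Suc k) x * (1 - safe T k x))" .
    moreover have "d k \<le> (LINT x|M. Q (Suc k) x * (1 - safe T k x))"
      unfolding d_def using safe_bounds safe_measurable_past by (intro Q_submartingale) auto
    ultimately show ?thesis by linarith
  qed
  \<comment> \<open>Summation by parts moves the differences to the decreasing \<open>1 / T\<close>,
    so that \<open>d\<close> can be replaced by \<open>R\<close> term by term; afterwards the parts
    are summed back.\<close>
  have "1 - s n \<le> d n / T n + (\<Sum>k<n. d k * (1 / T k - 1 / T (Suc k)))"
  proof (induction n)
    case 0
    show ?case using d0 T(1)[of 0] by (simp add: field_simps)
  next
    case (Suc n)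
    have "s n - s (Suc n) \<le> (d (Suc n) - d n) / T (Suc n)"
      using dS[of n] T(1)[of "Suc n"] by (simp add: field_simps)
    then have "1 - s (Suc n) \<le> d n / T n + (\<Sum>k<n. d k * (1 / T k - 1 / T (Suc k))) + (d (Suc n) - d n) / T (Suc n)"
      using Suc by linarith
    then show ?case by (simp add: algebra_simps diff_divide_distrib)
  qed
  also have "\<dots> \<le> R n / T n + (\<Sum>k<n. R k * (1 / T k - 1 / T (Suc k)))"
    using T dR by (intro add_mono divide_right_mono sum_mono mult_right_mono) (auto intro: less_imp_le frac_le)
  also have "\<dots> = R 0 / T 0 + (\<Sum>k<n. (R (Suc k) - R k) / T (Suc k))"
    by (induction n) (simp_all add: algebra_simps diff_divide_distrib)
  finally show ?thesis by (simp add: s_def)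
qed

text \<open>The thresholds match \<open>sum_log_square_increments_le\<close>: the initial term
  contributes \<open>1\<close> and the sum at most \<open>2\<close>, hence the
  \<open>3\<close>.\<close>

lemma expectation_unsafe_exp_le:
  assumes C1: "\<And>n. (\<Sum>j\<le>n. t j * (r j)^2) \<le> C * W n"
    and C2: "\<And>n. (\<Sum>j\<le>n. (t j)^2 * (r j)^2) \<le> (C * W n)^2"
  shows "1 - (LINT x|M. safe (\<lambda>k. (exp A * W k * u k)^2) n x) \<le> 3 * (2 + 20 * C^2) * exp (- (2 * A))"
proof -
  define D where "D = 2 + 20 * C^2"
  have D: "D \<ge> 0" by (simp add: D_def)
  have upos: "u k > 0" for k using u_ge_1[of k] by linarith
  have e: "exp (- (2 * A)) = 1 / (exp A)^2" by (simp add: exp_minus exp_double divide_inverse)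
  have "1 - (LINT x|M. safe (\<lambda>k. (exp A * W k * u k)^2) n x)
    \<le> D * (W 0)^2 / (exp A * W 0 * u 0)^2 + (\<Sum>k<n. (D * (W (Suc k))^2 - D * (W k)^2) / (exp A * W (Suc k) * u (Suc k))^2)"
  proof (rule expectation_unsafe_le)
    fix k
    show "0 < (exp A * W k * u k)^2" using W_pos[of k] upos[of k] by simp
    show "(exp A * W k * u k)^2 \<le> (exp A * W (Suc k) * u (Suc k))^2"
      using W_mono[of k] u_mono[of k] W_pos[of k] upos[of k] W_pos[of "Suc k"] by (intro power_mono mult_mono) auto
    show "(LINT x|M. Q k x) \<le> D * (W k)^2"
      unfolding D_def by (rule expectation_Q_le[OF C1 C2])
  qed
  also have "(\<Sum>k<n. (D * (W (Suc k))^2 - D * (W k)^2) / (exp A * W (Suc k) * u (Suc k))^2)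
    = D * exp (- (2 * A)) * (\<Sum>k<n. ((W (Suc k))^2 - (W k)^2) / ((W (Suc k))^2 * (u (Suc k))^2))"
    unfolding e sum_distrib_left
    by (intro sum.cong refl) (simp add: power_mult_distrib flip: right_diff_distrib)
  also have "\<dots> \<le> D * exp (- (2 * A)) * 2"
    using D sum_log_square_increments_le[of W n] W_mono unfolding u_def by (intro mult_left_mono) auto
  also have "D * (W 0)^2 / (exp A * W 0 * u 0)^2 = D * exp (- (2 * A))"
    unfolding e by (simp add: power_mult_distrib)
  finally show ?thesis by (simp add: D_def algebra_simps)
qed

end

section \<open>Low moments\<close>

text \<open>Hoelder with exponents \<open>1 / a\<close> and \<open>1 / (1 - a)\<close>, from Young's
  inequality for quantities normalised by their means; an indicator \<open>c\<close> equals its own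
  powers. With \<open>c = 1\<close> it is Jensen's inequality.\<close>

lemma (in prob_space) expectation_powr_interpolation:
  fixes Y c :: "'a \<Rightarrow> real"
  assumes Y: "integrable M Y" "\<And>x. 0 \<le> Y x"
    and c: "c \<in> borel_measurable M" "\<And>x. c x \<in> {0, 1}"
    and a: "0 < a" "a \<le> 1"
  shows "(LINT x|M. Y x powr a * c x) \<le> (LINT x|M. Y x) powr a * (LINT x|M. c x) powr (1 - a)"
proof -
  define S where "S = (LINT x|M. Y x)"
  define P where "P = (LINT x|M. c x)"
  note c(1) [measurable]
  have [measurable]: "Y \<in> borel_measurable M" using Y(1) by auto
  have c01: "0 \<le> c x" "c x \<le> 1" for x using c(2)[of x] by auto
  have ic: "integrable M c" using c01 by (intro integrable_const_bound[where B = 1]) auto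
  have S0: "S \<ge> 0" "P \<ge> 0" using Y(2) c01 by (auto simp: S_def P_def intro!: integral_nonneg_AE)
  show ?thesis
  proof (cases "S = 0 \<or> P = 0")
    case True
    have "AE x in M. Y x powr a * c x = 0"
    proof (cases "S = 0")
      case True
      then have "AE x in M. Y x = 0"
        using integral_nonneg_eq_0_iff_AE[OF Y(1)] Y(2) by (simp add: S_def)
      then show ?thesis by eventually_elim simp
    next
      case False
      then have "AE x in M. c x = 0"
        using True integral_nonneg_eq_0_iff_AE[OF ic] c01 by (simp add: P_def)
      then show ?thesis by eventually_elim simp
    qed
    then have "(LINT x|M. Y x powr a * c x) = (LINT x|M. 0)"
      by (intro integral_cong_AE) auto
    then show ?thesis by simp
  next
    case False
    then have pos: "S > 0" "P > 0" using S0 by auto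
    have pt: "Y x powr a * c x \<le> S powr a * P powr (1 - a) * (a / S * Y x + (1 - a) / P * c x)" for x
    proof (cases "Y x = 0 \<or> c x = 0")
      case True
      then have "Y x powr a * c x = 0" by auto
      moreover have "0 \<le> S powr a * P powr (1 - a) * (a / S * Y x + (1 - a) / P * c x)"
        using Y(2) c01 pos a by (intro mult_nonneg_nonneg add_nonneg_nonneg) auto
      ultimately show ?thesis by (simp only:)
    next
      case False
      then have Yp: "Y x > 0" and c1: "c x = 1" using Y(2)[of x] c(2)[of x] by auto
      have "(Y x / S) powr a * (1 / P) powr (1 - a) \<le> a * (Y x / S) + (1 - a) * (1 / P)"
        using Yp pos a by (intro Youngs_inequality_0) auto
      then have "S powr a * P powr (1 - a) * ((Y x / S) powr a * (1 / P) powr (1 - a))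
         \<le> S powr a * P powr (1 - a) * (a * (Y x / S) + (1 - a) * (1 / P))"
        by (intro mult_left_mono) auto
      moreover have "S powr a * P powr (1 - a) * ((Y x / S) powr a * (1 / P) powr (1 - a)) = Y x powr a"
        using Yp pos by (simp add: powr_divide)
      ultimately show ?thesis by (simp add: c1)
    qed
    have "(LINT x|M. Y x powr a * c x) \<le> (LINT x|M. S powr a * P powr (1 - a) * (a / S * Y x + (1 - a) / P * c x))"
    proof (rule integral_mono)
      show "integrable M (\<lambda>x. S powr a * P powr (1 - a) * (a / S * Y x + (1 - a) / P * c x))"
        using Y(1) ic by simp
      then show "integrable M (\<lambda>x. Y x powr a * c x)"
        by (rule Bochner_Integration.integrable_bound) (use pt c01 in \<open>auto intro!: AE_I2 order_trans[OF _ abs_ge_self]\<close>)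
    qed (rule pt)
    also have "\<dots> = S powr a * P powr (1 - a)"
      using Y(1) ic pos by (simp add: S_def[symmetric] P_def[symmetric])
    finally show ?thesis by (simp add: S_def P_def)
  qed
qed

lemma powr_sum_inverse_le:
  fixes a b q :: real
  assumes "0 \<le> a" "0 \<le> b" "1/2 \<le> q"
  shows "(a + b) powr (1/q) \<le> 4 * (a powr (1/q) + b powr (1/q))"
proof -
  have "(a + b) powr (1/q) \<le> (2 * max a b) powr (1/q)" using assms by (intro powr_mono2) auto
  also have "\<dots> = 2 powr (1/q) * max a b powr (1/q)" using assms by (simp add: powr_mult)
  also have "\<dots> \<le> 2 powr 2 * max a b powr (1/q)"
    using assms by (intro mult_right_mono powr_mono) (auto simp: field_simps)
  also have "\<dots> \<le> 4 * (a powr (1/q) + b powr (1/q))" by (auto simp: max_def)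
  finally show ?thesis .
qed

text \<open>The logarithm is \<open>ln (16 * D)\<close> with \<open>D\<close> the constant of
  \<open>expectation_unsafe_exp_le\<close>; \<open>800000\<close> is the quasi-triangle constant
  \<open>4\<close> times the \<open>200000\<close> of \<open>survival_le\<close>.\<close>

definition chaos_constant :: "real \<Rightarrow> real" where
  "chaos_constant C = 800000 * (ln (16 * (3 * (2 + 20 * C^2))) + 3)"

context circle_chaos
begin

section \<open>The normalised total mass and its moments\<close>

definition mass :: "nat \<Rightarrow> 'a \<Rightarrow> real" where
  "mass n x = (LINT h|unit_interval. (norm (F n h x))^2) / W n"

lemma F_measurable_pair_M: "(\<lambda>x. F n (fst x) (snd x)) \<in> borel_measurable (unit_interval \<Otimes>\<^sub>M M)"
proof -
  have "(\<lambda>x. x) \<in> measurable unit_interval borel" by (rule measurable_unit_interval) simp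
  then have "(\<lambda>x. (fst x, snd x)) \<in> measurable (unit_interval \<Otimes>\<^sub>M M) (borel \<Otimes>\<^sub>M past n)"
    by (intro measurable_Pair measurable_compose[OF measurable_snd id_measurable_M_past])
      (auto intro: measurable_compose[OF measurable_fst])
  from measurable_compose[OF this F_measurable_past_pair[of n n]] show ?thesis by simp
qed

lemma mass_measurable [measurable]: "mass n \<in> borel_measurable M"
proof -
  interpret U: sigma_finite_measure unit_interval by (rule sigma_finite_unit_interval)
  have "(\<lambda>y. (snd y, fst y)) \<in> measurable (M \<Otimes>\<^sub>M unit_interval) (unit_interval \<Otimes>\<^sub>M M)" by measurable
  note [measurable] = measurable_compose[OF this F_measurable_pair_M[of n], simplified]
  have "(\<lambda>(x, h). (norm (F n h x))^2) \<in> borel_measurable (M \<Otimes>\<^sub>M unit_interval)"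
    unfolding case_prod_beta' by measurable
  then have "(\<lambda>x. LINT h|unit_interval. (norm (F n h x))^2) \<in> borel_measurable M"
    by (rule U.borel_measurable_lebesgue_integral)
  then show ?thesis unfolding mass_def[abs_def] by measurable
qed

lemma mass_nonneg: "mass n x \<ge> 0"
  unfolding mass_def using W_pos[of n] by (intro divide_nonneg_nonneg integral_nonneg_AE) auto

lemma expectation_mass_mult:
  assumes c: "c \<in> borel_measurable M" "\<And>x. 0 \<le> c x \<and> c x \<le> (1::real)"
  shows "integrable M (\<lambda>x. mass n x * c x)"
    and "(LINT x|M. mass n x * c x) = (LINT h|unit_interval. (LINT x|M. (norm (F n h x))^2 * c x) / W n)"
    and "integrable unit_interval (\<lambda>h. (LINT x|M. (norm (F n h x))^2 * c x) / W n)"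
proof -
  interpret U: prob_space unit_interval by (rule prob_space_unit_interval)
  interpret P: pair_prob_space unit_interval M ..
  note F_measurable_pair_M[of n, measurable] c(1) [measurable]
  have meas: "(\<lambda>y. (norm (F n (fst y) (snd y)))^2 * c (snd y)) \<in> borel_measurable (unit_interval \<Otimes>\<^sub>M M)" by measurable
  have int: "integrable (unit_interval \<Otimes>\<^sub>M M) (\<lambda>y. (norm (F n (fst y) (snd y)))^2 * c (snd y))"
  proof (rule P.P.integrable_const_bound[where B = "(4 ^ Suc n)^2 * 1"])
    have "norm ((norm (F n h x))^2 * c x) \<le> (4 ^ Suc n)^2 * 1" for h x
      unfolding norm_mult using norm_F_square_le[of n h x] c(2)[of x] by (intro mult_mono) auto
    then show "AE y in unit_interval \<Otimes>\<^sub>M M. norm ((norm (F n (fst y) (snd y)))^2 * c (snd y)) \<le> (4 ^ Suc n)^2 * 1" by simp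
  qed (rule meas)
  have eq: "(LINT h|unit_interval. (norm (F n h x))^2 * c x) / W n = mass n x * c x" for x
    by (simp add: mass_def)
  have int': "integrable (unit_interval \<Otimes>\<^sub>M M) (\<lambda>(h, x). (norm (F n h x))^2 * c x)"
    using int by (simp add: case_prod_beta')
  show "integrable M (\<lambda>x. mass n x * c x)"
    using P.integrable_snd[OF int'] unfolding eq[symmetric] by simp
  show "(LINT x|M. mass n x * c x) = (LINT h|unit_interval. (LINT x|M. (norm (F n h x))^2 * c x) / W n)"
    unfolding eq[symmetric] using P.Fubini_integral[OF int'] by simp
  show "integrable unit_interval (\<lambda>h. (LINT x|M. (norm (F n h x))^2 * c x) / W n)"
    using P.integrable_fst[OF int'] by simp
qed

lemma expectation_mass: "(LINT x|M. mass n x) = 1" and integrable_mass: "integrable M (mass n)"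
proof -
  interpret U: prob_space unit_interval by (rule prob_space_unit_interval)
  show "integrable M (mass n)" using expectation_mass_mult(1)[of "\<lambda>_. 1" n] by simp
  show "(LINT x|M. mass n x) = 1"
    using expectation_mass_mult(2)[of "\<lambda>_. 1" n] W_pos[of n] U.prob_space
    by (simp add: expectation_norm_F_square)
qed

lemma integrable_mass_powr:
  assumes "0 \<le> q" "q \<le> 1"
  shows "integrable M (\<lambda>x. mass n x powr q)"
proof (rule Bochner_Integration.integrable_bound[of _ "\<lambda>x. 1 + mass n x"])
  have "mass n x powr q \<le> 1 + mass n x" for x
  proof -
    have "mass n x powr q \<le> (1 + mass n x) powr q" using mass_nonneg[of n x] assms by (intro powr_mono2) auto
    also have "\<dots> \<le> (1 + mass n x) powr 1" using mass_nonneg[of n x] assms by (intro powr_mono) auto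
    finally show ?thesis using mass_nonneg[of n x] by simp
  qed
  then show "AE x in M. norm (mass n x powr q) \<le> norm (1 + mass n x)"
    using mass_nonneg[of n] by (auto intro!: AE_I2 order_trans[OF _ abs_ge_self])
qed (use integrable_mass in auto)

text \<open>On the safe event the Sobolev bound keeps the paths of all \<open>h \<in> {0..1}\<close>
  below the barrier at once, so Fubini reduces the claim to \<open>survival_le\<close> for each
  single \<open>h\<close>.\<close>

lemma expectation_mass_safe_le:
  assumes A: "A \<ge> 0"
  shows "(LINT x|M. mass n x * safe (\<lambda>k. (exp A * W k * u k)^2) n x) \<le> 200000 * (A + 3) / sqrt (u n)"
proof -
  interpret U: prob_space unit_interval by (rule prob_space_unit_interval)
  define b where "b k = exp A * W k * u k" for k
  define s where "s = safe (\<lambda>k. (b k)^2) n"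
  have bpos: "b k > 0" for k using W_pos[of k] u_ge_1[of k] by (simp add: b_def)
  have s: "s \<in> borel_measurable M" "\<And>x. 0 \<le> s x \<and> s x \<le> 1"
    unfolding s_def using safe_bounds by auto
  have sb: "s x \<le> below b n h x" if "h \<in> {0..1}" for h x
  proof -
    have "norm (F k h x) \<le> b k" if "Q k x \<le> (b k)^2" for k
    proof (rule power2_le_imp_le)
      show "(norm (F k h x))^2 \<le> (b k)^2"
        using norm_F_square_le_Q[OF \<open>h \<in> {0..1}\<close>, of k x] that by simp
    qed (use bpos[of k] in simp)
    then show ?thesis by (auto simp: s_def safe_def below_def)
  qed
  have "(LINT x|M. mass n x * s x) = (LINT h|unit_interval. (LINT x|M. (norm (F n h x))^2 * s x) / W n)"
    by (rule expectation_mass_mult(2)[OF s])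
  also have "\<dots> \<le> (LINT h|unit_interval. 200000 * (A + 3) / sqrt (u n))"
  proof (rule integral_mono[OF expectation_mass_mult(3)[OF s]])
    fix h assume "h \<in> space unit_interval"
    then have h: "h \<in> {0..1}" by simp
    have "(LINT x|M. (norm (F n h x))^2 * s x) / W n \<le> survival b n h"
      unfolding survival_def
    proof (intro divide_right_mono integral_mono mult_left_mono sb h)
      show "integrable M (\<lambda>x. (norm (F n h x))^2 * s x)"
      proof (rule integrable_bounded)
        show "norm ((norm (F n h x))^2 * s x) \<le> (4 ^ Suc n)^2 * 1" for x
          unfolding norm_mult using norm_F_square_le[of n h x] s(2)[of x] by (intro mult_mono) auto
      qed (use s(1) in measurable)
      show "integrable M (\<lambda>x. (norm (F n h x))^2 * below b n h x)"
        using integrable_F_powr_below[of 2 n h b n] by simp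
    qed (use W_pos[of n] in auto)
    also have "\<dots> \<le> 200000 * (A + 3) / sqrt (u n)"
      using survival_le[OF A, of n h] by (simp add: b_def[abs_def])
    finally show "(LINT x|M. (norm (F n h x))^2 * s x) / W n \<le> 200000 * (A + 3) / sqrt (u n)" .
  qed simp
  finally show ?thesis using U.prob_space by (simp add: s_def b_def)
qed

lemma mass_moment_root_le:
  assumes C1: "\<And>n. (\<Sum>j\<le>n. t j * (r j)^2) \<le> C * W n"
    and C2: "\<And>n. (\<Sum>j\<le>n. (t j)^2 * (r j)^2) \<le> (C * W n)^2"
    and q: "1/2 \<le> q" "q < 1"
  shows "(LINT x|M. mass n x powr q) powr (1/q) * (1 - q) * sqrt (u n) \<le> 2 * chaos_constant C"
proof -
  define e where "e q = (LINT x|M. mass n x powr q)" for q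
  define z where "z q = e q powr (1/q) * (1 - q) * sqrt (u n)" for q
  define D where "D = 3 * (2 + 20 * C^2)"
  define \<kappa> where "\<kappa> = ln (16 * D)"
  have D: "D \<ge> 6" by (simp add: D_def)
  have \<kappa>: "\<kappa> \<ge> 0" "exp \<kappa> = 16 * D" using D by (auto simp: \<kappa>_def)
  have su: "sqrt (u n) > 0" using u_ge_1[of n] by simp
  have e0: "e q \<ge> 0" for q unfolding e_def by (intro integral_nonneg_AE) auto
  have e1: "e q \<le> 1" if "0 < q" "q \<le> 1" for q
    using expectation_powr_interpolation[OF integrable_mass mass_nonneg, of "\<lambda>_. 1" q n] that
    by (simp add: e_def expectation_mass prob_space)
  have rec: "z q \<le> chaos_constant C + z ((1 + q) / 2) / 2" if q: "1/2 \<le> q" "q < 1" for q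
  proof -
    define q' where "q' = (1 + q) / 2"
    have q': "q < q'" "q' < 1" "0 < q'" using q by (auto simp: q'_def)
    \<comment> \<open>The exponent of the exceptional event in Hoelder's inequality is only of order
      \<open>1 - q\<close>; this \<open>A\<close> compensates, as \<open>exp (- (2 * A)) powr ((1 -
      q) / 2) = exp (- \<kappa>) = 1 / (16 * D)\<close>.\<close>
    define A where "A = \<kappa> / (1 - q)"
    have A: "A \<ge> \<kappa>" "A \<ge> 0" using \<kappa>(1) q by (auto simp: A_def field_simps)
    define s where "s = safe (\<lambda>k. (exp A * W k * u k)^2) n"
    have s01: "s x \<in> {0, 1}" for x by (auto simp: s_def safe_def)
    have sm [measurable]: "s \<in> borel_measurable M" by (simp add: s_def)
    have isf: "integrable M s" using s01 by (intro integrable_bounded[where B = 1]) (auto, metis abs_one abs_zero insert_iff order_refl singletonD zero_le_one)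
    define S where "S = 200000 * (A + 3) / sqrt (u n)"
    define P where "P = (LINT x|M. 1 - s x)"
    have good: "(LINT x|M. mass n x powr q * s x) \<le> S powr q"
    proof -
      have eq: "mass n x powr q * s x = (mass n x * s x) powr q * 1" for x
        using s01[of x] by auto
      have "(LINT x|M. (mass n x * s x) powr q * 1) \<le> (LINT x|M. mass n x * s x) powr q * (LINT x|M. 1) powr (1 - q)"
      proof (rule expectation_powr_interpolation)
        show "integrable M (\<lambda>x. mass n x * s x)"
          using s01 by (intro expectation_mass_mult) (auto, (metis insert_iff order_refl singletonD zero_le_one)+)
        show "0 \<le> mass n x * s x" for x using s01[of x] mass_nonneg[of n x] by auto
      qed (use q in auto)
      also have "\<dots> = (LINT x|M. mass n x * s x) powr q" by (simp add: prob_space)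
      also have "\<dots> \<le> S powr q"
      proof (intro powr_mono2)
        have "0 \<le> mass n x * s x" for x using s01[of x] mass_nonneg[of n x] by auto
        then show "0 \<le> (LINT x|M. mass n x * s x)" by (intro integral_nonneg_AE) auto
        show "(LINT x|M. mass n x * s x) \<le> S"
          unfolding s_def S_def by (rule expectation_mass_safe_le[OF A(2)])
      qed (use q in auto)
      finally show ?thesis unfolding eq .
    qed
    have bad: "(LINT x|M. mass n x powr q * (1 - s x)) \<le> e q' powr (q / q') * P powr (1 - q / q')"
    proof -
      have "(LINT x|M. (mass n x powr q') powr (q / q') * (1 - s x)) \<le> e q' powr (q / q') * P powr (1 - q / q')"
        unfolding e_def P_def
      proof (rule expectation_powr_interpolation)
        show "1 - s x \<in> {0, 1}" for x using s01[of x] by auto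
      qed (use q q' integrable_mass_powr[of q' n] in auto)
      then show ?thesis using q' by (simp add: powr_powr)
    qed
    have P: "0 \<le> P" "P \<le> D * exp (- (2 * A))"
    proof -
      have "0 \<le> 1 - s x" for x using s01[of x] by auto
      then show "0 \<le> P" unfolding P_def by (intro integral_nonneg_AE) auto
      have "P = 1 - (LINT x|M. s x)" unfolding P_def using isf by (simp add: prob_space)
      then show "P \<le> D * exp (- (2 * A))"
        using expectation_unsafe_exp_le[OF C1 C2, of A n] by (simp add: s_def D_def)
    qed
    have DA: "D * exp (- (2 * A)) \<le> 1"
    proof -
      have "exp (- (2 * A)) \<le> exp (- \<kappa>)" using A by simp
      also have "\<dots> = 1 / (16 * D)" by (simp only: exp_minus \<kappa>(2) inverse_eq_divide)
      finally have "D * exp (- (2 * A)) \<le> D * (1 / (16 * D))" using D by (intro mult_left_mono) auto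
      then show ?thesis using D by simp
    qed
    have Pe: "P powr ((1 - q / q') / q) \<le> 1 / 16"
    proof -
      have ex: "(1 - q) / 2 \<le> (1 - q / q') / q"
      proof -
        have "1 - q / q' = (q' - q) / q'" using q' by (simp add: diff_divide_distrib)
        also have "q' - q = (1 - q) / 2" by (simp add: q'_def field_simps)
        finally have "(1 - q / q') / q = (1 - q) / 2 / (q * q')" by (simp add: mult.commute)
        moreover have "q * q' \<le> 1 * 1" using q q' by (intro mult_mono) auto
        then have "(1 - q) / 2 / 1 \<le> (1 - q) / 2 / (q * q')" using q q' by (intro divide_left_mono) auto
        ultimately show ?thesis by simp
      qed
      have "P powr ((1 - q / q') / q) \<le> (D * exp (- (2 * A))) powr ((1 - q / q') / q)"
        using P order_trans[OF _ ex] q by (intro powr_mono2) auto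
      also have "\<dots> \<le> (D * exp (- (2 * A))) powr ((1 - q) / 2)"
        using DA D ex by (intro powr_mono') auto
      also have "\<dots> = D powr ((1 - q) / 2) * exp (- (2 * A)) powr ((1 - q) / 2)"
        using D by (simp add: powr_mult)
      also have "exp (- (2 * A)) powr ((1 - q) / 2) = exp (- \<kappa>)"
        using q by (simp add: powr_def A_def)
      also have "D powr ((1 - q) / 2) \<le> D powr 1" using D q by (intro powr_mono) auto
      also have "D powr 1 * exp (- \<kappa>) = 1 / 16" using \<kappa> D by (simp add: exp_minus)
      finally show ?thesis by simp
    qed
    have S0: "S \<ge> 0" using A su by (simp add: S_def)
    have "e q = (LINT x|M. mass n x powr q * s x) + (LINT x|M. mass n x powr q * (1 - s x))"
    proof -
      have i: "integrable M (\<lambda>x. mass n x powr q * c x)" if [measurable]: "c \<in> borel_measurable M" and "\<And>x. c x \<in> {0, 1}" for c :: "'a \<Rightarrow> real"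
      proof (rule Bochner_Integration.integrable_bound[OF integrable_mass_powr[of q n]])
        show "AE x in M. norm (mass n x powr q * c x) \<le> norm (mass n x powr q)"
        proof (rule AE_I2)
          fix x show "norm (mass n x powr q * c x) \<le> norm (mass n x powr q)" using that(2)[of x] by auto
        qed
      qed (use q in auto)
      have "e q = (LINT x|M. mass n x powr q * s x + mass n x powr q * (1 - s x))"
        by (simp add: e_def algebra_simps)
      also have "\<dots> = (LINT x|M. mass n x powr q * s x) + (LINT x|M. mass n x powr q * (1 - s x))"
      proof (intro Bochner_Integration.integral_add i)
        show "1 - s x \<in> {0, 1}" for x using s01[of x] by auto
      qed (use s01 in auto)
      finally show ?thesis .
    qed
    also have "\<dots> \<le> S powr q + e q' powr (q / q') * P powr (1 - q / q')" by (intro add_mono good bad)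
    finally have "e q powr (1/q) \<le> (S powr q + e q' powr (q / q') * P powr (1 - q / q')) powr (1/q)"
      using e0 q by (intro powr_mono2) auto
    also have "\<dots> \<le> 4 * ((S powr q) powr (1/q) + (e q' powr (q / q') * P powr (1 - q / q')) powr (1/q))"
      using q by (intro powr_sum_inverse_le) auto
    also have "(S powr q) powr (1/q) = S" using S0 q by (simp add: powr_powr)
    also have "(e q' powr (q / q') * P powr (1 - q / q')) powr (1/q) = e q' powr (1/q') * P powr ((1 - q / q') / q)"
      using q q' by (simp add: powr_mult powr_powr)
    also have "\<dots> \<le> e q' powr (1/q') * (1/16)" by (intro mult_left_mono Pe) auto
    \<comment> \<open>The \<open>4\<close> of \<open>powr_sum_inverse_le\<close> times
      \<open>1/16\<close> is \<open>1/4\<close>; since \<open>1 - q = 2 * (1 - q')\<close>, this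
      becomes the contraction factor \<open>1/2\<close> for \<open>z\<close>.\<close>
    finally have "e q powr (1/q) \<le> 4 * S + e q' powr (1/q') / 4" by simp
    then have "e q powr (1/q) * ((1 - q) * sqrt (u n)) \<le> (4 * S + e q' powr (1/q') / 4) * ((1 - q) * sqrt (u n))"
      using q su by (intro mult_right_mono) auto
    also have "\<dots> = 4 * (S * ((1 - q) * sqrt (u n))) + z q' / 2"
      by (simp add: z_def q'_def field_simps)
    also have "S * ((1 - q) * sqrt (u n)) = 200000 * (\<kappa> + 3 * (1 - q))"
      using su q by (simp add: S_def A_def field_simps)
    also have "4 * (200000 * (\<kappa> + 3 * (1 - q))) \<le> chaos_constant C"
      using q by (simp add: chaos_constant_def \<kappa>_def D_def)
    finally show ?thesis by (simp add: z_def q'_def mult.assoc)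
  qed
  have bd: "z q \<le> sqrt (u n)" if q: "1/2 \<le> q" "q < 1" for q
  proof -
    have "e q powr (1/q) \<le> 1" using e0[of q] e1[of q] q by (intro powr_le1) auto
    then have "e q powr (1/q) * (1 - q) \<le> 1 * 1" using q by (intro mult_mono) auto
    then have "e q powr (1/q) * (1 - q) * sqrt (u n) \<le> 1 * 1 * sqrt (u n)" using su by (intro mult_right_mono) auto
    then show ?thesis by (simp add: z_def)
  qed
  from halving_recursion_bound[of z "chaos_constant C" "sqrt (u n)" q, OF rec bd] q
  show ?thesis by (simp add: z_def e_def)
qed

lemma mass_moment_le:
  assumes C1: "\<And>n. (\<Sum>j\<le>n. t j * (r j)^2) \<le> C * W n"
    and C2: "\<And>n. (\<Sum>j\<le>n. (t j)^2 * (r j)^2) \<le> (C * W n)^2"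
    and q: "0 \<le> q" "q \<le> 1"
  shows "(LINT x|M. mass n x powr q) \<le> 2 * (2 * chaos_constant C + 1) * (sqrt (u n) * (1 - q) + 1) powr (-q)"
proof -
  define e where "e q = (LINT x|M. mass n x powr q)" for q
  define K where "K = 2 * chaos_constant C + 1"
  have "ln (16 * (3 * (2 + 20 * C^2))) \<ge> 0" by simp
  then have K: "K \<ge> 1" by (simp add: K_def chaos_constant_def)
  have su: "sqrt (u n) > 0" using u_ge_1[of n] by simp
  have e0: "e q \<ge> 0" for q unfolding e_def by (intro integral_nonneg_AE) auto
  have interp: "(LINT x|M. Y x powr a) \<le> (LINT x|M. Y x) powr a"
    if "integrable M Y" "\<And>x. 0 \<le> Y x" "0 < a" "a \<le> 1" for Y :: "'a \<Rightarrow> real" and a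
    using expectation_powr_interpolation[OF that(1,2), of "\<lambda>_. 1" a] that by (simp add: prob_space)
  have e1: "e q \<le> 1" if "0 < q" "q \<le> 1" for q
    using interp[OF integrable_mass mass_nonneg that] by (simp add: e_def expectation_mass)
  have big: "e q \<le> K powr q * (sqrt (u n) * (1 - q) + 1) powr (-q)" if q: "1/2 \<le> q" "q \<le> 1" for q
  proof -
    define s where "s = sqrt (u n) * (1 - q)"
    have s0: "s \<ge> 0" using su q by (simp add: s_def)
    define y where "y = e q powr (1/q)"
    have y: "y \<le> 1" "0 \<le> y" using e0[of q] e1[of q] q by (auto simp: y_def intro!: powr_le1)
    have "y * s \<le> 2 * chaos_constant C"
    proof (cases "q = 1")
      case True
      then show ?thesis using K by (simp add: s_def K_def)
    next
      case False
      then show ?thesis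
        using mass_moment_root_le[OF C1 C2, of q n] q by (simp add: y_def s_def e_def mult_ac)
    qed
    \<comment> \<open>Adding \<open>y \<le> 1\<close> covers small \<open>s\<close>; it accounts for
      the \<open>+ 1\<close> in \<open>K\<close>.\<close>
    then have "y * (s + 1) \<le> K" using y by (simp add: K_def algebra_simps)
    then have "y \<le> K / (s + 1)" using s0 by (simp add: field_simps)
    then have "y powr q \<le> (K / (s + 1)) powr q" using y q by (intro powr_mono2) auto
    moreover have "y powr q = e q" using e0[of q] q by (simp add: y_def powr_powr)
    moreover have "(K / (s + 1)) powr q = K powr q * (s + 1) powr (-q)"
      using s0 K by (simp add: powr_divide powr_minus_divide)
    ultimately show ?thesis by (simp add: s_def)
  qed
  have Kq: "K powr q \<le> K" if "q \<le> 1" for q using powr_mono[OF that, of K] K by simp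
  show ?thesis
  proof (cases "q \<ge> 1/2")
    case True
    have "e q \<le> K powr q * (sqrt (u n) * (1 - q) + 1) powr (-q)" by (rule big[OF True q(2)])
    also have "\<dots> \<le> (2 * K) * (sqrt (u n) * (1 - q) + 1) powr (-q)"
      using Kq[OF q(2)] K by (intro mult_right_mono) auto
    finally show ?thesis by (simp add: e_def K_def)
  next
    case False
    show ?thesis
    proof (cases "q = 0")
      case True
      \<comment> \<open>Only an inequality, because \<open>0 powr 0 = 0\<close> where the mass
        vanishes.\<close>
      have "e 0 \<le> (LINT x|M. 1)"
        unfolding e_def
        by (intro integral_mono integrable_bounded[where B = 1]) auto
      moreover have "sqrt (u n) + 1 \<noteq> 0" using su by linarith
      ultimately show ?thesis using True K by (simp add: e_def K_def prob_space)
    next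
      case nz: False
      then have q0: "0 < q" "q < 1/2" using q False by auto
      define v where "v = sqrt (u n) * (1 - q) + 1"
      have v: "v \<ge> 1" using su q0 by (simp add: v_def)
      \<comment> \<open>Jensen's inequality reduces \<open>q < 1/2\<close> to the exponent
        \<open>1/2\<close>. Replacing \<open>1 - q\<close> by \<open>1/2\<close> at most halves
        \<open>v\<close>, which explains the factor \<open>2\<close> in the final constant.\<close>
      have vh: "v / 2 \<le> sqrt (u n) * (1 - 1/2) + 1"
      proof -
        have "sqrt (u n) * (1 - q) \<le> sqrt (u n) * 1" using su q0 by (intro mult_left_mono) auto
        then show ?thesis by (simp add: v_def)
      qed
      have "e q = (LINT x|M. (mass n x powr (1/2)) powr (2 * q))"
        by (simp add: e_def powr_powr)
      also have "\<dots> \<le> e (1/2) powr (2 * q)"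
        unfolding e_def
      proof (rule interp)
        show "integrable M (\<lambda>x. mass n x powr (1/2))" by (rule integrable_mass_powr) auto
      qed (use q0 in auto)
      also have "\<dots> \<le> (K powr (1/2) * (v / 2) powr (-(1/2))) powr (2 * q)"
      proof (intro powr_mono2)
        have "e (1/2) \<le> K powr (1/2) * (sqrt (u n) * (1 - 1/2) + 1) powr (-(1/2))"
          by (rule big) auto
        also have "\<dots> \<le> K powr (1/2) * (v / 2) powr (-(1/2))"
          using vh v by (intro mult_left_mono powr_mono2') auto
        finally show "e (1/2) \<le> K powr (1/2) * (v / 2) powr (-(1/2))" .
      qed (use q0 e0 in auto)
      also have "\<dots> = K powr q * (2 powr q * v powr (-q))"
        using v K by (simp add: powr_mult powr_powr powr_divide powr_minus_divide)
      also have "\<dots> \<le> K * (2 powr 1 * v powr (-q))"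
        using Kq[of q] q0 K by (intro mult_mono mult_right_mono powr_mono) auto
      finally show ?thesis by (simp add: e_def K_def v_def algebra_simps)
    qed
  qed
qed

end

section \<open>The Steinhaus Euler product\<close>

lemma measurable_cis [measurable]: "cis \<in> borel_measurable borel"
  by (intro borel_measurable_continuous_onI continuous_intros)

lemma uniform_circle_moment:
  assumes "m > 0"
  shows "(\<integral>z. z ^ m \<partial>uniform_circle) = 0"
proof -
  have cont: "continuous_on {0..2 * pi} (\<lambda>x. cis (real m * x))"
    by (intro continuous_intros)
  have "(\<integral>z. z ^ m \<partial>uniform_circle) = (\<integral>x. cis x ^ m \<partial>uniform_measure lborel {0..2 * pi})"
    unfolding uniform_circle_def by (subst integral_distr) auto
  also have "\<dots> = (\<integral>x. cis (real m * x) \<partial>uniform_measure lborel {0..2 * pi})"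
    by (simp only: Complex.DeMoivre)
  also have "\<dots> = (\<integral>x. indicator {0..2 * pi} x *\<^sub>R cis (real m * x) \<partial>lborel) /\<^sub>R (2 * pi)"
  proof -
    have dens: "indicator {0..2 * pi} x / emeasure lborel {0..2 * pi} = ennreal (indicator {0..2 * pi} x / (2 * pi))" for x
      by (cases "x \<in> {0..2 * pi}") (simp_all add: ennreal_1[symmetric] divide_ennreal del: ennreal_1)
    have "(\<integral>x. cis (real m * x) \<partial>uniform_measure lborel {0..2 * pi})
      = (\<integral>x. (indicator {0..2 * pi} x / (2 * pi)) *\<^sub>R cis (real m * x) \<partial>lborel)"
      unfolding uniform_measure_def dens by (rule integral_density) auto
    also have "\<dots> = (\<integral>x. inverse (2 * pi) *\<^sub>R (indicator {0..2 * pi} x *\<^sub>R cis (real m * x)) \<partial>lborel)"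
      by (intro Bochner_Integration.integral_cong refl) (simp only: scaleR_scaleR divide_inverse mult.commute)
    finally show ?thesis by (simp only: integral_scaleR_right)
  qed
  also have "(\<integral>x. indicator {0..2 * pi} x *\<^sub>R cis (real m * x) \<partial>lborel) = integral {0..2 * pi} (\<lambda>x. cis (real m * x))"
    using set_borel_integral_eq_integral(2)[OF borel_integrable_atLeastAtMost'[OF cont]]
    by (simp add: set_lebesgue_integral_def)
  also have "\<dots> = 0"
  proof -
    define G where "G x = cis (real m * x) / (\<i> * m)" for x
    have "((\<lambda>x. cis (real m * x)) has_integral G (2 * pi) - G 0) {0..2 * pi}"
    proof (rule fundamental_theorem_of_calculus)
      fix x :: real
      have "((\<lambda>z. exp (\<i> * (m * z)) / (\<i> * m)) has_field_derivative exp (\<i> * (m * of_real x))) (at (of_real x))"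
        using assms by (auto intro!: derivative_eq_intros simp: mult.commute[of "exp _" \<i>])
      from has_vector_derivative_real_field[OF this]
      show "(G has_vector_derivative cis (real m * x)) (at x within {0..2 * pi})"
        by (simp add: G_def[abs_def] cis_conv_exp)
    qed simp
    moreover have "cis (real m * (2 * pi)) = 1"
      using cis_multiple_2pi[of "real m"] by (simp add: mult_ac)
    ultimately show ?thesis by (simp add: G_def integral_unique)
  qed
  finally show ?thesis by simp
qed

lemma AE_uniform_circle: "AE z in uniform_circle. norm z = 1"
  unfolding uniform_circle_def by (subst AE_distr_iff) auto

context steinhaus
begin

text \<open>\<open>Z p\<close> has modulus \<open>1\<close> only almost surely, while
  \<open>circle_chaos\<close> asks for it everywhere; this changes \<open>Z p\<close> on a null
  set.\<close>

definition circle_part :: "nat \<Rightarrow> 'a \<Rightarrow> complex" where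
  "circle_part p \<omega> = (if norm (Z p \<omega>) = 1 then Z p \<omega> else 1)"

lemma Z_measurable: "prime p \<Longrightarrow> Z p \<in> borel_measurable M"
  using indep unfolding indep_vars_def by auto

lemma AE_norm_Z: "prime p \<Longrightarrow> AE \<omega> in M. norm (Z p \<omega>) = 1"
proof -
  assume p: "prime p"
  have "AE z in distr M borel (Z p). norm z = 1"
    unfolding uniform[OF p] by (rule AE_uniform_circle)
  then show ?thesis using Z_measurable[OF p] by (subst (asm) AE_distr_iff) auto
qed

lemma circle_part_chaos:
  "circle_chaos M circle_part {p. prime p} (\<lambda>p. if prime p then 1 / sqrt (real p) else 0) (\<lambda>p. if prime p then ln (real p) else 0)"
proof
  have "indep_vars (\<lambda>_. borel) (\<lambda>p \<omega>. (\<lambda>z. if norm z = 1 then z else 1) (Z p \<omega>)) {p. prime p}"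
    by (rule indep_vars_compose2[OF indep]) measurable
  then show "indep_vars (\<lambda>_. borel) circle_part {p. prime p}"
    by (simp add: circle_part_def[abs_def])
  show "norm (circle_part p \<omega>) = 1" for p \<omega> by (simp add: circle_part_def)
  show "(\<integral>\<omega>. circle_part p \<omega> ^ m \<partial>M) = 0" if "p \<in> {p. prime p}" "m > 0" for p m
  proof -
    have p: "prime p" using that by simp
    note Z_measurable[OF p, measurable]
    have "(\<integral>\<omega>. circle_part p \<omega> ^ m \<partial>M) = (\<integral>\<omega>. Z p \<omega> ^ m \<partial>M)"
      unfolding circle_part_def
      using AE_norm_Z[OF p] by (intro integral_cong_AE) auto
    also have "\<dots> = (\<integral>z. z ^ m \<partial>distr M borel (Z p))" by (subst integral_distr) auto
    also have "\<dots> = 0" unfolding uniform[OF p] by (rule uniform_circle_moment[OF that(2)])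
    finally show ?thesis .
  qed
  show "((if prime p then 1 / sqrt (real p) else 0)\<^sup>2 :: real) \<le> 1 / 2" for p
    using prime_ge_2_nat[of p] by (auto simp: power_divide divide_simps)
  show "0 \<le> (if prime p then ln (real p) else 0)" for p
    using prime_ge_1_nat[of p] by auto
qed auto

end

sublocale steinhaus \<subseteq> chaos: circle_chaos M circle_part "{p. prime p}"
  "\<lambda>p. if prime p then 1 / sqrt (real p) else 0" "\<lambda>p. if prime p then ln (real p) else 0"
  by (rule circle_part_chaos)

context steinhaus
begin

lemma chaos_W: "chaos.W n = mertens_product n"
proof -
  have "chaos.W n = (\<Prod>p\<in>{..n}. if prime p then 1 / (1 - 1 / real p) else 1)"
    unfolding chaos.W_def chaos.w_def by (intro prod.cong) (auto simp: power_divide)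
  also have "\<dots> = (\<Prod>p | prime p \<and> p \<le> n. 1 / (1 - 1 / real p))"
    by (intro prod.mono_neutral_cong_right) auto
  finally show ?thesis by (simp add: mertens_product_def)
qed

lemma sum_primes_eq:
  fixes g :: "nat \<Rightarrow> real"
  assumes "\<And>p. \<not> prime p \<Longrightarrow> g p = 0"
  shows "(\<Sum>p\<le>n. g p) = (\<Sum>p | prime p \<and> p \<le> n. g p)"
  using assms by (intro sum.mono_neutral_right) auto

text \<open>The sum is that of \<open>ln p / p\<close> over primes; the lower Mertens bound replaces
  \<open>ln n\<close> by \<open>chaos.W n\<close>, which fixes \<open>C = 2\<close>.\<close>

lemma chaos_frequency_sum_le:
  "(\<Sum>p\<le>n. (if prime p then ln (real p) else 0) * (if prime p then 1 / sqrt (real p) else 0)\<^sup>2) \<le> 2 * chaos.W n"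
proof (cases "n = 0")
  case False
  have "(\<Sum>p\<le>n. (if prime p then ln (real p) else 0) * (if prime p then 1 / sqrt (real p) else 0)\<^sup>2)
    = (\<Sum>p | prime p \<and> p \<le> n. ln (real p) / real p)"
    by (subst sum_primes_eq) (auto intro!: sum.cong simp: power_divide)
  also have "\<dots> \<le> 2 * ln (real n)" using False by (intro sum_ln_prime_div_prime_le) simp
  also have "\<dots> \<le> 2 * ln (real n + 1)" using False by simp
  finally show ?thesis using ln_le_mertens_product[of n] by (simp add: chaos_W)
qed (use chaos.W_pos[of 0] in auto)

lemma chaos_square_frequency_sum_le:
  "(\<Sum>p\<le>n. (if prime p then ln (real p) else 0)\<^sup>2 * (if prime p then 1 / sqrt (real p) else 0)\<^sup>2) \<le> (2 * chaos.W n)\<^sup>2"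
proof (cases "n = 0")
  case False
  have l: "0 \<le> ln (real n)" "ln (real n) \<le> chaos.W n"
  proof -
    have "ln (real n) \<le> ln (real n + 1)" using False by simp
    then show "ln (real n) \<le> chaos.W n" using ln_le_mertens_product[of n] by (simp add: chaos_W)
  qed (use False in auto)
  have "(\<Sum>p\<le>n. (if prime p then ln (real p) else 0)\<^sup>2 * (if prime p then 1 / sqrt (real p) else 0)\<^sup>2)
    = (\<Sum>p | prime p \<and> p \<le> n. ln (real p) * (ln (real p) / real p))"
    by (subst sum_primes_eq) (auto intro!: sum.cong simp: power_divide power2_eq_square)
  also have "\<dots> \<le> (\<Sum>p | prime p \<and> p \<le> n. ln (real n) * (ln (real p) / real p))"
  proof (intro sum_mono mult_right_mono)
    fix p assume p: "p \<in> {p. prime p \<and> p \<le> n}"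
    then have "p \<ge> 1" using prime_ge_1_nat by auto
    then show "ln (real p) \<le> ln (real n)" "0 \<le> ln (real p) / real p" using p by auto
  qed
  also have "\<dots> = ln (real n) * (\<Sum>p | prime p \<and> p \<le> n. ln (real p) / real p)"
    by (simp add: sum_distrib_left)
  also have "\<dots> \<le> ln (real n) * (2 * ln (real n))"
    using False l by (intro mult_left_mono sum_ln_prime_div_prime_le) auto
  also have "\<dots> \<le> chaos.W n * (2 * chaos.W n)" using l by (intro mult_mono) auto
  also have "\<dots> \<le> (2 * chaos.W n)\<^sup>2" by (simp add: power2_eq_square)
  finally show ?thesis .
qed simp

lemma euler_product_eq:
  assumes "\<omega> \<in> space M" "\<And>p. prime p \<Longrightarrow> norm (Z p \<omega>) = 1" "x \<ge> 0"
  shows "euler_product (\<lambda>n. f n \<omega>) x (1 / 2 + \<i> * of_real h) = chaos.F (nat \<lfloor>x\<rfloor>) h \<omega>"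
proof -
  have set: "{p. prime p \<and> real p \<le> x} = {p. prime p \<and> p \<le> nat \<lfloor>x\<rfloor>}"
    using assms(3) by (auto simp: le_nat_iff le_floor_iff)
  have fac: "inverse (1 - f p \<omega> * of_nat p powr (- (1 / 2 + \<i> * of_real h))) = chaos.fac p h \<omega>" if p: "prime p" for p
  proof -
    have p0: "real p > 0" using p by (simp add: prime_gt_0_nat)
    have "of_nat p powr (- (1 / 2 + \<i> * of_real h)) = exp (- (1 / 2 + \<i> * of_real h) * of_real (ln (real p)))"
      using p0 by (simp add: powr_def Ln_of_nat)
    also have "- (1 / 2 + \<i> * of_real h) * of_real (ln (real p)) = of_real (- (ln (real p) / 2)) + \<i> * of_real (-(ln (real p) * h))"
      by (simp add: algebra_simps)
    also have "exp \<dots> = exp (of_real (- (ln (real p) / 2))) * cis (-(ln (real p) * h))"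
      by (simp only: cis_conv_exp exp_add)
    also have "exp (of_real (- (ln (real p) / 2))) = complex_of_real (exp (- (ln (real p) / 2)))"
      by (rule exp_of_real)
    also have "exp (- (ln (real p) / 2)) = 1 / sqrt (real p)"
    proof -
      have "ln (real p) / 2 = ln (sqrt (real p))" using p0 by (simp add: ln_sqrt)
      then show ?thesis using p0 by (simp add: exp_minus inverse_eq_divide)
    qed
    finally show ?thesis
      using p assms(1,2) by (simp add: chaos.fac_def chaos.X'_def circle_part_def at_prime inverse_eq_divide mult_ac)
  qed
  have "euler_product (\<lambda>n. f n \<omega>) x (1 / 2 + \<i> * of_real h) = (\<Prod>p | prime p \<and> p \<le> nat \<lfloor>x\<rfloor>. chaos.fac p h \<omega>)"
    unfolding euler_product_def set using fac by (intro prod.cong) auto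
  also have "\<dots> = (\<Prod>p\<le>nat \<lfloor>x\<rfloor>. chaos.fac p h \<omega>)"
    by (intro prod.mono_neutral_left) (auto simp: chaos.fac_def)
  finally show ?thesis by (simp add: chaos.F_def)
qed

text \<open>\<open>ln x\<close> and the normalisation \<open>chaos.W n\<close> differ by a factor
  \<open>c\<close> that the upper Mertens bound controls; the lower one gives
  \<open>chaos.u n \<ge> ln (ln x)\<close>. The threshold \<open>16\<close> secures
  \<open>n \<ge> 3\<close> and \<open>ln x \<ge> 1\<close>.\<close>

lemma low_moment_le:
  assumes x: "x \<ge> 16" and q: "0 \<le> q" "q \<le> 1"
  shows "(\<integral>\<omega>. (1 / ln x *
             (LBINT h:{0..1}. (norm (euler_product (\<lambda>n. f n \<omega>) x (1 / 2 + \<i> * of_real h)))\<^sup>2))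
           powr q \<partial>M)
        \<le> (2 * exp 4) * (2 * (2 * chaos_constant 2 + 1)) * (sqrt (ln (ln x)) * (1 - q) + 1) powr (- q)"
    (is "(\<integral>\<omega>. ?Y \<omega> \<partial>M) \<le> _")
proof -
  define n where "n = nat \<lfloor>x\<rfloor>"
  have n: "real n \<le> x" "x < real n + 1" "n \<ge> 3"
    using x by (auto simp: n_def le_nat_floor)
  define c where "c = chaos.W n / ln x"
  have lx: "ln x \<ge> 1"
  proof -
    have "exp 1 \<le> x" using exp_le x by linarith
    then show ?thesis using x by (subst ln_ge_iff) auto
  qed
  have c: "0 \<le> c" "c \<le> 2 * exp 4"
  proof -
    have "chaos.W n \<le> 2 * exp 4 * ln (real n)" unfolding chaos_W by (rule mertens_product_le[OF n(3)])
    also have "\<dots> \<le> 2 * exp 4 * ln x" using n by (intro mult_left_mono) auto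
    finally show "c \<le> 2 * exp 4" using lx by (simp add: c_def field_simps)
    show "0 \<le> c" using lx chaos.W_pos[of n] by (simp add: c_def)
  qed
  have uge: "chaos.u n \<ge> ln (ln x)"
  proof -
    have "ln x \<le> ln (real n + 1)" using n x by simp
    also have "\<dots> \<le> chaos.W n" unfolding chaos_W by (rule ln_le_mertens_product)
    finally have "ln (ln x) \<le> ln (chaos.W n)" using lx by simp
    then show ?thesis by (simp add: chaos.u_def)
  qed
  \<comment> \<open>Countably many primes: one null set serves them all.\<close>
  have "AE \<omega> in M. \<forall>p\<in>{p. prime p}. norm (Z p \<omega>) = 1"
    by (subst AE_ball_countable) (auto intro: AE_norm_Z)
  then have ae: "AE \<omega> in M. ?Y \<omega> = c powr q * chaos.mass n \<omega> powr q"
    using AE_space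
  proof eventually_elim
    case (elim \<omega>)
    have "(LBINT h:{0..1}. (norm (euler_product (\<lambda>n. f n \<omega>) x (1 / 2 + \<i> * of_real h)))\<^sup>2) = chaos.W n * chaos.mass n \<omega>"
      using elim x chaos.W_pos[of n]
      by (simp add: euler_product_eq n_def[symmetric] chaos.mass_def integral_unit_interval)
    then show ?case using c(1) chaos.mass_nonneg[of n \<omega>] by (simp add: c_def flip: powr_mult)
  qed
  have "(\<integral>\<omega>. ?Y \<omega> \<partial>M) \<le> (\<integral>\<omega>. c powr q * chaos.mass n \<omega> powr q \<partial>M)"
    \<comment> \<open>The case split replaces a measurability proof: a non-integrable integrand has integral \<open>0\<close>.\<close>
  proof (cases "integrable M ?Y")
    case True
    then have "(\<integral>\<omega>. ?Y \<omega> \<partial>M) = (\<integral>\<omega>. c powr q * chaos.mass n \<omega> powr q \<partial>M)"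
      using ae by (intro integral_cong_AE) auto
    then show ?thesis by simp
  next
    case False
    then show ?thesis by (simp add: not_integrable_integral_eq integral_nonneg_AE)
  qed
  also have "\<dots> = c powr q * (\<integral>\<omega>. chaos.mass n \<omega> powr q \<partial>M)" by simp
  also have "\<dots> \<le> (2 * exp 4) * (2 * (2 * chaos_constant 2 + 1) * (sqrt (chaos.u n) * (1 - q) + 1) powr (-q))"
  proof (intro mult_mono)
    have "c powr q \<le> (2 * exp 4) powr q" using c q by (intro powr_mono2) auto
    also have "\<dots> \<le> (2 * exp 4) powr 1"
    proof (intro powr_mono)
      have "(1::real) \<le> exp 4" by simp
      then show "(1::real) \<le> 2 * exp 4" by linarith
    qed (use q in auto)
    finally show "c powr q \<le> 2 * exp 4" by simp
    show "(\<integral>\<omega>. chaos.mass n \<omega> powr q \<partial>M) \<le> 2 * (2 * chaos_constant 2 + 1) * (sqrt (chaos.u n) * (1 - q) + 1) powr (-q)"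
      by (rule chaos.mass_moment_le[OF chaos_frequency_sum_le chaos_square_frequency_sum_le q])
  qed (auto intro!: integral_nonneg_AE)
  also have "\<dots> \<le> (2 * exp 4) * (2 * (2 * chaos_constant 2 + 1) * (sqrt (ln (ln x)) * (1 - q) + 1) powr (-q))"
  proof (intro mult_left_mono powr_mono2')
    have "ln (ln x) \<ge> 0" using lx by simp
    then show "0 < sqrt (ln (ln x)) * (1 - q) + 1" using q by (intro add_nonneg_pos mult_nonneg_nonneg) auto
    show "sqrt (ln (ln x)) * (1 - q) + 1 \<le> sqrt (chaos.u n) * (1 - q) + 1"
      using uge q by (intro add_right_mono mult_right_mono) auto
    show "0 \<le> 2 * (2 * chaos_constant 2 + 1)" by (simp add: chaos_constant_def)
  qed (use q in auto)
  finally show ?thesis by (simp add: mult_ac)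
qed

end

theorem proposition1p2:
  shows "\<exists>K x0 :: real. K > 0 \<and> x0 > 0 \<and>
    (\<forall>(M :: 'a measure) Z f. steinhaus M Z f \<longrightarrow>
      (\<forall>x q. x \<ge> x0 \<longrightarrow> 0 \<le> q \<longrightarrow> q \<le> 1 \<longrightarrow>
        (\<integral>\<omega>. (1 / ln x *
             (LBINT h:{0..1}. (norm (euler_product (\<lambda>n. f n \<omega>) x (1 / 2 + \<i> * of_real h)))\<^sup>2))
           powr q \<partial>M)
        \<le> K * (sqrt (ln (ln x)) * (1 - q) + 1) powr (- q)))"
proof (intro exI conjI allI impI)
  have "chaos_constant 2 > 0" by (auto simp: chaos_constant_def intro!: add_nonneg_pos)
  then show "(2 * exp 4) * (2 * (2 * chaos_constant 2 + 1)) > (0::real)" by simp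
  show "(16::real) > 0" by simp
  fix M :: "'a measure" and Z f and x q :: real
  assume "steinhaus M Z f" "x \<ge> 16" "0 \<le> q" "q \<le> 1"
  then show "(\<integral>\<omega>. (1 / ln x *
             (LBINT h:{0..1}. (norm (euler_product (\<lambda>n. f n \<omega>) x (1 / 2 + \<i> * of_real h)))\<^sup>2))
           powr q \<partial>M)
        \<le> (2 * exp 4) * (2 * (2 * chaos_constant 2 + 1)) * (sqrt (ln (ln x)) * (1 - q) + 1) powr (- q)"
    by (rule steinhaus.low_moment_le)
qed

end
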